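(* Let $N,M,d\ge 1$ be integers. Let $(X_s)_{s\in\mathbb{R}^N_+}$ be an $N$-parameter Lévy process with values in $\mathbb{R}^d$, with associated semigroup $T_s h(x)=\mathbb{E}\,h(x+X_s)$, $s\in\mathbb{R}^N_+$, $h\in\mathcal{C}_0(\mathbb{R}^d)$, and generator $G=(G_1,\dots,G_N)$. Let $(H_t)_{t\in\mathbb{R}^M_+}$ be a subordinator field with values in $\mathbb{R}^N_+$, independent of $(X_s)_{s\in\mathbb{R}^N_+}$, and for $k=1,\dots,M$ let $b_k\in\mathbb{R}^N_+$ and $\phi_k$ be the drift vector and the Lévy measure of the one-parameter process $(H_{t_ke_k})_{t_k\ge 0}$, where $\{e_1,\dots,e_M\}$ is the canonical basis of $\mathbb{R}^M$. Let $Z_t=X_{H_t}$, $t\in\mathbb{R}^M_+$, be the subordinated field (which is an $M$-parameter Lévy process), let $T^Z_t h(x)=\mathbb{E}\,h(x+Z_t)$, $t\in\mathbb{R}^M_+$, $h\in\mathcal{C}_0(\mathbb{R}^d)$, be its semigroup, and let $G^Z=(G^Z_1,\dots,G^Z_M)$ be the generator of $(T^Z_t)_{t\in\mathbb{R}^M_+}$. Then for each $k=1,\dots,M$ and each $h$ in the Schwartz space $\mathcal{S}(\mathbb{R}^d)$, $$G^Z_k h(x)= b_k\cdot G\,h(x)+\int_{\mathbb{R}^N_+}\bigl(T_z h(x)-h(x)\bigr)\,\phi_k(dz),$$ where $b_k\cdot G=\sum_{j=1}^N (b_k)_jG_j$.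
   Context: $\mathbb{R}^N_+=[0,\infty)^N$ with the partial order $a\preceq b$ iff $a_j\le b_j$ for all $j$. $\mathcal{C}_0(\mathbb{R}^d)$ is the space of continuous functions vanishing at infinity with the sup-norm. A function on $\mathbb{R}^N_+$ is right continuous at $x$ if $f(x_i)\to f(x)$ for every $\preceq$-decreasing sequence $x_i\to x$; it has left limits at $x\ne0$ if $\lim f(x_i)$ exists for every $\preceq$-increasing sequence $x_i\to x$ (the limit may depend on the sequence); it is cadlag if it is right continuous everywhere and has left limits at every $x\neq 0$. An $N$-parameter (Multiparameter) Lévy process $(X_t)_{t\in\mathbb{R}^N_+}$ with values in $\mathbb{R}^d$ is a random field such that: (1) $X_0=0$ a.s.; (2) for any $0=t^{(0)}\preceq t^{(1)}\preceq\dots\preceq t^{(k)}$ the increments $X_{t^{(j)}}-X_{t^{(j-1)}}$, $j=1,\dots,k$, are independent; (3) $X_{t+\tau}-X_t\overset{d}{=}X_\tau$ for all $t,\tau\in\mathbb{R}^N_+$; (4) its paths are a.s. cadlag; (5) it is continuous in probability. A subordinator field $(H_t)_{t\in\mathbb{R}^M_+}$ with values in $\mathbb{R}^N_+$ is an $M$-parameter Lévy process taking values in $\mathbb{R}^N_+$ almost surely. For each $k$, $(H_{t_ke_k})_{t_k\ge0}$ is then a one-parameter Lévy process with values in $\mathbb{R}^N_+$, and $\mathbb{E}e^{-\lambda\cdot H_{t_ke_k}}=e^{-t_kS_k(\lambda)}$, $\lambda\in\mathbb{R}^N_+$, with $S_k(\lambda)=b_k\cdot\lambda+\int_{\mathbb{R}^N_+}(1-e^{-\lambda\cdot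 x})\phi_k(dx)$, where $b_k\in\mathbb{R}^N_+$ and $\phi_k$ is a Lévy measure supported on $\mathbb{R}^N_+$ with $\int_{\mathbb{R}^N_+}\min(|x|,1)\phi_k(dx)<\infty$. The generator of a strongly continuous $N$-parameter semigroup $(T_t)_{t\in\mathbb{R}^N_+}$ (i.e. bounded operators with $T_0=I$, $T_{s+t}=T_sT_t$, $T_tu\to u$ as $t\to0$) is the vector $G=(G_1,\dots,G_N)$, where $G_i$ is the generator of the one-parameter marginal semigroup $(T_{t_ie_i})_{t_i\ge0}$, with $Dom(G)=\bigcap_{j}Dom(G_j)$. The semigroups $T_t$ and $T^Z_t$ above are strongly continuous contraction semigroups on $\mathcal{C}_0(\mathbb{R}^d)$. *)

theory Defs
  imports "HOL-Probability.Probability"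
begin

text \<open>The parameter set of all nonnegative vectors is \<open>{0..} :: (real ^ 'n) set\<close>, for the
  componentwise order of the library; \<open>axis k t\<close> is \<open>t\<close> times the \<open>k\<close>-th canonical basis vector.
  Random fields are functions on the whole of \<open>real ^ 'n\<close> whose values outside \<open>{0..}\<close> are
  irrelevant.\<close>

section \<open>Multiparameter Levy processes\<close>

definition right_continuous_at :: "(real ^ 'n \<Rightarrow> 'b::topological_space) \<Rightarrow> real ^ 'n \<Rightarrow> bool" where
  "right_continuous_at f t \<longleftrightarrow>
     (\<forall>s. (\<forall>i. s i \<in> {0..}) \<and> decseq s \<and> s \<longlonglongrightarrow> t \<longrightarrow> (\<lambda>i. f (s i)) \<longlonglongrightarrow> f t)"

text \<open>The limit may depend on the sequence.\<close>

definition has_left_limits_at :: "(real ^ 'n \<Rightarrow> 'b::topological_space) \<Rightarrow> real ^ 'n \<Rightarrow> bool" where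
  "has_left_limits_at f t \<longleftrightarrow>
     (\<forall>s. (\<forall>i. s i \<in> {0..}) \<and> incseq s \<and> s \<longlonglongrightarrow> t \<longrightarrow> convergent (\<lambda>i. f (s i)))"

definition cadlag :: "(real ^ 'n \<Rightarrow> 'b::topological_space) \<Rightarrow> bool" where
  "cadlag f \<longleftrightarrow>
     (\<forall>t\<in>{0..}. right_continuous_at f t) \<and> (\<forall>t\<in>{0..} - {0}. has_left_limits_at f t)"

definition levy_field :: "'a measure \<Rightarrow> (real ^ 'n \<Rightarrow> 'a \<Rightarrow> 'b::euclidean_space) \<Rightarrow> bool" where
  "levy_field M X \<longleftrightarrow>
     prob_space M \<and>
     (\<forall>t\<in>{0..}. X t \<in> borel_measurable M) \<and>
     (AE \<omega> in M. X 0 \<omega> = 0) \<and>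
     (\<forall>(t :: nat \<Rightarrow> real ^ 'n) k. t 0 = 0 \<and> (\<forall>j<k. t j \<le> t (Suc j)) \<longrightarrow>
        prob_space.indep_vars M (\<lambda>_. borel) (\<lambda>j \<omega>. X (t (Suc j)) \<omega> - X (t j) \<omega>) {..<k}) \<and>
     (\<forall>t\<in>{0..}. \<forall>\<tau>\<in>{0..}.
        distr M borel (\<lambda>\<omega>. X (t + \<tau>) \<omega> - X t \<omega>) = distr M borel (X \<tau>)) \<and>
     (AE \<omega> in M. cadlag (\<lambda>t. X t \<omega>)) \<and>
     (\<forall>t\<in>{0..}. \<forall>\<epsilon>>0.
        ((\<lambda>s. measure M {\<omega> \<in> space M. norm (X s \<omega> - X t \<omega>) > \<epsilon>}) \<longlongrightarrow> 0) (at t within {0..}))"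

definition subordinator_field :: "'a measure \<Rightarrow> (real ^ 'm \<Rightarrow> 'a \<Rightarrow> real ^ 'n) \<Rightarrow> bool" where
  "subordinator_field M H \<longleftrightarrow> levy_field M H \<and> (\<forall>t\<in>{0..}. AE \<omega> in M. H t \<omega> \<in> {0..})"

text \<open>Independence of the sigma-algebras generated by the two fields; the library's
  \<open>indep_var\<close> would force both fields to have the same type.\<close>

definition indep_fields ::
  "'a measure \<Rightarrow> (real ^ 'n \<Rightarrow> 'a \<Rightarrow> 'b::euclidean_space) \<Rightarrow> (real ^ 'm \<Rightarrow> 'a \<Rightarrow> 'c::euclidean_space) \<Rightarrow> bool"
  where
  "indep_fields M X H \<longleftrightarrow>
     prob_space.indep_set M
       (sets (vimage_algebra (space M) (\<lambda>\<omega>. \<lambda>s\<in>{0..}. X s \<omega>) (PiM {0..} (\<lambda>_. borel))))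
       (sets (vimage_algebra (space M) (\<lambda>\<omega>. \<lambda>t\<in>{0..}. H t \<omega>) (PiM {0..} (\<lambda>_. borel))))"

definition subordinated_field ::
  "(real ^ 'n \<Rightarrow> 'a \<Rightarrow> 'b) \<Rightarrow> (real ^ 'm \<Rightarrow> 'a \<Rightarrow> real ^ 'n) \<Rightarrow> real ^ 'm \<Rightarrow> 'a \<Rightarrow> 'b" where
  "subordinated_field X H t \<omega> = X (H t \<omega>) \<omega>"

section \<open>Drift and Levy measure of the marginal subordinators\<close>

definition subordinator_levy_measure :: "(real ^ 'n) measure \<Rightarrow> bool" where
  "subordinator_levy_measure \<phi> \<longleftrightarrow>
     sets \<phi> = sets borel \<and> emeasure \<phi> {0} = 0 \<and> emeasure \<phi> (- {0..}) = 0 \<and>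
     (\<integral>\<^sup>+ x. ennreal (min (norm x) 1) \<partial>\<phi>) < \<infinity>"

definition laplace_exponent :: "real ^ 'n \<Rightarrow> (real ^ 'n) measure \<Rightarrow> real ^ 'n \<Rightarrow> real" where
  "laplace_exponent b \<phi> u = b \<bullet> u + (LINT x:{0..}|\<phi>. 1 - exp (- (u \<bullet> x)))"

definition drift_and_levy_measure ::
  "'a measure \<Rightarrow> (real ^ 'm \<Rightarrow> 'a \<Rightarrow> real ^ 'n) \<Rightarrow> 'm \<Rightarrow> real ^ 'n \<Rightarrow> (real ^ 'n) measure \<Rightarrow> bool"
  where
  "drift_and_levy_measure M H k b \<phi> \<longleftrightarrow>
     b \<in> {0..} \<and> subordinator_levy_measure \<phi> \<and>
     (\<forall>t\<ge>0. \<forall>u\<in>{0..}.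
        (\<integral>\<omega>. exp (- (u \<bullet> H (axis k t) \<omega>)) \<partial>M) = exp (- t * laplace_exponent b \<phi> u))"

section \<open>Semigroups and generators\<close>

definition C0 :: "('e::real_normed_vector \<Rightarrow> 'b::real_normed_vector) set" where
  "C0 = {f. continuous_on UNIV f \<and> (f \<longlongrightarrow> 0) at_infinity}"

text \<open>The expectation is taken in the completion of \<open>M\<close>, which changes nothing for
  \<open>M\<close>-measurable integrands. It is needed for the subordinated field: paths are only almost surely
  cadlag, so \<open>X\<^bsub>H\<^esub>\<close> is measurable only up to null sets.\<close>

definition field_semigroup ::
  "'a measure \<Rightarrow> (real ^ 'n \<Rightarrow> 'a \<Rightarrow> 'e::euclidean_space) \<Rightarrow>
     real ^ 'n \<Rightarrow> ('e \<Rightarrow> 'b::euclidean_space) \<Rightarrow> 'e \<Rightarrow> 'b" where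
  "field_semigroup M X s h x = (\<integral>\<omega>. h (x + X s \<omega>) \<partial>(completion M))"

text \<open>One-parameter generators on \<^term>\<open>C0\<close>; convergence in the sup-norm is uniform convergence.\<close>

definition is_generator_value ::
  "(real \<Rightarrow> ('e::euclidean_space \<Rightarrow> 'b::euclidean_space) \<Rightarrow> 'e \<Rightarrow> 'b) \<Rightarrow> ('e \<Rightarrow> 'b) \<Rightarrow> ('e \<Rightarrow> 'b) \<Rightarrow> bool" where
  "is_generator_value T h g \<longleftrightarrow> h \<in> C0 \<and> g \<in> C0 \<and>
     uniform_limit UNIV (\<lambda>t x. (T t h x - h x) /\<^sub>R t) g (at_right 0)"

definition generator_domain1 ::
  "(real \<Rightarrow> ('e::euclidean_space \<Rightarrow> 'b::euclidean_space) \<Rightarrow> 'e \<Rightarrow> 'b) \<Rightarrow> ('e \<Rightarrow> 'b) set" where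
  "generator_domain1 T = {h. \<exists>g. is_generator_value T h g}"

definition generator1 ::
  "(real \<Rightarrow> ('e::euclidean_space \<Rightarrow> 'b::euclidean_space) \<Rightarrow> 'e \<Rightarrow> 'b) \<Rightarrow> ('e \<Rightarrow> 'b) \<Rightarrow> 'e \<Rightarrow> 'b" where
  "generator1 T h = (THE g. is_generator_value T h g)"

text \<open>Multiparameter semigroups: the \<open>i\<close>-th component of the generator, and the domain of the
  whole vector.\<close>

definition generator ::
  "(real ^ 'n \<Rightarrow> ('e::euclidean_space \<Rightarrow> 'b::euclidean_space) \<Rightarrow> 'e \<Rightarrow> 'b) \<Rightarrow> 'n \<Rightarrow> ('e \<Rightarrow> 'b) \<Rightarrow> 'e \<Rightarrow> 'b" where
  "generator T i = generator1 (\<lambda>t. T (axis i t))"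

definition generator_domain ::
  "(real ^ 'n \<Rightarrow> ('e::euclidean_space \<Rightarrow> 'b::euclidean_space) \<Rightarrow> 'e \<Rightarrow> 'b) \<Rightarrow> ('e \<Rightarrow> 'b) set" where
  "generator_domain T = (\<Inter>i. generator_domain1 (\<lambda>t. T (axis i t)))"

section \<open>The Schwartz space\<close>

definition partial_deriv ::
  "'d \<Rightarrow> (real ^ 'd \<Rightarrow> 'b::real_normed_vector) \<Rightarrow> real ^ 'd \<Rightarrow> 'b" where
  "partial_deriv i f x = vector_derivative (\<lambda>s. f (x + axis i s)) (at 0)"

text \<open>A list of indices \<open>[i\<^sub>1, \<dots>, i\<^sub>m]\<close> stands for the mixed partial derivative
  in these directions, so that all partial derivatives of all orders are covered.\<close>

definition Schwartz_space :: "(real ^ 'd \<Rightarrow> 'b::real_normed_vector) set" where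
  "Schwartz_space = {h. \<forall>js.
     (\<forall>x. foldr partial_deriv js h differentiable at x) \<and>
     (\<forall>\<alpha> :: 'd \<Rightarrow> nat.
        bounded (range (\<lambda>x. (\<Prod>i\<in>UNIV. (x $ i) ^ \<alpha> i) *\<^sub>R foldr partial_deriv js h x)))}"

end

theory Submission
  imports Defs
begin

text \<open>Let \<open>T\<^sub>t\<close> be a convolution semigroup. Telescoping gives
  \<open>T\<^bsub>ns\<^esub> f - f - n (T\<^sub>s f - f) = (T\<^sub>s - I) (\<Sum>i<n. T\<^bsub>is\<^esub> f - f)\<close>, and for smooth \<open>f\<close> the functions
  \<open>T\<^bsub>is\<^esub> f - f\<close> are small together with two derivatives when \<open>ns\<close> is small. By Taylor expansion, the operators
  \<open>(T\<^sub>s - I) / s\<close> are bounded in the \<open>C\<^sup>2\<close> norm by their values on two explicit test functions; applying the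
  identity to these functions first bounds the operators uniformly in \<open>s\<close>, and then shows that
  \<open>(T\<^sub>s f - f) / s\<close> is uniformly Cauchy as \<open>s\<close> tends to \<open>0\<close>. Hence smooth functions lie in the domain of every
  marginal generator, both for \<open>X\<close> and for the subordinated field, without the Levy-Khintchine formula.

  It remains to identify the generator pointwise. Here \<open>T\<^sup>Z\<^sub>t h (x) - h (x) = \<integral> F d\<nu>\<^sub>t\<close>, where \<open>\<nu>\<^sub>t\<close> is the law of the
  subordinator and \<open>F s = T\<^sub>s h (x) - h (x)\<close> is continuous, bounded, and differentiable at \<open>0\<close> in the orthant with
  partial derivatives \<open>G\<^sub>j h (x)\<close>. The Laplace transforms of \<open>(1 - exp (- (s\<^sub>1 + \<dots> + s\<^sub>N))) \<nu>\<^sub>t / t\<close> converge, hence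
  so do these measures, and this gives the limit of \<open>(\<integral> F d\<nu>\<^sub>t) / t\<close>.\<close>

section \<open>Convolution operators on bounded Lipschitz functions\<close>

text \<open>The generator asks for a limit in the sup-norm, whereas Laplace transforms of the
  subordinator give a limit for each point \<open>x\<close> separately. So existence and value are
  settled by different means: telescoping yields uniform convergence without a formula, and
  uniqueness of the pointwise limit supplies the formula. The size of the inner difference is
  measured by the integral of \<open>min (norm z) 1\<close>, which costs one derivative on top of
  the two of a Taylor expansion; hence the order three. The weight
  \<open>1 - exp (- (1 \<bullet> s))\<close> vanishes at 0 like \<open>s\<close> and is bounded
  below away from 0, so it makes the possibly infinite Levy measure finite. In the limit of the
  weighted laws the drift turns into a point mass at 0 of size \<open>1 \<bullet> b\<close>, which
  has lost the direction of \<open>b\<close>. The direction is recovered from the linear part of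
  \<open>F\<close>, whose contribution tends to a combination of the Laplace exponents at the basis
  vectors; the remainder, divided by the weight, vanishes at 0 and does not see the point
  mass.\<close>

definition cv :: "'e::euclidean_space measure \<Rightarrow> ('e \<Rightarrow> 'v::euclidean_space) \<Rightarrow> 'e \<Rightarrow> 'v" where
  "cv \<mu> f x = (\<integral>y. f (x + y) \<partial>\<mu>)"

text \<open>One constant serves for both estimates because convolution with a probability measure
  preserves both (\<open>bdlip_cv\<close>), and together they bound \<open>f (x + z) - f x\<close>
  by a multiple of \<open>min (norm z) 1\<close>.\<close>

definition bdlip :: "real \<Rightarrow> ('e::real_normed_vector \<Rightarrow> 'v::real_normed_vector) \<Rightarrow> bool" where
  "bdlip C f \<longleftrightarrow> (\<forall>x. norm (f x) \<le> C) \<and> (\<forall>x y. norm (f x - f y) \<le> C * norm (x - y))"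

lemma bdlip_nonneg: "bdlip C f \<Longrightarrow> 0 \<le> C"
  unfolding bdlip_def by (meson norm_ge_zero order_trans)

lemma bdlip_continuous: "bdlip C f \<Longrightarrow> continuous_on A f"
  by (rule lipschitz_on_continuous_on[where L=C], rule lipschitz_onI)
     (auto simp: bdlip_nonneg dist_norm bdlip_def)

lemma bdlip_measurable:
  fixes f :: "'e::euclidean_space \<Rightarrow> 'v::euclidean_space"
  shows "bdlip C f \<Longrightarrow> f \<in> borel_measurable borel"
  by (intro borel_measurable_continuous_onI bdlip_continuous)

lemma bdlip_diff: "bdlip C f \<Longrightarrow> bdlip D g \<Longrightarrow> bdlip (C + D) (\<lambda>x. f x - g x)"
  unfolding bdlip_def
proof (intro conjI allI)
  fix x y
  assume a: "(\<forall>x. norm (f x) \<le> C) \<and> (\<forall>x y. norm (f x - f y) \<le> C * norm (x - y))"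
    "(\<forall>x. norm (g x) \<le> D) \<and> (\<forall>x y. norm (g x - g y) \<le> D * norm (x - y))"
  show "norm (f x - g x) \<le> C + D"
    using a norm_triangle_ineq4[of "f x" "g x"] by (meson add_mono order_trans)
  have "norm (f x - g x - (f y - g y)) \<le> norm (f x - f y) + norm (g x - g y)"
    using norm_triangle_ineq4[of "f x - f y" "g x - g y"] by (simp add: algebra_simps)
  also have "\<dots> \<le> C * norm (x - y) + D * norm (x - y)"
    using a by (intro add_mono) auto
  finally show "norm (f x - g x - (f y - g y)) \<le> (C + D) * norm (x - y)"
    by (simp add: algebra_simps)
qed

lemma bdlip_inner: "bdlip C f \<Longrightarrow> norm b = 1 \<Longrightarrow> bdlip C (\<lambda>x. f x \<bullet> b)"
  unfolding bdlip_def real_norm_def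
  by (metis Cauchy_Schwarz_ineq2 inner_diff_left mult.right_neutral order_trans)

lemma bdlip_min_norm: "bdlip 1 (\<lambda>z::'e::euclidean_space. min (norm z) 1)"
  unfolding bdlip_def
proof (intro conjI allI)
  fix x y :: 'e
  have "\<bar>min (norm x) 1 - min (norm y) 1\<bar> \<le> \<bar>norm x - norm y\<bar>" by (auto simp: min_def)
  then show "norm (min (norm x) 1 - min (norm y) 1) \<le> 1 * norm (x - y)"
    using norm_triangle_ineq3[of x y] by simp
qed auto

text \<open>The constant \<open>K\<close> measures the size of \<open>g\<close> in the twice differentiable sense,
  without mentioning a second derivative.\<close>

definition taylor_bd :: "real \<Rightarrow> ('e::euclidean_space \<Rightarrow> 'v::euclidean_space) \<Rightarrow> bool" where
  "taylor_bd K g \<longleftrightarrow> (\<forall>x. norm (g x) \<le> K \<and> (\<exists>L. linear L \<and> (\<forall>y. norm (L y) \<le> K * norm y) \<and>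
     (\<forall>y. norm (g (x + y) - g x - L y) \<le> K * (norm y)\<^sup>2)))"

text \<open>\<open>good C f\<close> says that the differences of \<open>f\<close> and its translates by small vectors are
  small in the sense of \<open>taylor_bd\<close>; it holds for \<open>C\<^sup>3\<close> functions with bounded derivatives.\<close>

definition good :: "real \<Rightarrow> ('e::euclidean_space \<Rightarrow> 'v::euclidean_space) \<Rightarrow> bool" where
  "good C f \<longleftrightarrow> bdlip C f \<and> (\<exists>L. (\<forall>x. linear (L x)) \<and> (\<forall>x y z.
     norm (L (x + z) y - L x y) \<le> C * min (norm z) 1 * norm y \<and>
     norm ((f (x + z + y) - f (x + z) - L (x + z) y) - (f (x + y) - f x - L x y))
       \<le> C * min (norm z) 1 * (norm y)\<^sup>2))"

locale borel_prob = prob_space \<mu> for \<mu> :: "'e::euclidean_space measure" +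
  assumes sets_eq [measurable_cong, simp]: "sets \<mu> = sets borel"
begin

lemma space_eq [simp]: "space \<mu> = UNIV"
  using sets_eq_imp_space_eq[OF sets_eq] by simp

lemma measure_UNIV [simp]: "measure \<mu> UNIV = 1"
  using prob_space by simp

lemma bd_integrable:
  fixes f :: "'e \<Rightarrow> 'v::euclidean_space"
  assumes "continuous_on UNIV f" "\<And>x. norm (f x) \<le> C"
  shows "integrable \<mu> f"
  using assms by (intro integrable_const_bound[where B=C])
    (auto intro!: borel_measurable_continuous_onI simp: measurable_cong_sets[OF sets_eq refl])

lemma bdlip_integrable:
  fixes f :: "'e \<Rightarrow> 'v::euclidean_space"
  assumes "bdlip C f"
  shows "integrable \<mu> f" "integrable \<mu> (\<lambda>y. f (x + y))"
proof -
  show "integrable \<mu> f"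
    using assms by (intro bd_integrable[where C=C] bdlip_continuous) (auto simp: bdlip_def)
  have "continuous_on UNIV (\<lambda>y. f (x + y))"
    by (rule continuous_on_compose2[OF bdlip_continuous[OF assms]]) (auto intro!: continuous_intros)
  then show "integrable \<mu> (\<lambda>y. f (x + y))"
    using assms by (intro bd_integrable[where C=C]) (auto simp: bdlip_def)
qed

lemma norm_integral_bound:
  fixes f :: "'e \<Rightarrow> 'v::euclidean_space"
  assumes "\<And>y. norm (f y) \<le> B"
  shows "norm (\<integral>y. f y \<partial>\<mu>) \<le> B"
proof (cases "integrable \<mu> f")
  case True
  then have "norm (\<integral>y. f y \<partial>\<mu>) \<le> (\<integral>y. norm (f y) \<partial>\<mu>)" by simp
  also have "\<dots> \<le> (\<integral>y. B \<partial>\<mu>)" using assms True by (intro integral_mono) auto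
  finally show ?thesis by simp
next
  \<comment> \<open>The integral of a nonintegrable function is 0 by convention, and
    \<open>B\<close> is nonnegative because it bounds a norm.\<close>
  case False
  moreover have "0 \<le> B" using assms norm_ge_zero order_trans by blast
  ultimately show ?thesis by (simp add: not_integrable_integral_eq)
qed

lemma cv_bound: "(\<And>y. norm (f y) \<le> B) \<Longrightarrow> norm (cv \<mu> f x) \<le> B"
  unfolding cv_def by (rule norm_integral_bound)

lemma cv_diff:
  "bdlip C f \<Longrightarrow> bdlip D g \<Longrightarrow> cv \<mu> (\<lambda>x. f x - g x) x = cv \<mu> f x - cv \<mu> g x"
  unfolding cv_def by (intro Bochner_Integration.integral_diff bdlip_integrable)

lemma cv_inner: "bdlip C f \<Longrightarrow> cv \<mu> f x \<bullet> b = cv \<mu> (\<lambda>x. f x \<bullet> b) x"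
  unfolding cv_def by (subst integral_inner_left) (auto intro: bdlip_integrable)

text \<open>The Lipschitz estimate bounds the integrand by \<open>C * norm y\<close>, the sup bound
  by \<open>C + C\<close>; the latter is the origin of the factor 2.\<close>

lemma cv_sub_bound:
  assumes "bdlip C f"
  shows "norm (cv \<mu> f x - f x) \<le> C * (\<integral>z. min (norm z) 1 \<partial>\<mu>) * 2"
proof -
  have i: "integrable \<mu> (\<lambda>y. f (x + y))" using assms by (rule bdlip_integrable)
  have m: "integrable \<mu> (\<lambda>z. min (norm z) 1)" by (rule bdlip_integrable(1)[OF bdlip_min_norm])
  have "cv \<mu> f x - f x = (\<integral>y. f (x + y) - f x \<partial>\<mu>)"
    unfolding cv_def using i by simp
  also have "norm \<dots> \<le> (\<integral>y. norm (f (x + y) - f x) \<partial>\<mu>)" by simp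
  also have "\<dots> \<le> (\<integral>y. 2 * C * min (norm y) 1 \<partial>\<mu>)"
  proof (rule integral_mono)
    show "norm (f (x + y) - f x) \<le> 2 * C * min (norm y) 1" for y
    proof -
      have "norm (f (x + y) - f x) \<le> C * norm (x + y - x)" using assms unfolding bdlip_def by blast
      moreover have "norm (f (x + y) - f x) \<le> C + C"
        using assms norm_triangle_ineq4[of "f (x+y)" "f x"] unfolding bdlip_def
        by (meson add_mono order_trans)
      moreover have "0 \<le> C * norm y" using bdlip_nonneg[OF assms] by simp
      ultimately show ?thesis by (auto simp: min_def)
    qed
  qed (use i m in auto)
  finally show ?thesis by simp
qed

lemma bdlip_cv:
  assumes "bdlip C f"
  shows "bdlip C (cv \<mu> f)"
  unfolding bdlip_def
proof (intro conjI allI)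
  fix x y
  show "norm (cv \<mu> f x) \<le> C" using assms by (intro cv_bound) (auto simp: bdlip_def)
  have "cv \<mu> f x - cv \<mu> f y = (\<integral>z. f (x + z) - f (y + z) \<partial>\<mu>)"
    unfolding cv_def using assms by (simp add: bdlip_integrable)
  also have "norm \<dots> \<le> C * norm (x - y)"
    using assms unfolding bdlip_def by (intro norm_integral_bound) (metis add_diff_cancel_right)
  finally show "norm (cv \<mu> f x - cv \<mu> f y) \<le> C * norm (x - y)" .
qed

text \<open>The difference is the average over \<open>z\<close> of \<open>f (x + z) - f x\<close>.
  For each \<open>z\<close> this function has a Taylor estimate with constant
  \<open>C * min (norm z) 1\<close>, and such estimates may be integrated; the averaged derivative
  differences serve as the linear map. Only the sup bound requires the factor 2.\<close>

lemma good_taylor_bd: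
  fixes f :: "'e \<Rightarrow> 'v::euclidean_space"
  assumes "good C f"
  shows "taylor_bd (2 * C * (\<integral>z. min (norm z) 1 \<partial>\<mu>)) (\<lambda>x. cv \<mu> f x - f x)"
proof -
  let ?m = "\<lambda>z::'e. min (norm z) 1"
  let ?I = "\<integral>z. ?m z \<partial>\<mu>"
  from assms obtain L where bl: "bdlip C f" and lin: "\<And>x. linear (L x)"
    and L1: "\<And>x y z. norm (L (x + z) y - L x y) \<le> C * ?m z * norm y"
    and L2: "\<And>x y z. norm ((f (x + z + y) - f (x + z) - L (x + z) y) - (f (x + y) - f x - L x y))
       \<le> C * ?m z * (norm y)\<^sup>2"
    unfolding good_def by blast
  have C: "0 \<le> C" using bl by (rule bdlip_nonneg)
  have im: "integrable \<mu> ?m" by (rule bdlip_integrable(1)[OF bdlip_min_norm])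
  have m0: "0 \<le> ?I" by (rule Bochner_Integration.integral_nonneg) auto
  \<comment> \<open>The Lipschitz dependence of \<open>L\<close> on its base point makes the
    integrands measurable in \<open>z\<close>.\<close>
  have contL: "continuous_on UNIV (\<lambda>z. L (x + z) y)" for x y
  proof -
    have "norm (L (x + z') y - L (x + z) y) \<le> (C * norm y) * norm (z' - z)" for z z'
    proof -
      have "norm (L (x + z') y - L (x + z) y) \<le> C * ?m (z' - z) * norm y"
        using L1[of "x + z" "z' - z" y] by simp
      also have "\<dots> \<le> C * norm (z' - z) * norm y"
        using C by (intro mult_right_mono mult_left_mono) auto
      finally show ?thesis by (simp add: algebra_simps)
    qed
    then have "(C * norm y)-lipschitz_on UNIV (\<lambda>z. L (x + z) y)"
      using C by (auto intro!: lipschitz_onI simp: dist_norm)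
    then show ?thesis by (rule lipschitz_on_continuous_on)
  qed
  have iL: "integrable \<mu> (\<lambda>z. L (x + z) y - L x y)" for x y
  proof (rule bd_integrable)
    show "norm (L (x + z) y - L x y) \<le> C * norm y" for z
      using L1[of x z y] C mult_right_mono[OF mult_left_mono[of "?m z" 1 C], of "norm y"] by simp
  qed (intro continuous_intros contL)
  have bnd: "norm (\<integral>z. F z \<partial>\<mu>) \<le> (2 * C * ?I) * B"
    if "integrable \<mu> F" "\<And>z. norm (F z) \<le> C * ?m z * B" "0 \<le> B" for F :: "'e \<Rightarrow> 'v" and B
  proof -
    have "norm (\<integral>z. F z \<partial>\<mu>) \<le> (\<integral>z. norm (F z) \<partial>\<mu>)" by simp
    also have "\<dots> \<le> (\<integral>z. (C * B) * ?m z \<partial>\<mu>)"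
      using that(1,2) im by (intro integral_mono) (auto simp: algebra_simps)
    also have "\<dots> = 1 * (C * ?I * B)" by simp
    also have "\<dots> \<le> 2 * (C * ?I * B)"
      using C m0 that(3) by (intro mult_right_mono) auto
    finally show ?thesis by (simp add: mult_ac)
  qed
  have ie: "cv \<mu> f x - f x = (\<integral>z. f (x + z) - f x \<partial>\<mu>)" for x
    unfolding cv_def using bdlip_integrable(2)[OF bl] by simp
  show ?thesis unfolding taylor_bd_def
  proof (intro allI conjI)
    fix x
    show "norm (cv \<mu> f x - f x) \<le> 2 * C * ?I"
      using cv_sub_bound[OF bl, of x] by (simp add: mult_ac)
    let ?L = "\<lambda>y. \<integral>z. L (x + z) y - L x y \<partial>\<mu>"
    show "\<exists>L. linear L \<and> (\<forall>y. norm (L y) \<le> 2 * C * ?I * norm y) \<and>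
       (\<forall>y. norm (cv \<mu> f (x + y) - f (x + y) - (cv \<mu> f x - f x) - L y)
          \<le> 2 * C * ?I * (norm y)\<^sup>2)"
    proof (intro exI[of _ ?L] conjI allI)
      show "linear ?L"
      proof (rule linearI)
        fix u v
        have "?L (u + v) = (\<integral>z. (L (x + z) u - L x u) + (L (x + z) v - L x v) \<partial>\<mu>)"
          by (intro Bochner_Integration.integral_cong) (auto simp: linear_add[OF lin])
        also have "\<dots> = ?L u + ?L v" by (intro Bochner_Integration.integral_add iL)
        finally show "?L (u + v) = ?L u + ?L v" .
      next
        fix r u
        have "?L (r *\<^sub>R u) = (\<integral>z. r *\<^sub>R (L (x + z) u - L x u) \<partial>\<mu>)"
          by (intro Bochner_Integration.integral_cong)
             (auto simp: linear_scale[OF lin] scaleR_diff_right)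
        then show "?L (r *\<^sub>R u) = r *\<^sub>R ?L u" by simp
      qed
      show "norm (?L y) \<le> 2 * C * ?I * norm y" for y
        by (rule bnd[OF iL L1]) simp
      fix y
      have i1: "integrable \<mu> (\<lambda>z. f (x + y + z) - f (x + y))" "integrable \<mu> (\<lambda>z. f (x + z) - f x)"
        using bdlip_integrable(2)[OF bl] by auto
      have "cv \<mu> f (x + y) - f (x + y) - (cv \<mu> f x - f x) - ?L y =
        (\<integral>z. (f (x + y + z) - f (x + y)) - (f (x + z) - f x) - (L (x + z) y - L x y) \<partial>\<mu>)"
        unfolding ie using i1 iL[of x y] by simp
      also have "\<dots> = (\<integral>z. (f (x + z + y) - f (x + z) - L (x + z) y) - (f (x + y) - f x - L x y) \<partial>\<mu>)"
        by (intro Bochner_Integration.integral_cong) (auto simp: algebra_simps)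
      also have "norm \<dots> \<le> 2 * C * ?I * (norm y)\<^sup>2"
      proof (rule bnd[OF _ L2])
        have "(\<lambda>z. (f (x + z + y) - f (x + z) - L (x + z) y) - (f (x + y) - f x - L x y)) =
          (\<lambda>z. (f (x + y + z) - f (x + y)) - (f (x + z) - f x) - (L (x + z) y - L x y))"
          by (auto simp: algebra_simps)
        then show "integrable \<mu> (\<lambda>z. (f (x + z + y) - f (x + z) - L (x + z) y) - (f (x + y) - f x - L x y))"
          using i1 iL[of x y] by simp
      qed simp
      finally show "norm (cv \<mu> f (x + y) - f (x + y) - (cv \<mu> f x - f x) - ?L y)
          \<le> 2 * C * ?I * (norm y)\<^sup>2" .
    qed
  qed
qed

end

section \<open>Functions with bounded derivatives up to order three\<close>

lemma norm_coord_sum_le: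
  fixes g :: "'e::euclidean_space \<Rightarrow> 'v::real_normed_vector"
  assumes "\<And>b. b \<in> Basis \<Longrightarrow> norm (g b) \<le> K"
  shows "norm (\<Sum>b\<in>Basis. (y \<bullet> b) *\<^sub>R g b) \<le> real DIM('e) * K * norm y"
proof -
  have "norm (\<Sum>b\<in>Basis. (y \<bullet> b) *\<^sub>R g b) \<le> (\<Sum>b\<in>(Basis::'e set). K * norm y)"
  proof (rule sum_norm_le)
    fix b :: 'e assume b: "b \<in> Basis"
    have "\<bar>y \<bullet> b\<bar> * norm (g b) \<le> norm y * K"
      using Basis_le_norm[OF b, of y] assms[OF b] by (intro mult_mono) auto
    then show "norm ((y \<bullet> b) *\<^sub>R g b) \<le> K * norm y" by (simp add: mult.commute)
  qed
  then show ?thesis by simp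
qed

lemma coord_sum_diff:
  "(\<Sum>b\<in>Basis. (y \<bullet> b) *\<^sub>R g b) - (\<Sum>b\<in>Basis. (y \<bullet> b) *\<^sub>R g' b)
    = (\<Sum>b\<in>Basis. (y \<bullet> b) *\<^sub>R (g b - (g' b :: 'v::real_normed_vector)))"
  by (simp add: scaleR_diff_right sum_subtractf)

lemma lipschitz_of_derivative_bound:
  fixes f :: "'e::euclidean_space \<Rightarrow> 'v::real_normed_vector"
  assumes "\<And>x. (f has_derivative (\<lambda>y. \<Sum>b\<in>Basis. (y \<bullet> b) *\<^sub>R f1 b x)) (at x)"
    and "\<And>b x. b \<in> Basis \<Longrightarrow> norm (f1 b x) \<le> K"
  shows "norm (f x - f y) \<le> real DIM('e) * K * norm (x - y)"
  using assms
  by (intro differentiable_bound[where S=UNIV and f'="\<lambda>x y. \<Sum>b\<in>Basis. (y \<bullet> b) *\<^sub>R f1 b x"])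
     (auto intro!: onorm_le norm_coord_sum_le)

lemma has_derivative_shift:
  assumes "\<And>x. (f has_derivative D x) (at x)"
  shows "((\<lambda>x. f (x + z)) has_derivative D (x + z)) (at x)"
proof -
  have "((\<lambda>x. x + z) has_derivative (\<lambda>y. y)) (at x)" by (auto intro!: derivative_eq_intros)
  from has_derivative_compose[OF this assms] show ?thesis .
qed

text \<open>The increment \<open>f (w + z) - f w\<close>, as a function of \<open>w\<close>, has a
  derivative whose Lipschitz constant is a multiple of \<open>min (norm z) 1\<close>: its second
  derivatives are increments of \<open>f2\<close>, which the bounds on \<open>f2\<close> and
  \<open>f3\<close> control. Derivatives are given in coordinates so that one mean value estimate
  can be applied at every order.\<close>

lemma smooth_good:
  fixes f :: "'e::euclidean_space \<Rightarrow> 'v::euclidean_space"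
  assumes d1: "\<And>x. (f has_derivative (\<lambda>y. \<Sum>b\<in>Basis. (y \<bullet> b) *\<^sub>R f1 b x)) (at x)"
    and d2: "\<And>b x. b \<in> Basis \<Longrightarrow> (f1 b has_derivative (\<lambda>y. \<Sum>c\<in>Basis. (y \<bullet> c) *\<^sub>R f2 b c x)) (at x)"
    and d3: "\<And>b c x. b \<in> Basis \<Longrightarrow> c \<in> Basis \<Longrightarrow>
      (f2 b c has_derivative (\<lambda>y. \<Sum>e\<in>Basis. (y \<bullet> e) *\<^sub>R f3 b c e x)) (at x)"
    and b0: "\<And>x. norm (f x) \<le> K"
    and b1: "\<And>b x. b \<in> Basis \<Longrightarrow> norm (f1 b x) \<le> K"
    and b2: "\<And>b c x. b \<in> Basis \<Longrightarrow> c \<in> Basis \<Longrightarrow> norm (f2 b c x) \<le> K"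
    and b3: "\<And>b c e x. b \<in> Basis \<Longrightarrow> c \<in> Basis \<Longrightarrow> e \<in> Basis \<Longrightarrow> norm (f3 b c e x) \<le> K"
  shows "\<exists>C. good C f"
proof -
  let ?m = "\<lambda>z::'e. min (norm z) 1"
  define N where "N = real DIM('e)"
  \<comment> \<open>\<open>N * K\<close> is the Lipschitz constant of a function with partial
    derivatives bounded by \<open>K\<close>, and \<open>2 * K\<close> the trivial bound for an
    increment; their sum dominates both cases of the minimum.\<close>
  define E where "E = N * K + 2 * K"
  have N: "1 \<le> N" unfolding N_def by (simp add: Suc_leI)
  have K: "0 \<le> K" using b0 norm_ge_zero order_trans by blast
  have E: "0 \<le> E" using K N by (simp add: E_def)
  have m: "0 \<le> ?m z" for z by simp
  have shift: "norm (g (x + z) - g x) \<le> E * ?m z"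
    if "\<And>x. norm (g x) \<le> K" "\<And>x y. norm (g x - g y) \<le> N * K * norm (x - y)"
    for g :: "'e \<Rightarrow> 'v" and x z
  proof -
    have "norm (g (x + z) - g x) \<le> N * K * norm z" using that(2)[of "x + z" x] by simp
    moreover have "norm (g (x + z) - g x) \<le> K + K"
      using norm_triangle_ineq4[of "g (x + z)" "g x"] that(1) by (meson add_mono order_trans)
    moreover have "0 \<le> N * K * norm z" "0 \<le> 2 * K * norm z" "0 \<le> N * K" using N K by auto
    ultimately show ?thesis unfolding E_def min_def by (auto simp: algebra_simps)
  qed
  have lf: "norm (f x - f y) \<le> N * K * norm (x - y)" for x y
    unfolding N_def by (rule lipschitz_of_derivative_bound[OF d1 b1])
  have l1: "norm (f1 b x - f1 b y) \<le> N * K * norm (x - y)" if "b \<in> Basis" for b x y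
    unfolding N_def by (rule lipschitz_of_derivative_bound[OF d2[OF that] b2[OF that]])
  have l2: "norm (f2 b c x - f2 b c y) \<le> N * K * norm (x - y)" if "b \<in> Basis" "c \<in> Basis" for b c x y
    unfolding N_def by (rule lipschitz_of_derivative_bound[OF d3[OF that] b3[OF that]])
  have s1: "norm (f1 b (x + z) - f1 b x) \<le> E * ?m z" if "b \<in> Basis" for b x z
    by (rule shift) (use b1 l1 that in auto)
  have s2: "norm (f2 b c (x + z) - f2 b c x) \<le> E * ?m z" if "b \<in> Basis" "c \<in> Basis" for b c x z
    by (rule shift) (use b2 l2 that in auto)
  \<comment> \<open>The mean value estimate is applied to the increment of \<open>f1 b\<close> by
    \<open>z\<close>. Its partial derivatives are increments of \<open>f2 b c\<close>, so the bound
    is small in \<open>z\<close> and Lipschitz in the base point at once.\<close>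
  have ss: "norm ((f1 b (x + z) - f1 b x) - (f1 b (y + z) - f1 b y)) \<le> N * (E * ?m z) * norm (x - y)"
    if b: "b \<in> Basis" for b x y z
    unfolding N_def
  proof (rule lipschitz_of_derivative_bound[where ?f1.0="\<lambda>c x. f2 b c (x + z) - f2 b c x"])
    fix x
    have "((\<lambda>x. f1 b (x + z) - f1 b x) has_derivative
       (\<lambda>y. (\<Sum>c\<in>Basis. (y \<bullet> c) *\<^sub>R f2 b c (x + z)) - (\<Sum>c\<in>Basis. (y \<bullet> c) *\<^sub>R f2 b c x))) (at x)"
      by (rule has_derivative_diff[OF has_derivative_shift[OF d2[OF b]] d2[OF b]])
    then show "((\<lambda>x. f1 b (x + z) - f1 b x) has_derivative
       (\<lambda>y. \<Sum>c\<in>Basis. (y \<bullet> c) *\<^sub>R (f2 b c (x + z) - f2 b c x))) (at x)"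
      by (simp only: coord_sum_diff)
  qed (rule s2[OF b])
  define L where "L x y = (\<Sum>b\<in>Basis. (y \<bullet> b) *\<^sub>R f1 b x)" for x y
  have Ld: "L x' y - L x y = (\<Sum>b\<in>Basis. (y \<bullet> b) *\<^sub>R (f1 b x' - f1 b x))" for x x' y
    unfolding L_def by (rule coord_sum_diff)
  have NE: "E \<le> N * N * E" "N * E \<le> N * N * E"
  proof -
    show a: "N * E \<le> N * N * E" using N E mult_right_mono[OF N, of "N * E"] by simp
    show "E \<le> N * N * E" using a mult_right_mono[OF N E] by linarith
  qed
  have R: "norm ((f (x + z + y) - f (x + z) - L (x + z) y) - (f (x + y) - f x - L x y))
       \<le> N * N * E * ?m z * (norm y)\<^sup>2" for x y z
  proof -
    define G where "G w = f (w + z) - f w" for w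
    define G' where "G' w y = L (w + z) y - L w y" for w y
    \<comment> \<open>On the ball of radius \<open>norm y\<close> the derivative of \<open>G\<close>
      varies by at most a multiple of \<open>norm y\<close>, so linearization at \<open>x\<close>
      leaves an error quadratic in \<open>y\<close>.\<close>
    have "norm (G (x + y) - G x - G' x ((x + y) - x)) \<le> norm ((x + y) - x) * (N * N * E * ?m z * norm y)"
    proof (rule differentiable_bound_linearization[where S="cball x (norm y)"])
      show "x + t *\<^sub>R (x + y - x) \<in> cball x (norm y)" if "t \<in> {0..1}" for t :: real
        using that by (auto simp: dist_norm mult_left_le_one_le)
      show "(G has_derivative G' w) (at w within cball x (norm y))" for w
        unfolding G_def[abs_def] G'_def[abs_def] L_def
        by (rule has_derivative_at_withinI[OF has_derivative_diff[OF has_derivative_shift[OF d1] d1]])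
      fix w assume w: "w \<in> cball x (norm y)"
      show "onorm (G' w - G' x) \<le> N * N * E * ?m z * norm y"
      proof (rule onorm_le)
        fix v
        have "(G' w - G' x) v = (\<Sum>b\<in>Basis. (v \<bullet> b) *\<^sub>R ((f1 b (w + z) - f1 b w) - (f1 b (x + z) - f1 b x)))"
          unfolding fun_diff_def G'_def Ld by (rule coord_sum_diff)
        also have "norm \<dots> \<le> N * (N * (E * ?m z) * norm (w - x)) * norm v"
          unfolding N_def by (rule norm_coord_sum_le, rule ss[unfolded N_def])
        also have "\<dots> \<le> N * (N * (E * ?m z) * norm y) * norm v"
          using w N E by (intro mult_right_mono mult_left_mono) (auto simp: dist_norm norm_minus_commute)
        finally show "norm ((G' w - G' x) v) \<le> N * N * E * ?m z * norm y * norm v"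
          by (simp add: mult_ac)
      qed
    qed simp
    then show ?thesis by (simp add: G_def G'_def algebra_simps power2_eq_square)
  qed
  have "good (N * N * E) f"
    unfolding good_def
  proof (intro conjI exI[of _ L] allI)
    have "K \<le> E" "N * K \<le> E" using K N by (auto simp: E_def intro: order_trans[of _ "2 * K"])
    then have c: "K \<le> N * N * E" "N * K \<le> N * N * E" using NE by auto
    show "bdlip (N * N * E) f"
      unfolding bdlip_def using b0 lf c
      by (meson mult_right_mono norm_ge_zero order_trans)
    show "linear (L x)" for x unfolding L_def[abs_def]
      using has_derivative_linear[OF d1] .
    show "norm (L (x + z) y - L x y) \<le> N * N * E * ?m z * norm y" for x y z
    proof -
      have "norm (L (x + z) y - L x y) \<le> N * (E * ?m z) * norm y"
        unfolding Ld N_def using s1 by (intro norm_coord_sum_le) auto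
      also have "\<dots> \<le> N * N * E * ?m z * norm y"
        using NE(2) by (intro mult_right_mono) (auto simp: mult.assoc[symmetric] intro!: mult_right_mono)
      finally show ?thesis .
    qed
  qed (rule R)
  then show ?thesis by blast
qed

text \<open>For a sum of functions of single coordinates all mixed derivatives vanish, so three
  derivatives of one real function suffice. The vectors \<open>v b\<close> allow the same argument
  for \<open>sin_field\<close> (\<open>v b = b\<close>) and \<open>quad_field\<close>
  (\<open>v b = 1\<close>).\<close>

lemma good_coordinate_sum:
  fixes v :: "'e::euclidean_space \<Rightarrow> 'v::euclidean_space"
  assumes d: "\<And>r. (p0 has_real_derivative p1 r) (at r)" "\<And>r. (p1 has_real_derivative p2 r) (at r)"
      "\<And>r. (p2 has_real_derivative p3 r) (at r)"
    and b: "\<And>r. \<bar>p0 r\<bar> \<le> K" "\<And>r. \<bar>p1 r\<bar> \<le> K" "\<And>r. \<bar>p2 r\<bar> \<le> K" "\<And>r. \<bar>p3 r\<bar> \<le> K"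
    and v: "\<And>b. b \<in> Basis \<Longrightarrow> norm (v b) \<le> 1"
  shows "\<exists>C. good C (\<lambda>y. \<Sum>b\<in>Basis. p0 (y \<bullet> b) *\<^sub>R v b)"
proof -
  let ?N = "real DIM('e)"
  have K: "0 \<le> K" using b(1)[of 0] by linarith
  have sm: "\<bar>r\<bar> * norm (v b) \<le> ?N * K" if "\<bar>r\<bar> \<le> K" "b \<in> Basis" for r b
  proof -
    have "\<bar>r\<bar> * norm (v b) \<le> K * 1" using that v K by (intro mult_mono) auto
    also have "\<dots> \<le> ?N * K" using K mult_right_mono[of 1 ?N K] by (simp add: Suc_leI)
    finally show ?thesis .
  qed
  have comp: "((\<lambda>y. p (y \<bullet> b) *\<^sub>R v b) has_derivative (\<lambda>y. (y \<bullet> b) *\<^sub>R p' (x \<bullet> b) *\<^sub>R v b)) (at x)"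
    if "\<And>r. (p has_real_derivative p' r) (at r)" for p p' b x
  proof -
    have i: "((\<lambda>y. y \<bullet> b) has_derivative (\<lambda>y. y \<bullet> b)) (at x)" by (auto intro!: derivative_eq_intros)
    show ?thesis
      using has_derivative_scaleR_left[OF has_derivative_compose[OF i
        that[unfolded has_field_derivative_def]], of "v b"] by (simp add: mult.commute)
  qed
  have pick: "(\<Sum>c\<in>Basis. (y \<bullet> c) *\<^sub>R (if b = c then g else 0)) = (y \<bullet> b) *\<^sub>R (g::'v)" if "b \<in> Basis" for y b :: 'e and g
  proof -
    have "(\<Sum>c\<in>Basis. (y \<bullet> c) *\<^sub>R (if b = c then g else 0)) = (\<Sum>c\<in>Basis. if b = c then (y \<bullet> c) *\<^sub>R g else 0)"
      by (intro sum.cong) auto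
    then show ?thesis using that by simp
  qed
  show ?thesis
  proof (rule smooth_good[where ?f1.0="\<lambda>b y. p1 (y \<bullet> b) *\<^sub>R v b"
      and ?f2.0="\<lambda>b c y. if b = c then p2 (y \<bullet> b) *\<^sub>R v b else 0"
      and ?f3.0="\<lambda>b c e y. if b = e then (if b = c then p3 (y \<bullet> b) *\<^sub>R v b else 0) else 0"
      and K="?N * K"])
    show "((\<lambda>y. \<Sum>b\<in>Basis. p0 (y \<bullet> b) *\<^sub>R v b) has_derivative
       (\<lambda>y. \<Sum>b\<in>Basis. (y \<bullet> b) *\<^sub>R p1 (x \<bullet> b) *\<^sub>R v b)) (at x)" for x
      by (intro has_derivative_sum comp d(1))
    show "((\<lambda>y. p1 (y \<bullet> b) *\<^sub>R v b) has_derivative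
       (\<lambda>y. \<Sum>c\<in>Basis. (y \<bullet> c) *\<^sub>R (if b = c then p2 (x \<bullet> b) *\<^sub>R v b else 0))) (at x)"
      if "b \<in> Basis" for b x
      unfolding pick[OF that] by (rule comp[OF d(2)])
    show "((\<lambda>y. if b = c then p2 (y \<bullet> b) *\<^sub>R v b else 0) has_derivative
       (\<lambda>y. \<Sum>e\<in>Basis. (y \<bullet> e) *\<^sub>R (if b = e then if b = c then p3 (x \<bullet> b) *\<^sub>R v b else 0 else 0))) (at x)"
      if "b \<in> Basis" for b c x
      unfolding pick[OF that] by (cases "b = c") (simp_all add: comp[OF d(3)] del: scaleR_scaleR)
    show "norm (\<Sum>b\<in>Basis. p0 (x \<bullet> b) *\<^sub>R v b) \<le> ?N * K" for x
    proof -
      have "norm (\<Sum>b\<in>Basis. p0 (x \<bullet> b) *\<^sub>R v b) \<le> (\<Sum>b\<in>(Basis::'e set). K * 1)"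
      proof (rule sum_norm_le)
        show "norm (p0 (x \<bullet> b) *\<^sub>R v b) \<le> K * 1" if "b \<in> Basis" for b
          unfolding norm_scaleR using v[OF that] b(1) K by (intro mult_mono) auto
      qed
      then show ?thesis by simp
    qed
  qed (use sm b K in auto)
qed

text \<open>Smooth bounded substitutes for \<open>y\<close> and \<open>norm y ^ 2\<close>, the two terms of a Taylor expansion at \<open>0\<close>.\<close>

definition sin_field :: "'e::euclidean_space \<Rightarrow> 'e" where
  "sin_field y = (\<Sum>b\<in>Basis. sin (y \<bullet> b) *\<^sub>R b)"

definition quad_field :: "'e::euclidean_space \<Rightarrow> real" where
  "quad_field y = (\<Sum>b\<in>Basis. (y \<bullet> b)\<^sup>2 / (1 + (y \<bullet> b)\<^sup>2))"

lemma good_sin_field: "\<exists>C. good C (sin_field :: 'e::euclidean_space \<Rightarrow> 'e)"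
  unfolding sin_field_def[abs_def]
  by (rule good_coordinate_sum[where ?p1.0=cos and ?p2.0="\<lambda>r. - sin r" and ?p3.0="\<lambda>r. - cos r" and K=1])
     (auto intro!: derivative_eq_intros)

lemma good_quad_field: "\<exists>C. good C (quad_field :: 'e::euclidean_space \<Rightarrow> real)"
proof -
  have p: "1 + r\<^sup>2 > 0" "1 + r\<^sup>2 \<noteq> 0" for r :: real
    using zero_le_power2[of r] by linarith+
  have r1: "\<bar>r\<bar> \<le> 1 + r\<^sup>2" for r :: real
  proof -
    have "0 \<le> (\<bar>r\<bar> - 1)\<^sup>2" by simp
    then have "2 * \<bar>r\<bar> \<le> 1 + r\<^sup>2" by (simp add: power2_diff)
    then show ?thesis by linarith
  qed
  have mono: "(1 + r\<^sup>2) ^ m \<le> (1 + r\<^sup>2) ^ n" if "m \<le> n" for r :: real and m n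
    by (rule power_increasing[OF that]) simp
  have e: "(\<lambda>y::'e. \<Sum>b\<in>Basis. (y \<bullet> b)\<^sup>2 / (1 + (y \<bullet> b)\<^sup>2))
     = (\<lambda>y. \<Sum>b\<in>Basis. ((y \<bullet> b)\<^sup>2 / (1 + (y \<bullet> b)\<^sup>2)) *\<^sub>R 1)" by simp
  show ?thesis
    unfolding quad_field_def[abs_def] e
  \<comment> \<open>The value 48 = 24 + 24 comes from the two terms of the third derivative; the
    lower orders have smaller bounds.\<close>
  proof (rule good_coordinate_sum[where ?p0.0="\<lambda>r. r\<^sup>2 / (1 + r\<^sup>2)" and ?p1.0="\<lambda>r. 2 * r / (1 + r\<^sup>2)^2"
      and ?p2.0="\<lambda>r. (2 - 6 * r\<^sup>2) / (1 + r\<^sup>2)^3"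
      and ?p3.0="\<lambda>r. (24 * r^3 - 24 * r) / (1 + r\<^sup>2)^4" and K=48])
    fix r :: real
    have q: "((\<lambda>r. 1 + r\<^sup>2) has_real_derivative 2 * r) (at r)"
      by (auto intro!: derivative_eq_intros)
    show "((\<lambda>r. r\<^sup>2 / (1 + r\<^sup>2)) has_real_derivative 2 * r / (1 + r\<^sup>2)^2) (at r)"
      using p[of r] by (auto intro!: derivative_eq_intros simp: field_simps power2_eq_square)
    have "((\<lambda>r. 2 * r / (1 + r\<^sup>2)^2) has_real_derivative
        (2 * (1 + r\<^sup>2)^2 - 2 * r * (2 * (1 + r\<^sup>2) * (2 * r))) / ((1 + r\<^sup>2)^2 * (1 + r\<^sup>2)^2)) (at r)"
      using p[of r] by (auto intro!: derivative_eq_intros)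
    moreover have "(2 * (1 + r\<^sup>2)^2 - 2 * r * (2 * (1 + r\<^sup>2) * (2 * r))) / ((1 + r\<^sup>2)^2 * (1 + r\<^sup>2)^2)
       = (2 - 6 * r\<^sup>2) / (1 + r\<^sup>2)^3"
    proof -
      define u where "u = 1 + r\<^sup>2"
      have u: "u \<noteq> 0" using p[of r] by (simp add: u_def)
      have "2 * u^2 - 2 * r * (2 * u * (2 * r)) = (2 - 6 * r\<^sup>2) * u"
        by (simp add: u_def power2_eq_square algebra_simps)
      then show ?thesis using u unfolding u_def[symmetric]
        by (simp add: divide_simps power2_eq_square power3_eq_cube)
    qed
    ultimately show "((\<lambda>r. 2 * r / (1 + r\<^sup>2)^2) has_real_derivative (2 - 6 * r\<^sup>2) / (1 + r\<^sup>2)^3) (at r)"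
      by simp
    have "((\<lambda>r. (2 - 6 * r\<^sup>2) / (1 + r\<^sup>2)^3) has_real_derivative
        ((- 12 * r) * (1 + r\<^sup>2)^3 - (2 - 6 * r\<^sup>2) * (3 * (1 + r\<^sup>2)^2 * (2 * r))) / ((1 + r\<^sup>2)^3 * (1 + r\<^sup>2)^3)) (at r)"
      using p[of r] by (auto intro!: derivative_eq_intros)
    moreover have "((- 12 * r) * (1 + r\<^sup>2)^3 - (2 - 6 * r\<^sup>2) * (3 * (1 + r\<^sup>2)^2 * (2 * r))) / ((1 + r\<^sup>2)^3 * (1 + r\<^sup>2)^3)
       = (24 * r^3 - 24 * r) / (1 + r\<^sup>2)^4"
    proof -
      define u where "u = 1 + r\<^sup>2"
      have u: "u \<noteq> 0" using p[of r] by (simp add: u_def)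
      have "(- 12 * r) * u^3 - (2 - 6 * r\<^sup>2) * (3 * u^2 * (2 * r)) = (24 * r^3 - 24 * r) * u^2"
        by (simp add: u_def power2_eq_square power3_eq_cube algebra_simps)
      moreover have "u^3 * u^3 = u^4 * u^2" by (simp add: power_add[symmetric])
      ultimately have "((- 12 * r) * u^3 - (2 - 6 * r\<^sup>2) * (3 * u^2 * (2 * r))) / (u^3 * u^3)
         = ((24 * r^3 - 24 * r) * u^2) / (u^4 * u^2)"
        by (simp only:)
      also have "\<dots> = (24 * r^3 - 24 * r) / u^4"
        by (rule mult_divide_mult_cancel_right) (use u in simp)
      finally show ?thesis unfolding u_def .
    qed
    ultimately show "((\<lambda>r. (2 - 6 * r\<^sup>2) / (1 + r\<^sup>2)^3) has_real_derivative
       (24 * r^3 - 24 * r) / (1 + r\<^sup>2)^4) (at r)"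
      by simp
    show "\<bar>r\<^sup>2 / (1 + r\<^sup>2)\<bar> \<le> 48" using p[of r] by (simp add: field_simps)
    show "\<bar>2 * r / (1 + r\<^sup>2)^2\<bar> \<le> 48"
      using p[of r] mono[of 1 2 r] r1[of r] by (simp add: abs_mult divide_le_eq)
    have "\<bar>2 - 6 * r\<^sup>2\<bar> \<le> 6 * (1 + r\<^sup>2)" by (auto simp: abs_le_iff)
    then show "\<bar>(2 - 6 * r\<^sup>2) / (1 + r\<^sup>2)^3\<bar> \<le> 48"
      using p[of r] mono[of 1 3 r] by (simp add: divide_le_eq)
    have "\<bar>r\<bar> * r\<^sup>2 \<le> (1 + r\<^sup>2) * (1 + r\<^sup>2)" using r1[of r] by (intro mult_mono) auto
    then have "\<bar>r^3\<bar> \<le> (1 + r\<^sup>2)^2" by (simp add: power2_eq_square power3_eq_cube abs_mult)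
    moreover have "\<bar>24 * r^3 - 24 * r\<bar> \<le> 24 * \<bar>r^3\<bar> + 24 * \<bar>r\<bar>" by (auto simp: abs_if)
    ultimately show "\<bar>(24 * r^3 - 24 * r) / (1 + r\<^sup>2)^4\<bar> \<le> 48"
      using p[of r] mono[of 2 4 r] mono[of 1 2 r] r1[of r] by (simp add: divide_le_eq)
  qed auto
qed

section \<open>Schwartz functions\<close>

lemma partial_deriv_eq:
  fixes x :: "real ^ 'a"
  assumes "(g has_derivative g') (at x)"
  shows "partial_deriv i g x = g' (axis i 1)"
proof -
  have z: "axis i 0 = (0 :: real ^ 'a)" by simp
  have "((\<lambda>s. x + axis i s) has_derivative (\<lambda>s. s *\<^sub>R axis i 1)) (at 0)"
  proof -
    have "(\<lambda>s. x + axis i s) = (\<lambda>s. x + s *\<^sub>R axis i (1::real))"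
      by (auto simp: axis_def vec_eq_iff)
    then show ?thesis by (auto intro!: derivative_eq_intros)
  qed
  then have "((\<lambda>s. g (x + axis i s)) has_derivative (\<lambda>s. g' (s *\<^sub>R axis i 1))) (at 0)"
    by (rule has_derivative_compose) (simp only: z add_0_right assms)
  moreover have "g' (s *\<^sub>R axis i 1) = s *\<^sub>R g' (axis i 1)" for s
    using linear_scale[OF has_derivative_linear[OF assms]] .
  ultimately show ?thesis
    unfolding partial_deriv_def by (intro vector_derivative_at) (simp add: has_vector_derivative_def)
qed

text \<open>Every iterated partial derivative is differentiable by definition, so its total
  derivative is assembled from partial derivatives of one order more; the weight exponent
  \<open>\<alpha> = 0\<close> bounds all of them.\<close>

lemma Schwartz_good:
  fixes h :: "real ^ 'd \<Rightarrow> 'v::euclidean_space"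
  assumes h: "h \<in> Schwartz_space"
  shows "\<exists>C. good C h"
proof -
  have diff: "foldr partial_deriv js h differentiable at x" for js x
    using h unfolding Schwartz_space_def by blast
  have sb: "bounded (range (\<lambda>x. (\<Prod>i\<in>UNIV. (x $ i) ^ \<alpha> i) *\<^sub>R foldr partial_deriv js h x))" for js \<alpha>
    using h unfolding Schwartz_space_def by blast
  have "bounded (range (\<lambda>x. foldr partial_deriv js h x))" for js
  proof -
    show ?thesis using sb[of "\<lambda>_. 0" js] by simp
  qed
  then have "\<exists>K. \<forall>x. norm (foldr partial_deriv js h x) \<le> K" for js
    unfolding bounded_iff by auto
  then obtain B where B: "\<And>js x. norm (foldr partial_deriv js h x) \<le> B js" by metis
  define K where "K = Max (B ` {js :: 'd list. set js \<subseteq> UNIV \<and> length js \<le> 3})"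
  have K: "norm (foldr partial_deriv js h x) \<le> K" if "length js \<le> 3" for js x
  proof -
    have "B js \<le> K" unfolding K_def using that
      by (intro Max_ge finite_imageI finite_lists_length_le) auto
    then show ?thesis using B order_trans by blast
  qed
  \<comment> \<open>\<open>smooth_good\<close> runs over basis vectors, the Schwartz space over
    coordinate indices; \<open>ix\<close> translates the former into the latter.\<close>
  define ix where "ix b = (SOME i. b = axis i (1::real))" for b :: "real ^ 'd"
  have ix: "b = axis (ix b) 1" if "b \<in> Basis" for b
    unfolding ix_def by (rule someI_ex) (use that in \<open>auto simp: Basis_vec_def\<close>)
  \<comment> \<open>\<open>foldr\<close> applies the head of the list last, so differentiating once
    more puts a new index in front.\<close>
  have der: "(foldr partial_deriv js h has_derivative
     (\<lambda>y. \<Sum>b\<in>Basis. (y \<bullet> b) *\<^sub>R foldr partial_deriv (ix b # js) h x)) (at x)" for js x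
  proof -
    obtain g' where g': "(foldr partial_deriv js h has_derivative g') (at x)"
      using diff unfolding differentiable_def by blast
    have "g' y = (\<Sum>b\<in>Basis. (y \<bullet> b) *\<^sub>R foldr partial_deriv (ix b # js) h x)" for y
    proof -
      have "g' y = g' (\<Sum>b\<in>Basis. (y \<bullet> b) *\<^sub>R b)" by (simp add: euclidean_representation)
      also have "\<dots> = (\<Sum>b\<in>Basis. (y \<bullet> b) *\<^sub>R g' b)"
        by (simp add: linear_sum[OF has_derivative_linear[OF g']]
            linear_scale[OF has_derivative_linear[OF g']])
      also have "\<dots> = (\<Sum>b\<in>Basis. (y \<bullet> b) *\<^sub>R foldr partial_deriv (ix b # js) h x)"
      proof (intro sum.cong refl)
        fix b :: "real ^ 'd" assume "b \<in> Basis"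
        from partial_deriv_eq[OF g', of "ix b"] ix[OF this, symmetric]
        show "(y \<bullet> b) *\<^sub>R g' b = (y \<bullet> b) *\<^sub>R foldr partial_deriv (ix b # js) h x" by simp
      qed
      finally show ?thesis .
    qed
    then have "g' = (\<lambda>y. \<Sum>b\<in>Basis. (y \<bullet> b) *\<^sub>R foldr partial_deriv (ix b # js) h x)" by (rule ext)
    then show ?thesis using g' by (simp only:)
  qed
  show ?thesis
    by (rule smooth_good[where ?f1.0="\<lambda>b. foldr partial_deriv [ix b] h"
        and ?f2.0="\<lambda>b c. foldr partial_deriv [ix c, ix b] h"
        and ?f3.0="\<lambda>b c e. foldr partial_deriv [ix e, ix c, ix b] h" and K=K])
       (use der[of "[]"] der[of "[_]"] der[of "[_, _]"] K[of "[]"] K[of "[_]"] K[of "[_, _]"]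
         K[of "[_, _, _]"] in simp_all)
qed

text \<open>The weights of degree one already give decay: each product of \<open>x $ i\<close> with
  \<open>h x\<close> is bounded, and \<open>norm x\<close> is at most the sum of the
  \<open>\<bar>x $ i\<bar>\<close>, so \<open>h x\<close> is at most a constant over
  \<open>norm x\<close>.\<close>

lemma Schwartz_C0:
  fixes h :: "real ^ 'd \<Rightarrow> 'v::euclidean_space"
  assumes h: "h \<in> Schwartz_space"
  shows "h \<in> C0"
proof -
  have diff: "h differentiable at x" for x
    using h[unfolded Schwartz_space_def] by (auto dest: spec[of _ "[]"])
  have sb: "bounded (range (\<lambda>x. (\<Prod>i\<in>UNIV. (x $ i) ^ \<alpha> i) *\<^sub>R foldr partial_deriv js h x))" for js \<alpha>
    using h unfolding Schwartz_space_def by blast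
  have "\<exists>K. \<forall>x. \<bar>x $ i\<bar> * norm (h x) \<le> K" for i
  proof -
    note sb[of "\<lambda>j. if j = i then 1 else 0" "[]"]
    moreover have "(\<Prod>j\<in>UNIV. (x $ j) ^ (if j = i then 1 else 0)) = x $ i" for x :: "real ^ 'd"
    proof -
      have "(\<Prod>j\<in>UNIV. (x $ j) ^ (if j = i then 1 else 0)) = (\<Prod>j\<in>UNIV. if j = i then x $ j else 1)"
        by (intro prod.cong) auto
      then show ?thesis by simp
    qed
    ultimately show ?thesis unfolding bounded_iff by auto
  qed
  then obtain K where K: "\<And>i x. \<bar>x $ i\<bar> * norm (h x) \<le> K i" by metis
  have nb: "norm (h x) \<le> (\<Sum>i\<in>UNIV. K i) / norm x" if "x \<noteq> 0" for x
  proof -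
    have "norm x * norm (h x) \<le> (\<Sum>i\<in>UNIV. \<bar>x $ i\<bar>) * norm (h x)"
      by (intro mult_right_mono norm_le_l1_cart) simp
    also have "\<dots> \<le> (\<Sum>i\<in>UNIV. K i)" unfolding sum_distrib_right by (intro sum_mono K)
    finally show ?thesis using that by (simp add: pos_le_divide_eq mult.commute)
  qed
  have "(h \<longlongrightarrow> 0) at_infinity"
  proof (rule Lim_null_comparison)
    show "\<forall>\<^sub>F x in at_infinity. norm (h x) \<le> (\<Sum>i\<in>UNIV. K i) / norm x"
      unfolding eventually_at_infinity using nb by (intro exI[of _ 1]) (metis norm_zero not_one_le_zero)
    show "((\<lambda>x::real ^ 'd. (\<Sum>i\<in>UNIV. K i) / norm x) \<longlongrightarrow> 0) at_infinity"
      by (rule real_tendsto_divide_at_top[OF tendsto_const filterlim_norm_at_top])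
  qed
  moreover have "continuous_on UNIV h"
    using diff by (auto simp: continuous_on_eq_continuous_at intro: differentiable_imp_continuous_within)
  ultimately show ?thesis by (simp add: C0_def)
qed

section \<open>Bounding a convolution operator by the integrals of two test functions\<close>

lemma sin_field_error: "norm (y - sin_field y) \<le> (norm (y::'e::euclidean_space))\<^sup>2"
proof -
  have s: "\<bar>r - sin r\<bar> \<le> r\<^sup>2" for r :: real
  proof -
    have "\<bar>sin r - (\<Sum>m<2. sin_coeff m * r ^ m)\<bar> \<le> inverse (fact 2) * \<bar>r\<bar> ^ 2"
      by (rule Maclaurin_sin_bound)
    then have "\<bar>sin r - r\<bar> \<le> inverse 2 * r\<^sup>2"
      by (simp add: numeral_2_eq_2 sin_coeff_def)
    then have "\<bar>r - sin r\<bar> * 2 \<le> r\<^sup>2" by (simp add: abs_minus_commute)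
    moreover have "\<bar>r - sin r\<bar> \<le> \<bar>r - sin r\<bar> * 2" by simp
    ultimately show ?thesis by (rule order_trans[rotated])
  qed
  have "y - sin_field y = (\<Sum>b\<in>Basis. ((y \<bullet> b) - sin (y \<bullet> b)) *\<^sub>R b)"
    unfolding sin_field_def by (simp add: scaleR_diff_left sum_subtractf euclidean_representation)
  also have "norm \<dots> \<le> (\<Sum>b\<in>(Basis::'e set). (y \<bullet> b)\<^sup>2)"
    using s by (intro sum_norm_le) auto
  also have "\<dots> = (norm y)\<^sup>2"
    unfolding power2_norm_eq_inner by (subst euclidean_inner) (simp add: power2_eq_square)
  finally show ?thesis .
qed

lemma norm_sin_field: "norm (sin_field (y::'e::euclidean_space)) \<le> real DIM('e)"
proof -
  have "norm (sin_field y) \<le> (\<Sum>b\<in>(Basis::'e set). 1)"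
    unfolding sin_field_def by (intro sum_norm_le) auto
  then show ?thesis by simp
qed

lemma quad_field_nonneg: "0 \<le> quad_field y"
  unfolding quad_field_def by (intro sum_nonneg) (auto intro!: divide_nonneg_nonneg)

text \<open>The function \<open>r / (1 + r)\<close> is at least \<open>r / 2\<close> for
  \<open>r \<le> 1\<close> and at least \<open>1 / 2\<close> for \<open>r \<ge> 1\<close>. So either
  all coordinates are small and the summands compare one by one, or a single large coordinate
  suffices.\<close>

lemma quad_field_lower:
  fixes y :: "'e::euclidean_space"
  shows "(norm y)\<^sup>2 \<le> 2 * quad_field y \<or> 1 / 2 \<le> quad_field y"
proof (cases "\<forall>b\<in>Basis. (y \<bullet> b)\<^sup>2 \<le> 1")
  case True
  have "(norm y)\<^sup>2 = (\<Sum>b\<in>(Basis::'e set). (y \<bullet> b)\<^sup>2)"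
    unfolding power2_norm_eq_inner by (subst euclidean_inner) (simp add: power2_eq_square)
  also have "\<dots> \<le> (\<Sum>b\<in>Basis. 2 * ((y \<bullet> b)\<^sup>2 / (1 + (y \<bullet> b)\<^sup>2)))"
  proof (rule sum_mono)
    fix b :: 'e assume "b \<in> Basis"
    then have "(y \<bullet> b)\<^sup>2 \<le> 1" using True by blast
    then have "(y \<bullet> b)\<^sup>2 * (1 + (y \<bullet> b)\<^sup>2) \<le> (y \<bullet> b)\<^sup>2 * 2"
      by (intro mult_left_mono) auto
    moreover have "0 < 1 + (y \<bullet> b)\<^sup>2" using zero_le_power2[of "y \<bullet> b"] by linarith
    ultimately show "(y \<bullet> b)\<^sup>2 \<le> 2 * ((y \<bullet> b)\<^sup>2 / (1 + (y \<bullet> b)\<^sup>2))"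
      by (simp add: pos_le_divide_eq mult.commute)
  qed
  finally show ?thesis unfolding quad_field_def by (simp add: sum_distrib_left)
next
  case False
  then obtain b where b: "b \<in> Basis" "1 < (y \<bullet> b)\<^sup>2" by (auto simp: not_le)
  have "1 / 2 \<le> (y \<bullet> b)\<^sup>2 / (1 + (y \<bullet> b)\<^sup>2)"
    using b(2) by (simp add: pos_le_divide_eq)
  also have "\<dots> \<le> quad_field y"
    unfolding quad_field_def using b(1) by (intro member_le_sum) (auto intro!: divide_nonneg_nonneg)
  finally show ?thesis by blast
qed

text \<open>The increment \<open>g (x + y) - g x\<close> is \<open>L (sin_field y)\<close> up to an
  error dominated by \<open>quad_field y\<close>: for small \<open>y\<close> by Taylor expansion,
  for large \<open>y\<close> because everything is bounded while \<open>quad_field\<close> is at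
  least \<open>1 / 2\<close>. After integration \<open>L\<close> acts on the integral of
  \<open>sin_field\<close>, so two numbers control the operator for all \<open>x\<close> and all
  \<open>g\<close> of size \<open>K\<close>.\<close>

lemma (in borel_prob) taylor_bd_cv_bound:
  fixes g :: "'e \<Rightarrow> 'v::euclidean_space"
  assumes "taylor_bd K g" "bdlip C g"
  shows "norm (cv \<mu> g x - g x)
    \<le> K * (4 + 2 * real DIM('e)) * (norm (\<integral>y. sin_field y \<partial>\<mu>) + (\<integral>y. quad_field y \<partial>\<mu>))"
proof -
  let ?N = "real DIM('e)"
  from assms(1) obtain L where L: "linear L" and g: "\<And>x. norm (g x) \<le> K"
    and Lb: "\<And>y. norm (L y) \<le> K * norm y"
    and t: "\<And>y. norm (g (x + y) - g x - L y) \<le> K * (norm y)\<^sup>2"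
    unfolding taylor_bd_def by blast
  have K: "0 \<le> K" using g norm_ge_zero order_trans by blast
  have bl: "bounded_linear L" using L linear_conv_bounded_linear by blast
  obtain C1 C2 where C1: "bdlip C1 (sin_field :: 'e \<Rightarrow> 'e)" and C2: "bdlip C2 (quad_field :: 'e \<Rightarrow> real)"
    using good_sin_field good_quad_field unfolding good_def by blast
  note isf = bdlip_integrable(1)[OF C1] and iq = bdlip_integrable(1)[OF C2]
    and ig = bdlip_integrable(2)[OF assms(2), of x]
  have iL: "integrable \<mu> (\<lambda>y. L (sin_field y))" by (rule integrable_bounded_linear[OF bl isf])
  \<comment> \<open>The case of small \<open>y\<close> needs the factor 4 (two quadratic errors,
    each at most \<open>2 * quad_field y\<close>). For large \<open>y\<close> the bound
    \<open>K * (2 + ?N)\<close> must be at most half of the constant, which gives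
    \<open>4 + 2 * ?N\<close>.\<close>
  have pw: "norm (g (x + y) - g x - L (sin_field y)) \<le> K * (4 + 2 * ?N) * quad_field y" for y
  proof (cases "(norm y)\<^sup>2 \<le> 2 * quad_field y")
    case True
    have "g (x + y) - g x - L (sin_field y) = (g (x + y) - g x - L y) + L (y - sin_field y)"
      by (simp add: linear_diff[OF L])
    also have "norm \<dots> \<le> K * (norm y)\<^sup>2 + K * (norm y)\<^sup>2"
      using t[of y] Lb[of "y - sin_field y"] mult_left_mono[OF sin_field_error K, of y]
      by (intro norm_triangle_le add_mono) auto
    also have "\<dots> \<le> K * (2 * (2 * quad_field y))"
      using mult_left_mono[OF True K] by simp
    also have "\<dots> \<le> K * ((4 + 2 * ?N) * quad_field y)"
      using K quad_field_nonneg[of y] by (intro mult_left_mono) (auto intro: mult_right_mono)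
    finally show ?thesis by (simp add: mult.assoc)
  next
    case False
    then have q: "1 / 2 \<le> quad_field y" using quad_field_lower[of y] by blast
    have "norm (g (x + y) - g x - L (sin_field y)) \<le> norm (g (x + y)) + norm (g x) + norm (L (sin_field y))"
      by (meson norm_triangle_ineq4 norm_triangle_le_diff order_refl order_trans add_mono)
    also have "\<dots> \<le> K + K + K * ?N"
      using g Lb[of "sin_field y"] mult_left_mono[OF norm_sin_field K, of y]
      by (intro add_mono) auto
    also have "\<dots> \<le> K * (4 + 2 * ?N) * (1/2)" by (simp add: algebra_simps)
    also have "\<dots> \<le> K * (4 + 2 * ?N) * quad_field y"
      using q K by (intro mult_left_mono) auto
    finally show ?thesis .
  qed
  have "cv \<mu> g x - g x = (\<integral>y. g (x + y) - g x - L (sin_field y) \<partial>\<mu>) + L (\<integral>y. sin_field y \<partial>\<mu>)"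
    unfolding cv_def using ig iL integral_bounded_linear[OF bl isf] by simp
  also have "norm \<dots> \<le> K * (4 + 2 * ?N) * (\<integral>y. quad_field y \<partial>\<mu>)
      + K * (4 + 2 * ?N) * norm (\<integral>y. sin_field y \<partial>\<mu>)"
  proof (intro norm_triangle_le add_mono)
    have "norm (\<integral>y. g (x + y) - g x - L (sin_field y) \<partial>\<mu>)
        \<le> (\<integral>y. norm (g (x + y) - g x - L (sin_field y)) \<partial>\<mu>)" by simp
    also have "\<dots> \<le> (\<integral>y. K * (4 + 2 * ?N) * quad_field y \<partial>\<mu>)"
      using ig iL iq pw by (intro integral_mono) auto
    finally show "norm (\<integral>y. g (x + y) - g x - L (sin_field y) \<partial>\<mu>)
        \<le> K * (4 + 2 * ?N) * (\<integral>y. quad_field y \<partial>\<mu>)" by simp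
    have "norm (L (\<integral>y. sin_field y \<partial>\<mu>)) \<le> K * 1 * norm (\<integral>y. sin_field y \<partial>\<mu>)"
      using Lb by simp
    also have "\<dots> \<le> K * (4 + 2 * ?N) * norm (\<integral>y. sin_field y \<partial>\<mu>)"
      using K by (intro mult_right_mono mult_left_mono) auto
    finally show "norm (L (\<integral>y. sin_field y \<partial>\<mu>)) \<le> K * (4 + 2 * ?N) * norm (\<integral>y. sin_field y \<partial>\<mu>)" .
  qed
  finally show ?thesis by (simp add: algebra_simps)
qed

section \<open>Generators of convolution semigroups\<close>

text \<open>A locale assumption fixes the value type of \<open>f\<close>, so the semigroup law is
  assumed for real functions and carried over to vector values componentwise in \<open>semi\<close>.
  The assumption \<open>cont0\<close> expresses weak convergence to the point mass at 0.\<close>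

locale conv_semigroup =
  fixes \<mu> :: "real \<Rightarrow> 'e::euclidean_space measure"
  assumes prob: "0 \<le> t \<Longrightarrow> borel_prob (\<mu> t)"
    and semi_real: "0 \<le> s \<Longrightarrow> 0 \<le> t \<Longrightarrow> bdlip C (f :: 'e \<Rightarrow> real) \<Longrightarrow>
      cv (\<mu> (s + t)) f x = cv (\<mu> s) (cv (\<mu> t) f) x"
    and zero: "bdlip C (f :: 'e \<Rightarrow> real) \<Longrightarrow> cv (\<mu> 0) f x = f x"
    and cont0: "((\<lambda>t. \<integral>z. min (norm z) 1 \<partial>\<mu> t) \<longlongrightarrow> 0) (at_right 0)"
begin

definition \<kappa> :: "real \<Rightarrow> real" where "\<kappa> r = (\<integral>z. min (norm z) 1 \<partial>\<mu> r)"

text \<open>By \<open>taylor_bd_cv_bound\<close> this number bounds the operator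
  \<open>T_s - I\<close> on functions of given size, up to the factor \<open>c\<close>. The aim is a
  bound linear in \<open>s\<close>.\<close>

definition \<beta> :: "real \<Rightarrow> real" where
  "\<beta> s = norm (\<integral>y. sin_field y \<partial>\<mu> s) + (\<integral>y. quad_field y \<partial>\<mu> s)"

definition c where "c = 4 + 2 * real DIM('e)"

lemma c_pos: "0 < c" unfolding c_def by simp

lemma semi:
  fixes f :: "'e \<Rightarrow> 'v::euclidean_space"
  assumes "0 \<le> s" "0 \<le> t" "bdlip C f"
  shows "cv (\<mu> (s + t)) f x = cv (\<mu> s) (cv (\<mu> t) f) x"
proof (rule euclidean_eqI)
  fix b :: 'v assume "b \<in> Basis"
  then have f: "bdlip C (\<lambda>x. f x \<bullet> b)" using assms(3) by (intro bdlip_inner) auto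
  interpret s: borel_prob "\<mu> s" by (rule prob[OF assms(1)])
  interpret t: borel_prob "\<mu> t" by (rule prob[OF assms(2)])
  interpret st: borel_prob "\<mu> (s + t)" using assms by (intro prob) auto
  show "cv (\<mu> (s + t)) f x \<bullet> b = cv (\<mu> s) (cv (\<mu> t) f) x \<bullet> b"
    using assms f by (simp add: st.cv_inner s.cv_inner[OF t.bdlip_cv] t.cv_inner semi_real)
qed

lemma \<kappa>_zero: "\<kappa> 0 = 0"
  using zero[OF bdlip_min_norm, of 0] by (simp add: \<kappa>_def cv_def)

lemma \<kappa>_small:
  assumes "0 < e"
  obtains \<delta> where "0 < \<delta>" "\<And>r. 0 \<le> r \<Longrightarrow> r < \<delta> \<Longrightarrow> \<kappa> r \<le> e"
proof -
  have "\<forall>\<^sub>F t in at_right 0. \<kappa> t < e"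
    using order_tendstoD(2)[OF cont0 assms] by (simp add: \<kappa>_def)
  then obtain \<delta> where "0 < \<delta>" "\<And>r. 0 < r \<Longrightarrow> r < \<delta> \<Longrightarrow> \<kappa> r < e"
    unfolding eventually_at_right_field by auto
  then show ?thesis using \<kappa>_zero assms
    by (intro that[of \<delta>]) (metis less_eq_real_def)+
qed

text \<open>By the semigroup law the summand of index \<open>i\<close> is the increment of
  \<open>cv (\<mu> r) f x\<close> from \<open>r = i * s\<close> to \<open>r = (i + 1) * s\<close>,
  minus the first increment.\<close>

lemma telescope:
  fixes f :: "'e \<Rightarrow> 'v::euclidean_space"
  assumes s: "0 < s" and f: "bdlip C f"
  shows "cv (\<mu> (real n * s)) f x - f x - real n *\<^sub>R (cv (\<mu> s) f x - f x) =
    (\<Sum>i<n. cv (\<mu> s) (\<lambda>x. cv (\<mu> (real i * s)) f x - f x) x - (cv (\<mu> (real i * s)) f x - f x))"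
proof (induction n)
  case 0
  have "cv (\<mu> 0) f x = f x"
  proof (rule euclidean_eqI)
    fix b :: 'v assume "b \<in> Basis"
    then have fb: "bdlip C (\<lambda>x. f x \<bullet> b)" using f by (intro bdlip_inner) auto
    show "cv (\<mu> 0) f x \<bullet> b = f x \<bullet> b"
      using borel_prob.cv_inner[OF prob[of 0] f, of x b] zero[OF fb] by simp
  qed
  then show ?case by simp
next
  case (Suc n)
  interpret s: borel_prob "\<mu> s" using s by (intro prob) simp
  interpret n: borel_prob "\<mu> (real n * s)" using s by (intro prob) simp
  have "cv (\<mu> (real (Suc n) * s)) f x = cv (\<mu> s) (cv (\<mu> (real n * s)) f) x"
    using semi[of s "real n * s" C f x] s f by (simp add: algebra_simps)
  then have "cv (\<mu> s) (\<lambda>x. cv (\<mu> (real n * s)) f x - f x) x = cv (\<mu> (real (Suc n) * s)) f x - cv (\<mu> s) f x"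
    using s.cv_diff[OF n.bdlip_cv[OF f] f, of x] by simp
  then show ?case
    unfolding sum.lessThan_Suc Suc.IH[symmetric] by (simp add: algebra_simps)
qed

lemma \<beta>_nonneg: "0 \<le> \<beta> s"
  unfolding \<beta>_def
  by (intro add_nonneg_nonneg Bochner_Integration.integral_nonneg quad_field_nonneg) auto

text \<open>\<open>good_taylor_bd\<close> at time \<open>i * s\<close> gives the inner difference
  the size \<open>2 * C * \<kappa> (i * s)\<close>, and \<open>taylor_bd_cv_bound\<close> at time
  \<open>s\<close> multiplies it by \<open>c * \<beta> s\<close>. The error is thus a small multiple
  of \<open>n * \<beta> s\<close>, and can be absorbed.\<close>

lemma telescope_bound:
  fixes f :: "'e \<Rightarrow> 'v::euclidean_space"
  assumes s: "0 < s" and f: "good C f" and e: "\<And>i. i < n \<Longrightarrow> \<kappa> (real i * s) \<le> e"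
  shows "norm (cv (\<mu> (real n * s)) f x - f x - real n *\<^sub>R (cv (\<mu> s) f x - f x))
    \<le> real n * (2 * C * e * c * \<beta> s)"
proof -
  let ?d = "\<lambda>i. cv (\<mu> s) (\<lambda>x. cv (\<mu> (real i * s)) f x - f x) x - (cv (\<mu> (real i * s)) f x - f x)"
  have bl: "bdlip C f" using f by (simp add: good_def)
  then have C: "0 \<le> C" by (rule bdlip_nonneg)
  interpret s: borel_prob "\<mu> s" using s by (intro prob) simp
  have "norm (\<Sum>i<n. ?d i)
     \<le> (\<Sum>i<n. 2 * C * e * c * \<beta> s)"
  proof (rule sum_norm_le)
    fix i assume i: "i \<in> {..<n}"
    interpret i: borel_prob "\<mu> (real i * s)" using s by (intro prob) simp
    have "norm (?d i)
        \<le> (2 * C * \<kappa> (real i * s)) * c * \<beta> s"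
      unfolding \<kappa>_def c_def \<beta>_def
      by (rule s.taylor_bd_cv_bound[OF i.good_taylor_bd[OF f] bdlip_diff[OF i.bdlip_cv[OF bl] bl]])
    also have "\<dots> \<le> 2 * C * e * c * \<beta> s"
      using C \<beta>_nonneg c_pos e[of i] i by (intro mult_right_mono mult_left_mono) auto
    finally show "norm (?d i)
        \<le> 2 * C * e * c * \<beta> s" .
  qed
  then show ?thesis unfolding telescope[OF s bl] by simp
qed

text \<open>For small \<open>n * s\<close> the error in \<open>telescope_bound\<close> for the two test functions is at most half
  of \<open>n * \<beta> s\<close>, so that \<open>n * \<beta> s\<close> is bounded by the values at the time \<open>n * s\<close>, which is chosen
  of order one.\<close>

lemma \<beta>_linear:
  obtains \<delta> D where "0 < \<delta>" "0 \<le> D" "\<And>s. 0 < s \<Longrightarrow> s < \<delta> \<Longrightarrow> \<beta> s \<le> D * s"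
proof -
  obtain C1 C2 where C1: "good C1 (sin_field :: 'e \<Rightarrow> 'e)" and C2: "good C2 (quad_field :: 'e \<Rightarrow> real)"
    using good_sin_field good_quad_field by blast
  then have b1: "bdlip C1 (sin_field :: 'e \<Rightarrow> 'e)" and b2: "bdlip C2 (quad_field :: 'e \<Rightarrow> real)"
    by (auto simp: good_def)
  note nn = bdlip_nonneg[OF b1] bdlip_nonneg[OF b2]
  \<comment> \<open>Chosen so that the two error coefficients \<open>2 * C1 * e * c\<close> and
    \<open>2 * C2 * e * c\<close> add up to at most \<open>1 / 2\<close>; the summand 1 keeps the
    denominator positive.\<close>
  define e where "e = 1 / (4 * c * (C1 + C2 + 1))"
  have e: "0 < e" unfolding e_def using c_pos nn by simp
  have e2: "2 * C1 * e * c + 2 * C2 * e * c \<le> 1 / 2"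
  proof -
    have "2 * C1 * e * c + 2 * C2 * e * c = (C1 + C2) * (2 * c * e)" by (simp add: algebra_simps)
    also have "2 * c * e = 1 / (2 * (C1 + C2 + 1))"
      using c_pos nonzero_mult_divide_mult_cancel_left[of "2 * c" 1 "2 * (C1 + C2 + 1)"]
      by (simp add: e_def mult_ac)
    also have "(C1 + C2) * (1 / (2 * (C1 + C2 + 1))) \<le> 1 / 2" using nn by (simp add: divide_le_eq)
    finally show ?thesis .
  qed
  obtain \<delta> where \<delta>: "0 < \<delta>" "\<And>r. 0 \<le> r \<Longrightarrow> r < \<delta> \<Longrightarrow> \<kappa> r \<le> e"
    using \<kappa>_small[OF e] by blast
  define a where "a = \<delta> / 2"
  have a: "0 < a" "a < \<delta>" using \<delta> by (auto simp: a_def)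
  show ?thesis
  proof (rule that[of a "4 * (C1 + C2) / a"])
    show "0 < a" "0 \<le> 4 * (C1 + C2) / a" using a nn by auto
    fix s :: real assume s: "0 < s" "s < a"
    \<comment> \<open>Since \<open>s < a\<close>, this \<open>n\<close> is at least 1, and
      \<open>a < n * s + s\<close> gives \<open>a / 2 \<le> n * s\<close>. So \<open>n * s\<close>
      is comparable with \<open>a\<close>, yet below \<open>\<delta>\<close>.\<close>
    define n where "n = nat \<lfloor>a / s\<rfloor>"
    have fl: "real n = of_int \<lfloor>a / s\<rfloor>" unfolding n_def using s a by simp
    have n1: "real n * s \<le> a"
      using of_int_floor_le[of "a / s"] unfolding fl pos_le_divide_eq[OF s(1)] .
    have n2: "a / 2 \<le> real n * s"
    proof -
      have "a / s < real n + 1" unfolding fl by linarith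
      then have "a < real n * s + s" using s by (simp add: pos_divide_less_eq algebra_simps)
      moreover have "1 \<le> a / s" using s by simp
      then have "1 \<le> real n" unfolding fl by simp
      then have "s \<le> real n * s" using s by simp
      ultimately show ?thesis by linarith
    qed
    then have npos: "0 < real n" using a s zero_less_mult_pos2[of "real n" s] by linarith
    interpret s: borel_prob "\<mu> s" using s by (intro prob) simp
    interpret n: borel_prob "\<mu> (real n * s)" using s by (intro prob) simp
    have \<kappa>: "\<kappa> (real i * s) \<le> e" if "i < n" for i
    proof (rule \<delta>(2))
      have "real i * s \<le> real n * s" using that s by simp
      then show "real i * s < \<delta>" using n1 a by linarith
    qed (use s in simp)
    \<comment> \<open>Both test functions vanish at 0, so evaluating the telescoped difference at
      the point 0 returns exactly the integrals that make up \<open>\<beta>\<close>.\<close>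
    have v: "cv \<nu> sin_field 0 - sin_field 0 = (\<integral>y. sin_field y \<partial>\<nu>)"
      "cv \<nu> quad_field 0 - quad_field 0 = (\<integral>y. quad_field y \<partial>\<nu>)" for \<nu> :: "'e measure"
      by (auto simp: cv_def sin_field_def quad_field_def)
    have "real n * norm (\<integral>y. sin_field y \<partial>\<mu> s)
       \<le> norm (\<integral>y. sin_field y \<partial>\<mu> (real n * s)) + real n * (2 * C1 * e * c * \<beta> s)"
      using telescope_bound[OF s(1) C1, of n e 0, OF \<kappa>] unfolding v
      using norm_triangle_sub[of "real n *\<^sub>R (\<integral>y. sin_field y \<partial>\<mu> s)" "\<integral>y. sin_field y \<partial>\<mu> (real n * s)"]
      by (simp add: norm_minus_commute)
    moreover have "real n * (\<integral>y. quad_field y \<partial>\<mu> s)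
       \<le> \<bar>\<integral>y. quad_field y \<partial>\<mu> (real n * s)\<bar> + real n * (2 * C2 * e * c * \<beta> s)"
      using telescope_bound[OF s(1) C2, of n e 0, OF \<kappa>] unfolding v by simp
    moreover have "norm (\<integral>y. sin_field y \<partial>\<mu> (real n * s)) \<le> C1"
      "norm (\<integral>y. quad_field y \<partial>\<mu> (real n * s)) \<le> C2"
      using b1 b2 n.norm_integral_bound[of sin_field C1] n.norm_integral_bound[of quad_field C2]
      by (simp_all add: bdlip_def)
    moreover have "real n * ((2 * C1 * e * c + 2 * C2 * e * c) * \<beta> s) \<le> real n * (1 / 2 * \<beta> s)"
      using e2 by (intro mult_left_mono mult_right_mono \<beta>_nonneg) auto
    ultimately have "real n * \<beta> s \<le> C1 + C2 + real n * (1 / 2 * \<beta> s)"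
      by (simp add: \<beta>_def algebra_simps)
    then have k: "real n * \<beta> s \<le> 2 * (C1 + C2)" by simp
    have "\<beta> s * (a / 2) \<le> \<beta> s * (real n * s)"
      using n2 by (intro mult_left_mono \<beta>_nonneg)
    also have "\<dots> \<le> 2 * (C1 + C2) * s"
      using mult_right_mono[OF k, of s] s by (simp add: mult_ac)
    finally show "\<beta> s \<le> 4 * (C1 + C2) / a * s"
      using a by (simp add: field_simps)
  qed
qed

text \<open>The semigroup law factors the difference as \<open>T_a (T_{b-a} - I)\<close>, and
  averaging by \<open>T_a\<close> does not increase the sup bound.\<close>

lemma time_modulus:
  fixes f :: "'e \<Rightarrow> 'v::euclidean_space"
  assumes f: "bdlip C f" and st: "0 \<le> s" "0 \<le> t"
  shows "norm (cv (\<mu> s) f x - cv (\<mu> t) f x) \<le> 2 * C * \<kappa> \<bar>s - t\<bar>"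
  using st
proof (induction s t rule: linorder_wlog)
  case (le a b)
  interpret a: borel_prob "\<mu> a" using le by (intro prob) simp
  interpret r: borel_prob "\<mu> (b - a)" using le by (intro prob) simp
  have "cv (\<mu> b) f x - cv (\<mu> a) f x = cv (\<mu> a) (\<lambda>x. cv (\<mu> (b - a)) f x - f x) x"
    using semi[of a "b - a" C f x] le f a.cv_diff[OF r.bdlip_cv[OF f] f, of x] by simp
  also have "norm \<dots> \<le> 2 * C * \<kappa> (b - a)"
    using r.cv_sub_bound[OF f] by (intro a.cv_bound) (simp add: \<kappa>_def mult_ac)
  finally show ?case using le by (simp add: norm_minus_commute)
next
  case (sym a b)
  then show ?case by (simp add: norm_minus_commute abs_minus_commute)
qed

text \<open>With \<open>\<beta> s = O(s)\<close> the telescoping error, divided by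
  \<open>n * s\<close>, is arbitrarily small. This compares difference quotients at times in integer
  ratio only; two arbitrary times are compared through a common small step, using continuity in
  time. The estimates do not depend on \<open>x\<close>, so the limit is uniform.\<close>

theorem generator_exists:
  fixes h :: "'e \<Rightarrow> 'v::euclidean_space"
  assumes h: "good C h"
  shows "\<exists>g. uniform_limit UNIV (\<lambda>t x. (cv (\<mu> t) h x - h x) /\<^sub>R t) g (at_right 0)"
proof -
  define A where "A t x = (cv (\<mu> t) h x - h x) /\<^sub>R t" for t x
  have bl: "bdlip C h" using h by (simp add: good_def)
  then have C: "0 \<le> C" by (rule bdlip_nonneg)
  obtain \<delta>0 D where D: "0 < \<delta>0" "0 \<le> D" "\<And>s. 0 < s \<Longrightarrow> s < \<delta>0 \<Longrightarrow> \<beta> s \<le> D * s"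
    using \<beta>_linear by metis
  have close: "\<exists>\<delta>>0. \<forall>s t x. 0 < s \<and> s < \<delta> \<and> 0 < t \<and> t < \<delta> \<longrightarrow> norm (A s x - A t x) \<le> 2 * \<eta>"
    if \<eta>: "0 < \<eta>" for \<eta>
  proof -
    \<comment> \<open>Makes \<open>2 * C * e * c * D\<close>, the error of one comparison, at most
      \<open>\<eta>\<close>; the summand 1 excludes a zero denominator.\<close>
    define e where "e = \<eta> / (2 * C * c * D + 1)"
    have den: "0 < 2 * C * c * D + 1" using C c_pos D by (simp add: add_nonneg_pos)
    then have e: "0 < e" using \<eta> by (simp add: e_def)
    have e2: "2 * C * e * c * D \<le> \<eta>"
    proof -
      have "(2 * C * c * D) * e \<le> (2 * C * c * D + 1) * e" using e by (intro mult_right_mono) auto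
      also have "\<dots> = \<eta>" using den by (simp add: e_def)
      finally show ?thesis by (simp add: mult_ac)
    qed
    obtain \<delta>1 where \<delta>1: "0 < \<delta>1" "\<And>r. 0 \<le> r \<Longrightarrow> r < \<delta>1 \<Longrightarrow> \<kappa> r \<le> e"
      using \<kappa>_small[OF e] by blast
    define \<delta> where "\<delta> = min \<delta>0 \<delta>1"
    have mult: "norm (A (real n * s) x - A s x) \<le> \<eta>" if s: "0 < s" and n: "0 < n" "real n * s < \<delta>" for n s x
    proof -
      have "1 * s \<le> real n * s" using s n by (intro mult_right_mono) auto
      then have "s < \<delta>0" using n unfolding \<delta>_def by simp
      note Ds = D(3)[OF s this]
      have \<kappa>: "\<kappa> (real i * s) \<le> e" if "i < n" for i
      proof (rule \<delta>1(2))
        have "real i * s \<le> real n * s" using that s by simp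
        then show "real i * s < \<delta>1" using n by (simp add: \<delta>_def)
      qed (use s in simp)
      have ns: "0 < real n * s" using n s by simp
      have "A (real n * s) x - A s x
         = (cv (\<mu> (real n * s)) h x - h x - real n *\<^sub>R (cv (\<mu> s) h x - h x)) /\<^sub>R (real n * s)"
      proof -
        have "inverse (real n * s) * real n = inverse s" using n s by simp
        then have "(real n *\<^sub>R (cv (\<mu> s) h x - h x)) /\<^sub>R (real n * s) = (cv (\<mu> s) h x - h x) /\<^sub>R s"
          by (simp only: scaleR_scaleR)
        then show ?thesis unfolding A_def by (metis scaleR_diff_right)
      qed
      also have "norm \<dots> \<le> (real n * (2 * C * e * c * \<beta> s)) / (real n * s)"
        unfolding norm_scaleR abs_inverse divide_inverse_commute
        using telescope_bound[OF s h \<kappa>, of n x] n s by (intro mult_mono) auto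
      also have "\<dots> \<le> (real n * (2 * C * e * c * (D * s))) / (real n * s)"
        using Ds C e c_pos ns by (intro divide_right_mono mult_left_mono) auto
      also have "\<dots> = 2 * C * e * c * D" using n s by simp
      finally show ?thesis using e2 by linarith
    qed
    show ?thesis
    proof (intro exI[of _ \<delta>] conjI allI impI)
      show "0 < \<delta>" using D \<delta>1 by (simp add: \<delta>_def)
      fix s t x assume "0 < s \<and> s < \<delta> \<and> 0 < t \<and> t < \<delta>"
      then have st: "0 < s" "s < \<delta>" "0 < t" "t < \<delta>" by auto
      \<comment> \<open>The times \<open>t = k * (t / k)\<close> and
        \<open>r k = m k * (t / k)\<close> are multiples of the same step, and \<open>r k\<close>
        tends to \<open>s\<close> from below. Each quotient is within \<open>\<eta>\<close> of the
        one at the step, which explains the bound \<open>2 * \<eta>\<close>.\<close>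
      define m where "m k = nat \<lfloor>real k * (s / t)\<rfloor>" for k
      define r where "r k = real (m k) * (t / real k)" for k
      have mk: "real (m k) = of_int \<lfloor>real k * (s / t)\<rfloor>" for k unfolding m_def using st by simp
      have up: "r k \<le> s" if "0 < k" for k
      proof -
        have "r k \<le> (real k * (s / t)) * (t / real k)"
          unfolding r_def mk using st that by (intro mult_right_mono) auto
        then show ?thesis using st that by simp
      qed
      have lo: "s - t / real k \<le> r k" if "0 < k" for k
      proof -
        have "(real k * (s / t) - 1) * (t / real k) \<le> r k"
          unfolding r_def mk using st that by (intro mult_right_mono) (linarith, simp)
        then show ?thesis using st that by (simp add: left_diff_distrib diff_divide_distrib)
      qed
      have ev: "\<forall>\<^sub>F k in sequentially. 0 < k" by (rule eventually_gt_at_top)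
      have rlim: "r \<longlonglongrightarrow> s"
      proof (rule tendsto_sandwich[where h="\<lambda>_. s" and f="\<lambda>k. s - t / real k"])
        show "(\<lambda>k. s - t / real k) \<longlonglongrightarrow> s"
          using tendsto_diff[OF tendsto_const[of s] lim_const_over_n[of t]] by simp
      qed (rule eventually_mono[OF ev lo] eventually_mono[OF ev up] tendsto_const | assumption)+
      have Alim: "(\<lambda>k. A (r k) x) \<longlonglongrightarrow> A s x"
      proof -
        have "(\<lambda>k. cv (\<mu> (r k)) h x) \<longlonglongrightarrow> cv (\<mu> s) h x"
        proof (rule LIM_zero_cancel, rule Lim_null_comparison)
          show "\<forall>\<^sub>F k in sequentially. norm (cv (\<mu> (r k)) h x - cv (\<mu> s) h x) \<le> 2 * C * \<kappa> \<bar>r k - s\<bar>"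
            using st by (intro always_eventually allI time_modulus[OF bl]) (auto simp: r_def)
          have "(\<lambda>k. \<kappa> \<bar>r k - s\<bar>) \<longlonglongrightarrow> 0"
          proof (rule LIMSEQ_I)
            fix q :: real assume "0 < q"
            then obtain \<delta>2 where \<delta>2: "0 < \<delta>2" "\<And>r. 0 \<le> r \<Longrightarrow> r < \<delta>2 \<Longrightarrow> \<kappa> r \<le> q / 2"
              using \<kappa>_small[of "q / 2"] by auto
            have "\<exists>no. \<forall>k\<ge>no. norm (r k - s) < \<delta>2" by (rule LIMSEQ_D[OF rlim \<delta>2(1)])
            then obtain no where no: "\<And>k. k \<ge> no \<Longrightarrow> \<bar>r k - s\<bar> < \<delta>2" by auto
            have "norm (\<kappa> \<bar>r k - s\<bar> - 0) < q" if "k \<ge> no" for k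
            proof -
              have "0 \<le> \<kappa> \<bar>r k - s\<bar>" unfolding \<kappa>_def by (rule Bochner_Integration.integral_nonneg) auto
              moreover have "\<kappa> \<bar>r k - s\<bar> \<le> q / 2" by (rule \<delta>2(2)) (use no[OF that] in auto)
              ultimately show ?thesis using \<open>0 < q\<close> by simp
            qed
            then show "\<exists>no. \<forall>k\<ge>no. norm (\<kappa> \<bar>r k - s\<bar> - 0) < q" by blast
          qed
          then show "(\<lambda>k. 2 * C * \<kappa> \<bar>r k - s\<bar>) \<longlonglongrightarrow> 0" by (rule tendsto_mult_right_zero)
        qed
        then show ?thesis unfolding A_def using rlim st by (intro tendsto_intros) auto
      qed
      have "\<forall>\<^sub>F k in sequentially. norm (A (r k) x - A t x) \<le> 2 * \<eta>"
        using order_tendstoD(1)[OF rlim st(1)] ev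
      proof eventually_elim
        case (elim k)
        have tk: "0 < t / real k" using st elim by simp
        have mpos: "0 < m k" using elim st by (cases "m k") (auto simp: r_def)
        have a: "norm (A (r k) x - A (t / real k) x) \<le> \<eta>"
          unfolding r_def using mult[OF tk mpos] up[OF elim(2)] st by (simp add: r_def)
        have b: "norm (A t x - A (t / real k) x) \<le> \<eta>"
          using mult[OF tk elim(2), of x] st elim by simp
        have "norm (A (r k) x - A t x) \<le> norm (A (r k) x - A (t / real k) x) + norm (A t x - A (t / real k) x)"
          using norm_triangle_ineq4[of "A (r k) x - A (t / real k) x" "A t x - A (t / real k) x"] by simp
        then show ?case using a b by linarith
      qed
      then show "norm (A s x - A t x) \<le> 2 * \<eta>"
        by (rule tendsto_upperbound[OF tendsto_norm[OF tendsto_diff[OF Alim tendsto_const]]]) simp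
    qed
  qed
  \<comment> \<open>A limit along one sequence, pointwise in \<open>x\<close>, is enough to name the
    candidate; \<open>close\<close> is uniform in \<open>x\<close> and upgrades the convergence
    afterwards.\<close>
  define g where "g x = lim (\<lambda>n. A (inverse (real (Suc n))) x)" for x
  have inv: "\<forall>\<^sub>F n in sequentially. inverse (real (Suc n)) < \<delta>" if "0 < \<delta>" for \<delta> :: real
    using LIMSEQ_inverse_real_of_nat that by (rule order_tendstoD)
  have lim: "(\<lambda>n. A (inverse (real (Suc n))) x) \<longlonglongrightarrow> g x" for x
  proof -
    have "Cauchy (\<lambda>n. A (inverse (real (Suc n))) x)"
    proof (rule CauchyI)
      fix e :: real assume "0 < e"
      then obtain \<delta> where \<delta>: "0 < \<delta>"
        "\<forall>s t x. 0 < s \<and> s < \<delta> \<and> 0 < t \<and> t < \<delta> \<longrightarrow> norm (A s x - A t x) \<le> 2 * (e / 3)"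
        using close[of "e / 3"] by auto
      obtain N where "\<And>n. n \<ge> N \<Longrightarrow> inverse (real (Suc n)) < \<delta>"
        using inv[OF \<delta>(1)] by (auto simp: eventually_sequentially)
      then have "norm (A (inverse (real (Suc m))) x - A (inverse (real (Suc n))) x) \<le> 2 * (e / 3)"
        if "m \<ge> N" "n \<ge> N" for m n
        using \<delta>(2) that by simp
      then show "\<exists>M. \<forall>m\<ge>M. \<forall>n\<ge>M. norm (A (inverse (real (Suc m))) x - A (inverse (real (Suc n))) x) < e"
        using \<open>0 < e\<close> by (intro exI[of _ N] allI impI) (rule le_less_trans, assumption, auto)
    qed
    then show ?thesis unfolding g_def by (rule convergent_LIMSEQ_iff[THEN iffD1, OF Cauchy_convergent])
  qed
  have "uniform_limit UNIV A g (at_right 0)"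
  proof (rule uniform_limitI)
    fix e :: real assume "0 < e"
    then obtain \<delta> where \<delta>: "0 < \<delta>"
      "\<forall>s t x. 0 < s \<and> s < \<delta> \<and> 0 < t \<and> t < \<delta> \<longrightarrow> norm (A s x - A t x) \<le> 2 * (e / 3)"
      using close[of "e / 3"] by auto
    have "dist (A t x) (g x) < e" if t: "0 < t" "t < \<delta>" for t x
    proof -
      have "norm (A t x - g x) \<le> 2 * (e / 3)"
      proof (rule tendsto_upperbound[OF tendsto_norm[OF tendsto_diff[OF tendsto_const lim]]])
        show "\<forall>\<^sub>F n in sequentially. norm (A t x - A (inverse (real (Suc n))) x) \<le> 2 * (e / 3)"
          using inv[OF \<delta>(1)] by eventually_elim (use \<delta>(2) t in auto)
      qed simp
      then show ?thesis using \<open>0 < e\<close> by (simp add: dist_norm)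
    qed
    then show "\<forall>\<^sub>F t in at_right 0. \<forall>x\<in>UNIV. dist (A t x) (g x) < e"
      unfolding eventually_at_right_field using \<delta>(1) by (intro exI[of _ \<delta>]) auto
  qed
  then show ?thesis unfolding A_def[abs_def] by blast
qed

end

section \<open>Weak convergence from Laplace transforms\<close>

definition bc_orthant :: "(real ^ 'n \<Rightarrow> real) \<Rightarrow> bool" where
  "bc_orthant f \<longleftrightarrow> continuous_on {0..} f \<and> (\<exists>K. \<forall>s\<in>{0..}. \<bar>f s\<bar> \<le> K)"

text \<open>Finite measures on the orthant enter only as positive linear functionals on bounded
  continuous functions. The limit is an integral plus a point mass at 0, and in this form it is
  written down directly as a functional.\<close>

definition pos_functional :: "((real ^ 'n \<Rightarrow> real) \<Rightarrow> real) \<Rightarrow> bool" where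
  "pos_functional Q \<longleftrightarrow>
     (\<forall>f g. bc_orthant f \<longrightarrow> bc_orthant g \<longrightarrow> Q (\<lambda>s. f s + g s) = Q f + Q g) \<and>
     (\<forall>a f. bc_orthant f \<longrightarrow> Q (\<lambda>s. a * f s) = a * Q f) \<and>
     (\<forall>f g. bc_orthant f \<longrightarrow> bc_orthant g \<longrightarrow> (\<forall>s\<in>{0..}. f s \<le> g s) \<longrightarrow> Q f \<le> Q g)"

lemma pos_functionalD:
  assumes "pos_functional Q" "bc_orthant f"
  shows "bc_orthant g \<Longrightarrow> Q (\<lambda>s. f s + g s) = Q f + Q g"
    and "Q (\<lambda>s. a * f s) = a * Q f"
    and "bc_orthant g \<Longrightarrow> (\<And>s. s \<in> {0..} \<Longrightarrow> f s \<le> g s) \<Longrightarrow> Q f \<le> Q g"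
  using assms unfolding pos_functional_def by blast+

lemma bc_orthant_const: "bc_orthant (\<lambda>_. a)"
  unfolding bc_orthant_def by auto

lemma bc_orthant_add:
  assumes "bc_orthant f" "bc_orthant g"
  shows "bc_orthant (\<lambda>s. f s + g s)"
proof -
  obtain K L where "\<And>s. s \<in> {0..} \<Longrightarrow> \<bar>f s\<bar> \<le> K" "\<And>s. s \<in> {0..} \<Longrightarrow> \<bar>g s\<bar> \<le> L"
    using assms unfolding bc_orthant_def by blast
  then have "\<forall>s\<in>{0..}. \<bar>f s + g s\<bar> \<le> K + L" by (meson abs_triangle_ineq add_mono order_trans)
  then show ?thesis using assms unfolding bc_orthant_def by (blast intro: continuous_on_add)
qed

lemma bc_orthant_mult:
  assumes "bc_orthant f" "bc_orthant g"
  shows "bc_orthant (\<lambda>s. f s * g s)"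
proof -
  obtain K L where K: "\<And>s. s \<in> {0..} \<Longrightarrow> \<bar>f s\<bar> \<le> K" and L: "\<And>s. s \<in> {0..} \<Longrightarrow> \<bar>g s\<bar> \<le> L"
    using assms unfolding bc_orthant_def by blast
  have "0 \<le> K" using K[of 0] by simp
  then have "\<forall>s\<in>{0..}. \<bar>f s * g s\<bar> \<le> K * L" using K L by (auto simp: abs_mult intro!: mult_mono)
  then show ?thesis using assms unfolding bc_orthant_def by (blast intro: continuous_on_mult)
qed

lemma inner_orthant_nonneg: "u \<in> {0..} \<Longrightarrow> s \<in> {0..} \<Longrightarrow> 0 \<le> u \<bullet> (s :: real ^ 'n)"
  by (auto simp: inner_vec_def less_eq_vec_def intro!: sum_nonneg)

lemma bc_orthant_exp: "u \<in> {0..} \<Longrightarrow> bc_orthant (\<lambda>s. exp (- (u \<bullet> s)))"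
  unfolding bc_orthant_def
  by (auto intro!: continuous_intros exI[of _ 1] simp: inner_orthant_nonneg)

text \<open>The linear span of the exponentials, that is, the functions for which convergence
  follows from Laplace transforms by linearity. It is closed under products, so it contains all
  polynomials in the variables \<open>exp (- (s $ i))\<close>.\<close>

inductive exp_poly :: "(real ^ 'n \<Rightarrow> real) \<Rightarrow> bool" where
  exp_poly_exp: "u \<in> {0..} \<Longrightarrow> exp_poly (\<lambda>s. a * exp (- (u \<bullet> s)))"
| exp_poly_add: "exp_poly f \<Longrightarrow> exp_poly g \<Longrightarrow> exp_poly (\<lambda>s. f s + g s)"

lemma exp_poly_const: "exp_poly (\<lambda>_. a)"
  using exp_poly_exp[of 0 a] by simp

lemma exp_poly_mult:
  assumes "exp_poly f" "exp_poly g"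
  shows "exp_poly (\<lambda>s. f s * g s)"
  using assms
proof (induction arbitrary: g)
  case (exp_poly_exp u a)
  from exp_poly_exp(2) show ?case
  proof induction
    case (exp_poly_exp v b)
    have "exp_poly (\<lambda>s. (a * b) * exp (- ((u + v) \<bullet> s)))"
      using exp_poly_exp \<open>u \<in> {0..}\<close> by (intro exp_poly.exp_poly_exp) auto
    also have "(\<lambda>s. (a * b) * exp (- ((u + v) \<bullet> s))) = (\<lambda>s. a * exp (- (u \<bullet> s)) * (b * exp (- (v \<bullet> s))))"
      by (auto simp: inner_add_left exp_diff exp_minus divide_inverse algebra_simps exp_add)
    finally show ?case .
  next
    case (exp_poly_add f g)
    then show ?case by (simp add: distrib_left exp_poly.exp_poly_add)
  qed
next
  case (exp_poly_add f f')
  then show ?case by (simp add: distrib_right exp_poly.exp_poly_add)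
qed

lemma exp_poly_sum:
  "finite I \<Longrightarrow> (\<And>i. i \<in> I \<Longrightarrow> exp_poly (f i)) \<Longrightarrow> exp_poly (\<lambda>s. \<Sum>i\<in>I. f i s)"
  by (induction rule: finite_induct) (auto intro: exp_poly_const exp_poly_add)

lemma axis_orthant: "0 \<le> a \<Longrightarrow> axis i (a::real) \<in> {0..}"
  by (auto simp: less_eq_vec_def axis_def)

lemma exp_poly_polynomial:
  assumes "real_polynomial_function (p :: real ^ 'n \<Rightarrow> real)"
  shows "exp_poly (\<lambda>s. p (\<chi> i. exp (- (s $ i))))"
  using assms
proof induction
  case (linear f)
  have "f (\<chi> i. exp (- (s $ i))) = (\<Sum>i\<in>UNIV. f (axis i 1) * exp (- (axis i 1 \<bullet> s)))" for s
  proof -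
    have "(\<chi> i. exp (- (s $ i))) = (\<Sum>i\<in>UNIV. exp (- (s $ i)) *\<^sub>R axis i 1)"
      by (simp add: vec_eq_iff axis_def if_distrib[of "\<lambda>x. _ * x"] cong: if_cong)
    then show ?thesis
      using linear by (simp add: linear_sum[OF bounded_linear.linear] linear_scale[OF bounded_linear.linear]
          inner_axis' mult.commute)
  qed
  then show ?case
    by (simp only:) (intro exp_poly_sum exp_poly_exp axis_orthant, auto)
qed (auto intro: exp_poly_const exp_poly_add exp_poly_mult)

lemma exp_poly_bc: "exp_poly f \<Longrightarrow> bc_orthant f"
  by (induction rule: exp_poly.induct)
    (auto intro!: bc_orthant_add bc_orthant_mult bc_orthant_const bc_orthant_exp)

lemma pos_functional_abs_le:
  assumes "pos_functional Q" "bc_orthant f" "bc_orthant g" "\<And>s. s \<in> {0..} \<Longrightarrow> \<bar>f s\<bar> \<le> g s"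
  shows "\<bar>Q f\<bar> \<le> Q g"
proof -
  have n: "bc_orthant (\<lambda>s. (-1) * g s)" using assms by (intro bc_orthant_mult bc_orthant_const)
  have "Q f \<le> Q g" using assms unfolding pos_functional_def by (meson abs_le_D1)
  moreover have "Q (\<lambda>s. (-1) * g s) \<le> Q f"
    using assms n unfolding pos_functional_def by (smt (verit) abs_le_iff)
  moreover have "Q (\<lambda>s. (-1) * g s) = (-1) * Q g" by (rule pos_functionalD(2)[OF assms(1,3)])
  ultimately show ?thesis by linarith
qed

text \<open>Replacing \<open>s\<close> by \<open>min s R\<close> makes \<open>f\<close> a continuous function of \<open>exp (- s)\<close> in the unit cube,
  to which the Stone-Weierstrass theorem applies; the error is controlled by Laplace transforms
  near \<open>0\<close>.\<close>

lemma weak_convergence_laplace: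
  fixes J :: "'i \<Rightarrow> (real ^ 'n \<Rightarrow> real) \<Rightarrow> real"
  assumes J: "\<forall>\<^sub>F t in G. pos_functional (J t)" and J0: "pos_functional J0"
    and lap: "\<And>u. u \<in> {0..} \<Longrightarrow> ((\<lambda>t. J t (\<lambda>s. exp (- (u \<bullet> s)))) \<longlongrightarrow> J0 (\<lambda>s. exp (- (u \<bullet> s)))) G"
    and tight: "(\<lambda>n. J0 (\<lambda>s. exp (- ((1 / real (Suc n)) *\<^sub>R 1 \<bullet> s)))) \<longlonglongrightarrow> J0 (\<lambda>_. 1)"
    and f: "bc_orthant f"
  shows "((\<lambda>t. J t f) \<longlongrightarrow> J0 f) G"
proof -
  have conv: "((\<lambda>t. J t p) \<longlongrightarrow> J0 p) G" if "exp_poly p" for p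
    using that
  proof induction
    case (exp_poly_exp u a)
    have "((\<lambda>t. a * J t (\<lambda>s. exp (- (u \<bullet> s)))) \<longlongrightarrow> a * J0 (\<lambda>s. exp (- (u \<bullet> s)))) G"
      by (intro tendsto_intros lap exp_poly_exp)
    moreover have "J0 (\<lambda>s. a * exp (- (u \<bullet> s))) = a * J0 (\<lambda>s. exp (- (u \<bullet> s)))"
      using J0 bc_orthant_exp[OF exp_poly_exp] unfolding pos_functional_def by blast
    moreover have "\<forall>\<^sub>F t in G. a * J t (\<lambda>s. exp (- (u \<bullet> s))) = J t (\<lambda>s. a * exp (- (u \<bullet> s)))"
      using J by eventually_elim (rule pos_functionalD(2)[OF _ bc_orthant_exp[OF exp_poly_exp], symmetric])
    ultimately show ?case using Lim_transform_eventually by force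
  next
    case (exp_poly_add f g)
    have "((\<lambda>t. J t f + J t g) \<longlongrightarrow> J0 f + J0 g) G"
      by (intro tendsto_intros exp_poly_add)
    moreover have "J0 (\<lambda>s. f s + g s) = J0 f + J0 g"
      using J0 exp_poly_add exp_poly_bc unfolding pos_functional_def by blast
    moreover have "\<forall>\<^sub>F t in G. J t f + J t g = J t (\<lambda>s. f s + g s)"
      using J by eventually_elim (rule pos_functionalD(1)[OF _ exp_poly_bc exp_poly_bc, symmetric, OF _ exp_poly_add.hyps])
    ultimately show ?case using Lim_transform_eventually by force
  qed
  obtain K where K: "\<And>s. s \<in> {0..} \<Longrightarrow> \<bar>f s\<bar> \<le> K" and fc: "continuous_on {0..} f"
    using f unfolding bc_orthant_def by blast
  have K0: "0 \<le> K" using K[of 0] by simp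
  have one: "J0 (\<lambda>_. 1) \<ge> 0"
    using pos_functional_abs_le[OF J0 bc_orthant_const[of 0] bc_orthant_const[of 1]] by simp
  show ?thesis
  proof (rule tendstoI)
    fix e :: real assume e: "0 < e"
    \<comment> \<open>The final estimate adds up to \<open>d\<close> times
      \<open>12 * K + 2 * J0 (\<lambda>_. 1) + 2\<close>; the denominator is a positive number above
      this factor.\<close>
    define d where "d = e / (16 * (K + 1) + 2 * J0 (\<lambda>_. 1) + 4)"
    have den: "16 * (K + 1) + 2 * J0 (\<lambda>_. 1) + 4 > 0" using K0 one by (intro add_nonneg_pos add_nonneg_nonneg mult_nonneg_nonneg) auto
    have d: "0 < d" using e den by (simp add: d_def)
    have "\<forall>\<^sub>F n in sequentially. \<bar>J0 (\<lambda>s. exp (- ((1 / real (Suc n)) *\<^sub>R 1 \<bullet> s))) - J0 (\<lambda>_. 1)\<bar> < d"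
      using tendstoD[OF tight d] by (simp add: dist_real_def)
    then obtain n where n: "\<bar>J0 (\<lambda>s. exp (- ((1 / real (Suc n)) *\<^sub>R 1 \<bullet> s))) - J0 (\<lambda>_. 1)\<bar> < d"
      by (meson eventually_happens' sequentially_bot)
    define R where "R = real (Suc n)"
    have R: "0 < R" by (simp add: R_def)
    define u where "u = (1 / R) *\<^sub>R (1 :: real ^ 'n)"
    have u: "u \<in> {0..}" unfolding u_def using R by (auto simp: less_eq_vec_def)
    \<comment> \<open>A tail function inside the exponential span: it is at least
      \<open>1 / 2\<close> as soon as one coordinate exceeds \<open>R\<close>, while
      \<open>J0 T\<close> is small by \<open>tight\<close>. Its convergence under \<open>J\<close>
      makes the tail small along the filter too.\<close>
    define T where "T s = 1 + (-1) * exp (- (u \<bullet> s))" for s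
    have T: "exp_poly T"
      unfolding T_def[abs_def] using exp_poly_add[OF exp_poly_const exp_poly_exp[OF u]] by blast
    have JT: "Q T = Q (\<lambda>_. 1) - Q (\<lambda>s. exp (- (u \<bullet> s)))" if Q: "pos_functional Q" for Q
    proof -
      have "Q T = Q (\<lambda>_. 1) + Q (\<lambda>s. (-1) * exp (- (u \<bullet> s)))"
        unfolding T_def[abs_def] using Q bc_orthant_const bc_orthant_mult[OF bc_orthant_const bc_orthant_exp[OF u]]
        unfolding pos_functional_def by blast
      moreover have "Q (\<lambda>s. (-1) * exp (- (u \<bullet> s))) = (-1) * Q (\<lambda>s. exp (- (u \<bullet> s)))"
        using Q bc_orthant_exp[OF u] unfolding pos_functional_def by blast
      ultimately show ?thesis by simp
    qed
    have J0T: "J0 T < d" using n JT[OF J0] unfolding u_def R_def by linarith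
    define clamp where "clamp s = (\<chi> i. min (s $ i) R)" for s :: "real ^ 'n"
    \<comment> \<open>This is \<open>f\<close> of the clamped point in the variables
      \<open>y $ i = exp (- (s $ i))\<close>. The maximum with \<open>exp (- R)\<close> realizes the
      clamping and keeps the logarithm continuous up to the faces \<open>y $ i = 0\<close> of the
      cube.\<close>
    define q where "q y = f (\<chi> i. - ln (max (y $ i) (exp (- R))))" for y :: "real ^ 'n"
    have q: "f (clamp s) = q (\<chi> i. exp (- (s $ i)))" if "s \<in> {0..}" for s
    proof -
      have "- ln (max (exp (- (s $ i))) (exp (- R))) = min (s $ i) R" for i
        by (auto simp: max_def min_def)
      then show ?thesis unfolding q_def clamp_def by simp
    qed
    have qc: "continuous_on (cbox 0 1) q"
      unfolding q_def
    proof (rule continuous_on_compose2[OF fc])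
      show "continuous_on (cbox 0 1) (\<lambda>y::real ^ 'n. \<chi> i. - ln (max (y $ i) (exp (- R))))"
        by (intro continuous_intros continuous_on_vec_lambda) (auto simp: max_def)
      show "(\<lambda>y::real ^ 'n. \<chi> i. - ln (max (y $ i) (exp (- R)))) ` cbox 0 1 \<subseteq> {0..}"
      proof -
        have "ln (max r (exp (- R))) \<le> 0" if "r \<le> 1" for r
          using that R by (subst ln_le_zero_iff) (auto simp: less_max_iff_disj)
        then show ?thesis by (auto simp: less_eq_vec_def mem_box_cart)
      qed
    qed
    obtain p where p: "polynomial_function p" "\<And>y. y \<in> cbox 0 1 \<Longrightarrow> \<bar>q y - p y\<bar> < d"
      using Stone_Weierstrass_polynomial_function[OF compact_cbox qc d] by auto
    define P where "P s = p (\<chi> i. exp (- (s $ i)))" for s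
    have P: "exp_poly P" unfolding P_def[abs_def]
      using exp_poly_polynomial p(1) by (simp add: real_polynomial_function_eq)
    \<comment> \<open>Inside the box \<open>f\<close> and its clamped version agree. Outside they
      differ by at most \<open>2 * K\<close>, which is at most \<open>4 * K * T s\<close> because
      \<open>T s\<close> is at least \<open>1 / 2\<close> there.\<close>
    have close: "\<bar>f s + (-1) * P s\<bar> \<le> d * 1 + 4 * K * T s" if s: "s \<in> {0..}" for s
    proof -
      have "(\<chi> i. exp (- (s $ i))) \<in> cbox 0 1" using s by (auto simp: mem_box_cart less_eq_vec_def)
      from p(2)[OF this] have a: "\<bar>f (clamp s) - P s\<bar> < d" using q[OF s] by (simp add: P_def)
      have us: "0 \<le> u \<bullet> s" by (rule inner_orthant_nonneg[OF u s])
      then have T0: "0 \<le> T s" by (simp add: T_def)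
      have "\<bar>f s - f (clamp s)\<bar> \<le> 4 * K * T s"
      proof (cases "\<forall>i. s $ i \<le> R")
        case True
        then have "clamp s = s" by (auto simp: clamp_def vec_eq_iff min_def)
        then show ?thesis using T0 K0 by simp
      next
        case False
        then obtain i where i: "R < s $ i" by (auto simp: not_le)
        have "R * 1 \<le> R * (u \<bullet> s)"
        proof -
          have "s $ i \<le> (\<Sum>i\<in>UNIV. s $ i)" using s by (intro member_le_sum) (auto simp: less_eq_vec_def)
          then show ?thesis using i R by (simp add: u_def inner_vec_def sum_divide_distrib[symmetric])
        qed
        then have "1 \<le> u \<bullet> s" using R by (simp only: mult_le_cancel_left_pos)
        then have "exp (- (u \<bullet> s)) \<le> exp (-1)" by simp
        also have "exp (-1) \<le> (1/2 :: real)"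
          using exp_ge_add_one_self[of 1] by (simp add: exp_minus inverse_eq_divide)
        finally have "1 / 2 \<le> T s" by (simp add: T_def)
        then have "4 * K * (1 / 2) \<le> 4 * K * T s" using K0 by (intro mult_left_mono) auto
        moreover have "clamp s \<in> {0..}" using s R by (auto simp: clamp_def less_eq_vec_def)
        then have "\<bar>f s - f (clamp s)\<bar> \<le> K + K"
          using K[OF s] K[of "clamp s"] by (meson abs_triangle_ineq4 add_mono order_trans)
        ultimately show ?thesis by simp
      qed
      then show ?thesis using a by linarith
    qed
    have main: "\<bar>Q f - Q P\<bar> \<le> d * Q (\<lambda>_. 1) + 4 * K * Q T" if Q: "pos_functional Q" for Q
    proof -
      have nP: "bc_orthant (\<lambda>s. (-1) * P s)" by (intro bc_orthant_mult bc_orthant_const exp_poly_bc P)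
      have r1: "bc_orthant (\<lambda>s. d * 1)" "bc_orthant (\<lambda>s. 4 * K * T s)"
        using bc_orthant_const[of "d * 1"] bc_orthant_mult[OF bc_orthant_const[of "4 * K"] exp_poly_bc[OF T]]
        by simp_all
      have "Q (\<lambda>s. f s + (-1) * P s) = Q f + Q (\<lambda>s. (-1) * P s)"
        using Q f nP unfolding pos_functional_def by blast
      also have "Q (\<lambda>s. (-1) * P s) = (-1) * Q P"
        using Q exp_poly_bc[OF P] unfolding pos_functional_def by blast
      finally have l: "Q (\<lambda>s. f s + (-1) * P s) = Q f - Q P" by simp
      have "Q (\<lambda>s. d * 1 + 4 * K * T s) = Q (\<lambda>s. d * 1) + Q (\<lambda>s. 4 * K * T s)"
        using Q r1 unfolding pos_functional_def by blast
      also have "Q (\<lambda>s. d * 1) = d * Q (\<lambda>_. 1)"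
        using Q bc_orthant_const[of 1] unfolding pos_functional_def by blast
      also have "Q (\<lambda>s. 4 * K * T s) = 4 * K * Q T"
        using Q exp_poly_bc[OF T] unfolding pos_functional_def by blast
      finally have r: "Q (\<lambda>s. d * 1 + 4 * K * T s) = d * Q (\<lambda>_. 1) + 4 * K * Q T" .
      show ?thesis
        using pos_functional_abs_le[OF Q bc_orthant_add[OF f nP] bc_orthant_add[OF r1] close]
        unfolding l r .
    qed
    have "\<forall>\<^sub>F t in G. \<bar>J t P - J0 P\<bar> < d"
      using tendstoD[OF conv[OF P] d] by (simp add: dist_real_def)
    moreover have "\<forall>\<^sub>F t in G. \<bar>J t T - J0 T\<bar> < d"
      using tendstoD[OF conv[OF T] d] by (simp add: dist_real_def)
    moreover have "\<forall>\<^sub>F t in G. \<bar>J t (\<lambda>_. 1) - J0 (\<lambda>_. 1)\<bar> < 1"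
      using tendstoD[OF conv[OF exp_poly_const[of 1]], of 1] by (simp add: dist_real_def)
    ultimately show "\<forall>\<^sub>F t in G. dist (J t f) (J0 f) < e"
      using J
    proof eventually_elim
      case (elim t)
      have "K * J t T \<le> K * (2 * d)" using elim J0T K0 by (intro mult_left_mono) auto
      moreover have "K * J0 T \<le> K * d" using J0T K0 by (intro mult_left_mono) auto
      moreover have "d * J t (\<lambda>_. 1) \<le> d * (J0 (\<lambda>_. 1) + 1)" using elim d by (intro mult_left_mono) auto
      ultimately have "\<bar>J t f - J0 f\<bar> < d * (J0 (\<lambda>_. 1) + 1) + 4 * (K * (2 * d)) + d + d * J0 (\<lambda>_. 1) + 4 * (K * d)"
        using main[OF elim(4)] main[OF J0] elim(1) by linarith
      also have "\<dots> \<le> d * (16 * (K + 1) + 2 * J0 (\<lambda>_. 1) + 4)"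
        using d K0 by (simp add: algebra_simps)
      also have "\<dots> = e" using den by (simp add: d_def)
      finally show ?case by (simp add: dist_real_def)
    qed
  qed
qed

section \<open>Small-time limits of subordinators\<close>

text \<open>One shape covers both sides of the limit: \<open>a = 0\<close> and
  \<open>r = 1 / t\<close> before it, \<open>a = 1 \<bullet> b\<close> and \<open>r = 1\<close> in
  it.\<close>

lemma pos_functional_weighted:
  fixes w :: "real ^ 'n \<Rightarrow> real"
  assumes i: "\<And>f. bc_orthant f \<Longrightarrow> set_integrable m {0..} (\<lambda>s. f s * w s)"
    and w: "\<And>s. s \<in> {0..} \<Longrightarrow> 0 \<le> w s" and ar: "0 \<le> a" "0 \<le> r"
  shows "pos_functional (\<lambda>f. a * f 0 + r * (LINT s:{0..}|m. f s * w s))"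
  unfolding pos_functional_def
proof (intro conjI allI impI)
  fix f g :: "real ^ 'n \<Rightarrow> real" assume f: "bc_orthant f" and g: "bc_orthant g"
  have "(LINT s:{0..}|m. (f s + g s) * w s) = (LINT s:{0..}|m. f s * w s) + (LINT s:{0..}|m. g s * w s)"
    using set_integral_add(2)[OF i[OF f] i[OF g]] by (simp add: distrib_right)
  then show "a * (f 0 + g 0) + r * (LINT s:{0..}|m. (f s + g s) * w s) =
    a * f 0 + r * (LINT s:{0..}|m. f s * w s) + (a * g 0 + r * (LINT s:{0..}|m. g s * w s))"
    by (simp add: algebra_simps)
next
  fix c and f :: "real ^ 'n \<Rightarrow> real"
  have "(LINT s:{0..}|m. (c * f s) * w s) = c * (LINT s:{0..}|m. f s * w s)"
    by (simp add: mult.assoc)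
  then show "a * (c * f 0) + r * (LINT s:{0..}|m. (c * f s) * w s) =
     c * (a * f 0 + r * (LINT s:{0..}|m. f s * w s))"
    by (simp add: algebra_simps)
next
  fix f g :: "real ^ 'n \<Rightarrow> real"
  assume f: "bc_orthant f" and g: "bc_orthant g" and le: "\<forall>s\<in>{0..}. f s \<le> g s"
  have "(LINT s:{0..}|m. f s * w s) \<le> (LINT s:{0..}|m. g s * w s)"
    using le w by (intro set_integral_mono i f g mult_right_mono) auto
  then show "a * f 0 + r * (LINT s:{0..}|m. f s * w s) \<le> a * g 0 + r * (LINT s:{0..}|m. g s * w s)"
    using le ar by (intro add_mono mult_left_mono) auto
qed

lemma norm_le_inner_one: "s \<in> {0..} \<Longrightarrow> norm s \<le> 1 \<bullet> (s :: real ^ 'n)"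
proof -
  assume "s \<in> {0..}"
  then have "(\<Sum>i\<in>UNIV. \<bar>s $ i\<bar>) = 1 \<bullet> s" by (simp add: inner_vec_def less_eq_vec_def)
  then show ?thesis using norm_le_l1_cart[of s] by simp
qed

text \<open>This is what allows division by the weight: it vanishes at 0 no faster than
  \<open>norm s\<close> and has a positive lower bound away from 0. The proof combines
  \<open>norm s \<le> 1 \<bullet> s\<close> with \<open>exp (- r) \<le> 1 / (1 + r)\<close>.\<close>

lemma one_minus_exp_lower:
  fixes s :: "real ^ 'n"
  assumes "s \<in> {0..}"
  shows "norm s / (1 + norm s) \<le> 1 - exp (- (1 \<bullet> s))"
proof -
  have "exp (- (1 \<bullet> s)) \<le> exp (- norm s)" using norm_le_inner_one[OF assms] by simp
  also have "\<dots> \<le> 1 / (1 + norm s)"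
    using exp_ge_add_one_self[of "norm s"] by (simp add: exp_minus inverse_eq_divide frac_le add_pos_nonneg)
  finally have "1 - 1 / (1 + norm s) \<le> 1 - exp (- (1 \<bullet> s))" by simp
  moreover have "1 - 1 / (1 + norm s) = norm s / (1 + norm s)"
    using norm_ge_zero[of s] by (simp add: field_simps add_nonneg_eq_0_iff)
  ultimately show ?thesis by simp
qed

text \<open>A Levy measure integrates \<open>min (norm s) 1\<close>, so this comparison makes the
  integrand of the Laplace exponent integrable.\<close>

lemma one_minus_exp_upper:
  fixes s u :: "real ^ 'n"
  assumes s: "s \<in> {0..}" and u: "u \<in> {0..}"
  shows "\<bar>1 - exp (- (u \<bullet> s))\<bar> \<le> (norm u + 1) * min (norm s) 1"
proof -
  have p: "0 \<le> u \<bullet> s" using u s by (rule inner_orthant_nonneg)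
  have "1 - exp (- (u \<bullet> s)) \<le> u \<bullet> s" using exp_ge_add_one_self[of "- (u \<bullet> s)"] by simp
  also have "\<dots> \<le> norm u * norm s" by (rule norm_cauchy_schwarz)
  finally have a: "1 - exp (- (u \<bullet> s)) \<le> norm u * norm s" .
  have b: "0 \<le> 1 - exp (- (u \<bullet> s))" "1 - exp (- (u \<bullet> s)) \<le> 1" using p by auto
  have "1 - exp (- (u \<bullet> s)) \<le> (norm u + 1) * norm s" using a by (simp add: distrib_right add_increasing2)
  moreover have "1 - exp (- (u \<bullet> s)) \<le> (norm u + 1) * 1" by (rule order_trans[OF b(2)]) simp
  ultimately show ?thesis using b by (simp add: min_def)
qed

lemma levy_measure_integrable:
  fixes f :: "real ^ 'n \<Rightarrow> 'v::euclidean_space"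
  assumes \<phi>: "subordinator_levy_measure \<phi>" and c: "continuous_on {0..} f"
    and b: "\<And>s. s \<in> {0..} \<Longrightarrow> norm (f s) \<le> K * min (norm s) 1"
  shows "set_integrable \<phi> {0..} f"
proof -
  have s [measurable_cong]: "sets \<phi> = sets borel" and
    fin: "(\<integral>\<^sup>+ x. ennreal (min (norm x) 1) \<partial>\<phi>) < \<infinity>"
    using \<phi> unfolding subordinator_levy_measure_def by auto
  have "integrable \<phi> (\<lambda>x. min (norm x) 1)"
    using fin by (intro integrableI_nonneg) auto
  then have m: "integrable \<phi> (\<lambda>x. K * min (norm x) 1)" by simp
  show ?thesis
    unfolding set_integrable_def
  proof (rule Bochner_Integration.integrable_bound[OF m])
    have "(\<lambda>x. indicator {0..} x *\<^sub>R f x) \<in> borel_measurable borel"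
      by (rule borel_measurable_continuous_on_indicator[OF _ c]) simp
    then show "(\<lambda>x. indicator {0..} x *\<^sub>R f x) \<in> borel_measurable \<phi>" by measurable
    show "AE x in \<phi>. norm (indicator {0..} x *\<^sub>R f x) \<le> norm (K * min (norm x) 1)"
    proof (rule AE_I2)
      fix x
      show "norm (indicator {0..} x *\<^sub>R f x) \<le> norm (K * min (norm x) 1)"
        using b[of x] by (auto simp: indicator_def intro: order_trans)
    qed
  qed
qed

lemma continuous_on_exp_inner: "continuous_on A (\<lambda>s::real ^ 'n. exp (- (u \<bullet> s)))"
  by (intro continuous_intros)

locale subordinator_laws =
  fixes \<nu> :: "real \<Rightarrow> (real ^ 'n) measure" and b :: "real ^ 'n" and \<phi> :: "(real ^ 'n) measure"
  assumes prob: "0 \<le> t \<Longrightarrow> borel_prob (\<nu> t)"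
    and AE_orthant: "0 \<le> t \<Longrightarrow> AE s in \<nu> t. s \<in> {0..}"
    and drift: "b \<in> {0..}" and levy: "subordinator_levy_measure \<phi>"
    and laplace: "0 \<le> t \<Longrightarrow> u \<in> {0..} \<Longrightarrow>
      (\<integral>s. exp (- (u \<bullet> s)) \<partial>\<nu> t) = exp (- t * laplace_exponent b \<phi> u)"
begin

abbreviation (input) S where "S \<equiv> laplace_exponent b \<phi>"

lemma laplace_set:
  assumes "0 \<le> t" "u \<in> {0..}"
  shows "(LINT s:{0..}|\<nu> t. exp (- (u \<bullet> s))) = exp (- t * S u)"
proof -
  interpret borel_prob "\<nu> t" by (rule prob[OF assms(1)])
  have "(LINT s:{0..}|\<nu> t. exp (- (u \<bullet> s))) = (\<integral>s. exp (- (u \<bullet> s)) \<partial>\<nu> t)"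
    unfolding set_lebesgue_integral_def using AE_orthant[OF assms(1)]
    by (intro integral_cong_AE) (auto elim!: eventually_mono)
  then show ?thesis using laplace[OF assms] by simp
qed

lemma bounded_set_integrable:
  fixes f :: "real ^ 'n \<Rightarrow> 'v::euclidean_space"
  assumes t: "0 \<le> t" and c: "continuous_on {0..} f" and f: "\<And>s. s \<in> {0..} \<Longrightarrow> norm (f s) \<le> K"
  shows "set_integrable (\<nu> t) {0..} f"
proof -
  interpret borel_prob "\<nu> t" by (rule prob[OF t])
  have K: "0 \<le> K" using order_trans[OF norm_ge_zero f[of 0]] by simp
  have "(\<lambda>x. indicator {0..} x *\<^sub>R f x) \<in> borel_measurable borel"
    by (rule borel_measurable_continuous_on_indicator[OF _ c]) simp
  then show ?thesis unfolding set_integrable_def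
    using f K by (intro integrable_const_bound[where B=K]) (auto simp: indicator_def)
qed

lemma exp_diff_set_integrable:
  assumes "u \<in> {0..}"
  shows "set_integrable \<phi> {0..} (\<lambda>s. 1 - exp (- (u \<bullet> s)))"
  using one_minus_exp_upper[OF _ assms]
  by (intro levy_measure_integrable[OF levy, where K="norm u + 1"] continuous_intros) auto

abbreviation (input) w where "w \<equiv> \<lambda>s::real ^ 'n. 1 - exp (- (1 \<bullet> s))"

lemma one_orthant: "(1 :: real ^ 'n) \<in> {0..}"
  by (simp add: less_eq_vec_def)

lemma w_bounds: "s \<in> {0..} \<Longrightarrow> 0 \<le> w s" "s \<in> {0..} \<Longrightarrow> w s \<le> 1"
  using inner_orthant_nonneg[OF one_orthant] by auto

lemma weighted_integrable:
  assumes f: "bc_orthant f"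
  shows "0 \<le> t \<Longrightarrow> set_integrable (\<nu> t) {0..} (\<lambda>s. f s * w s)"
    and "set_integrable \<phi> {0..} (\<lambda>s. f s * w s)"
proof -
  obtain K where K: "\<And>s. s \<in> {0..} \<Longrightarrow> \<bar>f s\<bar> \<le> K" and c: "continuous_on {0..} f"
    using f unfolding bc_orthant_def by blast
  have K0: "0 \<le> K" using K[of 0] by simp
  show "set_integrable (\<nu> t) {0..} (\<lambda>s. f s * w s)" if "0 \<le> t"
  proof (rule bounded_set_integrable[OF that, where K="K * 1"])
    show "norm (f s * w s) \<le> K * 1" if "s \<in> {0..}" for s
      unfolding norm_mult using K[OF that] w_bounds[OF that] K0 by (intro mult_mono) auto
  qed (intro continuous_intros c)
  show "set_integrable \<phi> {0..} (\<lambda>s. f s * w s)"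
  proof (rule levy_measure_integrable[OF levy, where K="K * (norm (1::real^'n) + 1)"])
    show "norm (f s * w s) \<le> K * (norm (1::real^'n) + 1) * min (norm s) 1" if "s \<in> {0..}" for s
      unfolding norm_mult mult.assoc
      using K[OF that] one_minus_exp_upper[OF that one_orthant] K0 by (intro mult_mono) auto
  qed (intro continuous_intros c)
qed

text \<open>The weight turns an exponential into a difference of two exponentials, so the weighted
  Laplace transform is \<open>(exp (- t * S u) - exp (- t * S (u + 1))) / t\<close> and tends to
  \<open>S (u + 1) - S u\<close>. Its drift part \<open>1 \<bullet> b\<close> does not depend on
  \<open>u\<close>: it is the transform of a point mass at 0.\<close>

lemma weighted_limit:
  assumes f: "bc_orthant f"
  shows "((\<lambda>t. (LINT s:{0..}|\<nu> t. f s * w s) / t) \<longlongrightarrow>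
     (1 \<bullet> b) * f 0 + (LINT s:{0..}|\<phi>. f s * w s)) (at_right 0)"
proof -
  \<comment> \<open>The zero term brings \<open>J\<close> into the shape of
    \<open>pos_functional_weighted\<close>.\<close>
  define J where "J t f = 0 * f 0 + (1 / t) * (LINT s:{0..}|\<nu> t. f s * w s)" for t f
  define J0 where "J0 f = (1 \<bullet> b) * f 0 + 1 * (LINT s:{0..}|\<phi>. f s * w s)" for f
  have "((\<lambda>t. J t f) \<longlongrightarrow> J0 f) (at_right 0)"
  proof (rule weak_convergence_laplace[OF _ _ _ _ f])
    show "\<forall>\<^sub>F t in at_right 0. pos_functional (J t)"
      using eventually_at_right_less[of 0]
    proof eventually_elim
      case (elim t)
      then show ?case unfolding J_def
        by (intro pos_functional_weighted weighted_integrable w_bounds) auto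
    qed
    show "pos_functional J0"
      unfolding J0_def
      by (intro pos_functional_weighted weighted_integrable w_bounds inner_orthant_nonneg one_orthant drift) auto
  next
    fix u :: "real ^ 'n" assume u: "u \<in> {0..}"
    have u1: "u + 1 \<in> {0..}" using u by (simp add: less_eq_vec_def add_nonneg_nonneg)
    have e: "exp (- (u \<bullet> s)) * w s = exp (- (u \<bullet> s)) - exp (- ((u + 1) \<bullet> s))" for s :: "real ^ 'n"
      by (simp add: right_diff_distrib exp_add[symmetric] inner_add_left)
    have J: "J t (\<lambda>s. exp (- (u \<bullet> s)))
       = (exp (- t * S u) - exp (- t * S (u + 1))) / t"
      if t: "0 < t" for t
    proof -
      have "(LINT s:{0..}|\<nu> t. exp (- (u \<bullet> s)) * w s)
        = (LINT s:{0..}|\<nu> t. exp (- (u \<bullet> s))) - (LINT s:{0..}|\<nu> t. exp (- ((u + 1) \<bullet> s)))"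
        unfolding e
        by (intro set_integral_diff bounded_set_integrable[where K=1] continuous_on_exp_inner)
          (use t u u1 inner_orthant_nonneg in auto)
      then show ?thesis using laplace_set[OF _ u] laplace_set[OF _ u1] t by (simp add: J_def)
    qed
    have "((\<lambda>t. (exp (- t * p) - exp (- t * q)) / t) \<longlongrightarrow> q - p) (at_right 0)" for p q :: real
    proof -
      have "((\<lambda>t. exp (- t * p) - exp (- t * q)) has_real_derivative (q - p)) (at 0)"
        by (auto intro!: derivative_eq_intros)
      then have "((\<lambda>t. (exp (- t * p) - exp (- t * q)) / t) \<longlongrightarrow> q - p) (at 0)"
        by (simp add: DERIV_def)
      then show ?thesis by (rule tendsto_within_subset) simp
    qed
    then have "((\<lambda>t. J t (\<lambda>s. exp (- (u \<bullet> s)))) \<longlongrightarrow>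
        S (u + 1) - S u) (at_right 0)"
      by (rule Lim_transform_eventually) (use eventually_at_right_less[of 0] J in \<open>auto elim: eventually_mono\<close>)
    moreover have "S (u + 1) - S u = J0 (\<lambda>s. exp (- (u \<bullet> s)))"
    proof -
      have "(LINT s:{0..}|\<phi>. 1 - exp (- ((u + 1) \<bullet> s))) - (LINT s:{0..}|\<phi>. 1 - exp (- (u \<bullet> s)))
         = (LINT s:{0..}|\<phi>. (1 - exp (- ((u + 1) \<bullet> s))) - (1 - exp (- (u \<bullet> s))))"
        by (rule set_integral_diff(2)[symmetric]) (intro exp_diff_set_integrable u u1)+
      also have "\<dots> = (LINT s:{0..}|\<phi>. exp (- (u \<bullet> s)) * w s)"
        unfolding e by simp
      finally show ?thesis unfolding laplace_exponent_def J0_def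
        by (simp add: inner_add_left inner_commute[of b] inner_add_right)
    qed
    ultimately show "((\<lambda>t. J t (\<lambda>s. exp (- (u \<bullet> s)))) \<longlongrightarrow> J0 (\<lambda>s. exp (- (u \<bullet> s)))) (at_right 0)"
      by simp
  next
    \<comment> \<open>Tightness of the limit functional: the exponentials tend to 1 and the weight
      is an integrable majorant.\<close>
    let ?e = "\<lambda>n s. exp (- ((1 / real (Suc n)) *\<^sub>R (1 :: real ^ 'n) \<bullet> s))"
    have "(\<lambda>n. LINT s:{0..}|\<phi>. ?e n s * w s) \<longlonglongrightarrow> (LINT s:{0..}|\<phi>. 1 * w s)"
      unfolding set_lebesgue_integral_def
    proof (rule integral_dominated_convergence[where w="\<lambda>s. indicator {0..} s *\<^sub>R w s"])
      have m: "(\<lambda>s. indicator {0..} s *\<^sub>R f s) \<in> borel_measurable \<phi>"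
        if "continuous_on {0..} f" for f :: "real ^ 'n \<Rightarrow> real"
        using borel_measurable_continuous_on_indicator[OF _ that] levy
        by (simp add: subordinator_levy_measure_def cong: measurable_cong_sets)
      show "(\<lambda>s. indicator {0..} s *\<^sub>R (1 * w s)) \<in> borel_measurable \<phi>"
        by (intro m continuous_intros)
      show "(\<lambda>s. indicator {0..} s *\<^sub>R (?e n s * w s)) \<in> borel_measurable \<phi>" for n
        by (intro m continuous_intros)
      show "integrable \<phi> (\<lambda>s. indicator {0..} s *\<^sub>R w s)"
        using exp_diff_set_integrable[OF one_orthant] by (simp add: set_integrable_def)
      show "AE s in \<phi>. (\<lambda>n. indicator {0..} s *\<^sub>R (?e n s * w s))
          \<longlonglongrightarrow> indicator {0..} s *\<^sub>R (1 * w s)"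
      proof (rule AE_I2)
        fix s :: "real ^ 'n"
        have "(\<lambda>n. ?e n s) \<longlonglongrightarrow> exp (- (0 * (1 \<bullet> s)))"
          unfolding inner_scaleR_left
          using LIMSEQ_inverse_real_of_nat by (intro tendsto_intros) (simp add: inverse_eq_divide)
        then show "(\<lambda>n. indicator {0..} s *\<^sub>R (?e n s * w s))
          \<longlonglongrightarrow> indicator {0..} s *\<^sub>R (1 * w s)"
          by (intro tendsto_intros) simp
      qed
      show "AE s in \<phi>. norm (indicator {0..} s *\<^sub>R (?e n s * w s))
          \<le> indicator {0..} s *\<^sub>R w s" for n
      proof (rule AE_I2)
        fix s :: "real ^ 'n"
        show "norm (indicator {0..} s *\<^sub>R (?e n s * w s))
          \<le> indicator {0..} s *\<^sub>R w s"
          using w_bounds[of s] inner_orthant_nonneg[OF one_orthant, of s]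
          by (auto simp: indicator_def abs_mult intro!: mult_left_le_one_le)
      qed
    qed
    then show "(\<lambda>n. J0 (\<lambda>s. ?e n s)) \<longlonglongrightarrow> J0 (\<lambda>_. 1)"
      unfolding J0_def by (intro tendsto_intros) simp_all
  qed
  then show ?thesis by (simp add: J_def J0_def)
qed

text \<open>\<open>F\<close> minus its linear part, written with \<open>1 - exp (- s\<^sub>i)\<close> in place of \<open>s\<^sub>i\<close>, is a
  continuous multiple of the weight; the subtracted terms are Laplace exponents.\<close>

lemma small_time_limit_real:
  fixes F :: "real ^ 'n \<Rightarrow> real"
  assumes F: "bc_orthant F" and F0: "F 0 = 0"
    and diff: "((\<lambda>s. (F s - c \<bullet> s) / norm s) \<longlongrightarrow> 0) (at 0 within {0..})"
  shows "set_integrable \<phi> {0..} F"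
    and "((\<lambda>t. (LINT s:{0..}|\<nu> t. F s) / t) \<longlongrightarrow> b \<bullet> c + (LINT s:{0..}|\<phi>. F s)) (at_right 0)"
proof -
  let ?C = "\<Sum>i\<in>UNIV. \<bar>c $ i\<bar>"
  define lin where "lin s = (\<Sum>i\<in>UNIV. (c $ i) * (1 - exp (- (axis i 1 \<bullet> s))))" for s :: "real ^ 'n"
  \<comment> \<open>The value 0 at the origin is the continuous extension, as \<open>f0\<close>
    shows, and it removes the point mass term of \<open>weighted_limit\<close>.\<close>
  define f where "f s = (if s = 0 then 0 else (F s - lin s) / w s)" for s
  obtain K where K: "\<And>s. s \<in> {0..} \<Longrightarrow> \<bar>F s\<bar> \<le> K" and Fc: "continuous_on {0..} F"
    using F unfolding bc_orthant_def by blast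
  have linc: "continuous_on A lin" for A unfolding lin_def[abs_def] by (intro continuous_intros)
  have ax: "axis i (1::real) \<in> {0..}" for i :: 'n by (rule axis_orthant) simp
  have lin0: "lin 0 = 0" by (simp add: lin_def)
  have wpos: "0 < w s" if "s \<in> {0..}" "s \<noteq> 0" for s
  proof -
    have "0 < norm s / (1 + norm s)" using that by (intro divide_pos_pos) (auto intro: add_pos_nonneg)
    then show ?thesis using one_minus_exp_lower[OF that(1)] by linarith
  qed
  have fw: "f s * w s = F s - lin s" if "s \<in> {0..}" for s
    using wpos[OF that] F0 lin0 by (auto simp: f_def)
  have linb: "\<bar>lin s\<bar> \<le> ?C" if s: "s \<in> {0..}" for s
  proof -
    have "\<bar>lin s\<bar> \<le> (\<Sum>i\<in>UNIV. \<bar>(c $ i) * (1 - exp (- (axis i 1 \<bullet> s)))\<bar>)"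
      unfolding lin_def by (rule sum_abs)
    also have "\<dots> \<le> (\<Sum>i\<in>UNIV. \<bar>c $ i\<bar> * 1)"
      unfolding abs_mult using inner_orthant_nonneg[OF ax s]
      by (intro sum_mono mult_left_mono) (auto simp: abs_le_iff intro: order_trans[of _ 1])
    finally show ?thesis by simp
  qed
  \<comment> \<open>For \<open>x \<ge> 0\<close> the function \<open>1 - exp (- x)\<close> agrees
    with \<open>x\<close> up to \<open>x\<^sup>2\<close>, so \<open>lin\<close> may replace
    \<open>c \<bullet> s\<close> in the first-order expansion of \<open>F\<close>.\<close>
  have quad: "\<bar>c \<bullet> s - lin s\<bar> \<le> ?C * (norm s)\<^sup>2" if s: "s \<in> {0..}" for s
  proof -
    have e: "\<bar>x - (1 - exp (- x))\<bar> \<le> x\<^sup>2" if x: "0 \<le> x" for x :: real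
    proof -
      have l: "1 - x \<le> exp (- x)" using exp_ge_add_one_self[of "- x"] by simp
      have "exp (- x) \<le> 1 / (1 + x)"
        using exp_ge_add_one_self[of x] x by (simp add: exp_minus inverse_eq_divide frac_le)
      also have "\<dots> \<le> 1 - x + x\<^sup>2"
      proof -
        have "(1 - x + x\<^sup>2) * (1 + x) = 1 + x ^ 3" by (simp add: algebra_simps power2_eq_square power3_eq_cube)
        then show ?thesis using x by (simp add: pos_divide_le_eq)
      qed
      finally show ?thesis using l by (simp add: abs_le_iff)
    qed
    have "c \<bullet> s - lin s = (\<Sum>i\<in>UNIV. (c $ i) * (s $ i - (1 - exp (- (s $ i)))))"
      unfolding lin_def by (simp add: inner_vec_def[of c s] inner_axis' sum_subtractf[symmetric] right_diff_distrib)
    also have "\<bar>\<dots>\<bar> \<le> (\<Sum>i\<in>UNIV. \<bar>(c $ i) * (s $ i - (1 - exp (- (s $ i))))\<bar>)" by (rule sum_abs)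
    also have "\<dots> \<le> (\<Sum>i\<in>UNIV. \<bar>c $ i\<bar> * (norm s)\<^sup>2)"
      unfolding abs_mult
    proof (intro sum_mono mult_left_mono)
      fix i
      have "\<bar>s $ i - (1 - exp (- (s $ i)))\<bar> \<le> (s $ i)\<^sup>2" using s by (intro e) (auto simp: less_eq_vec_def)
      also have "\<dots> \<le> (norm s)\<^sup>2" using power_mono[OF component_le_norm_cart[of s i], of 2] by simp
      finally show "\<bar>s $ i - (1 - exp (- (s $ i)))\<bar> \<le> (norm s)\<^sup>2" .
    qed simp
    finally show ?thesis by (simp add: sum_distrib_right)
  qed
  \<comment> \<open>Differentiability makes the numerator \<open>o (norm s)\<close>, while the
    weight is at least \<open>norm s / (1 + norm s)\<close>.\<close>
  have f0: "(f \<longlongrightarrow> 0) (at 0 within {0..})"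
  proof (rule Lim_null_comparison)
    have "((\<lambda>s. (\<bar>(F s - c \<bullet> s) / norm s\<bar> + ?C * norm s) * (1 + norm s)) \<longlongrightarrow> (\<bar>0\<bar> + ?C * 0) * (1 + 0))
      (at 0 within {0..})"
      by (intro tendsto_intros diff tendsto_norm_zero)
    then show "((\<lambda>s. (\<bar>(F s - c \<bullet> s) / norm s\<bar> + ?C * norm s) * (1 + norm s)) \<longlongrightarrow> 0) (at 0 within {0..})"
      by simp
    show "\<forall>\<^sub>F s in at 0 within {0..}. norm (f s) \<le> (\<bar>(F s - c \<bullet> s) / norm s\<bar> + ?C * norm s) * (1 + norm s)"
      unfolding eventually_at_filter
    proof (intro always_eventually allI impI)
      fix s :: "real ^ 'n" assume s0: "s \<noteq> 0" and s: "s \<in> {0..}"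
      have n: "0 < norm s" using s0 by simp
      have "norm (f s) = \<bar>F s - lin s\<bar> / w s" using s0 wpos[OF s s0] by (simp add: f_def)
      also have "\<dots> \<le> \<bar>F s - lin s\<bar> / (norm s / (1 + norm s))"
        using one_minus_exp_lower[OF s] n by (intro divide_left_mono mult_pos_pos wpos s s0) (auto simp: add_pos_pos)
      also have "\<dots> = \<bar>F s - lin s\<bar> / norm s * (1 + norm s)" by simp
      also have "\<dots> \<le> ((\<bar>F s - c \<bullet> s\<bar> + ?C * (norm s)\<^sup>2) / norm s) * (1 + norm s)"
      proof (intro mult_right_mono divide_right_mono)
        show "\<bar>F s - lin s\<bar> \<le> \<bar>F s - c \<bullet> s\<bar> + ?C * (norm s)\<^sup>2"
          using quad[OF s] abs_triangle_ineq[of "F s - c \<bullet> s" "c \<bullet> s - lin s"] by simp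
      qed auto
      also have "\<dots> = (\<bar>(F s - c \<bullet> s) / norm s\<bar> + ?C * norm s) * (1 + norm s)"
        using n by (simp add: add_divide_distrib power2_eq_square)
      finally show "norm (f s) \<le> (\<bar>(F s - c \<bullet> s) / norm s\<bar> + ?C * norm s) * (1 + norm s)" .
    qed
  qed
  have f: "bc_orthant f"
    unfolding bc_orthant_def
  proof (intro conjI)
    show "continuous_on {0..} f"
      unfolding continuous_on_eq_continuous_within
    proof
      fix s :: "real ^ 'n" assume s: "s \<in> {0..}"
      show "continuous (at s within {0..}) f"
      proof (cases "s = 0")
        case True
        then show ?thesis using f0 by (simp add: continuous_within f_def)
      next
        case False
        have "continuous_on ({0..} - {0}) (\<lambda>s. (F s - lin s) / w s)"
          using wpos by (intro continuous_intros linc continuous_on_subset[OF Fc]) (auto simp: less_imp_neq[THEN not_sym])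
        then have "continuous_on ({0..} - {0}) f"
          by (rule continuous_on_eq) (simp add: f_def)
        then have "continuous (at s within {0..} - {0}) f"
          using s False by (simp add: continuous_on_eq_continuous_within)
        moreover have "at s within {0..} - {0} = at s within {0..}"
          by (rule at_within_nhd[where S="- {0}"]) (use False in auto)
        ultimately show ?thesis by simp
      qed
    qed
    have "\<forall>\<^sub>F s in at 0 within {0..}. dist (f s) 0 < 1" by (rule tendstoD[OF f0]) simp
    then obtain d where d: "0 < d" "\<And>s. s \<in> {0..} \<Longrightarrow> s \<noteq> 0 \<Longrightarrow> norm s < d \<Longrightarrow> \<bar>f s\<bar> < 1"
      unfolding eventually_at by (auto simp: dist_norm)
    have K0: "0 \<le> K + ?C"
      using K[of 0] by (intro add_nonneg_nonneg sum_nonneg) auto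
    \<comment> \<open>Within distance \<open>d\<close> of 0 the convergence \<open>f0\<close> bounds
      \<open>f\<close> by 1; farther away the numerator is bounded and the weight is at least
      \<open>d / (1 + d)\<close>.\<close>
    have "\<bar>f s\<bar> \<le> 1 + (K + ?C) / (d / (1 + d))" if s: "s \<in> {0..}" for s
    proof (cases "s = 0 \<or> norm s < d")
      case True
      have "0 \<le> (K + ?C) / (d / (1 + d))"
        using K0 d by (intro divide_nonneg_nonneg) auto
      moreover have "\<bar>f s\<bar> \<le> 1" using True d(2)[OF s] by (cases "s = 0") (auto simp: f_def)
      ultimately show ?thesis by linarith
    next
      case False
      then have s0: "s \<noteq> 0" and n: "d \<le> norm s" by auto
      have "d / (1 + d) \<le> norm s / (1 + norm s)" using d n by (simp add: divide_simps algebra_simps)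
      then have wl: "d / (1 + d) \<le> w s" using one_minus_exp_lower[OF s] by linarith
      have "\<bar>f s\<bar> = \<bar>F s - lin s\<bar> / w s" using s0 wpos[OF s s0] by (simp add: f_def)
      also have "\<dots> \<le> (K + ?C) / (d / (1 + d))"
        using K[OF s] linb[OF s] wl d by (intro frac_le) auto
      finally show ?thesis by simp
    qed
    then show "\<exists>K. \<forall>s\<in>{0..}. \<bar>f s\<bar> \<le> K" by blast
  qed
  have F_ind: "indicator {0..} s *\<^sub>R F s = indicator {0..} s *\<^sub>R (f s * w s + lin s)" for s :: "real ^ 'n"
    using fw[of s] by (cases "s \<in> {0..}") simp_all
  have ilin: "set_integrable m {0..} lin"
    if "\<And>u. u \<in> {0..} \<Longrightarrow> set_integrable m {0..} (\<lambda>s. 1 - exp (- (u \<bullet> s)))" for m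
    unfolding lin_def[abs_def] set_integrable_def scaleR_sum_right
    using set_integrable_mult_right[OF that[OF ax]]
    by (intro Bochner_Integration.integrable_sum) (simp add: set_integrable_def)
  have vlin: "(LINT s:{0..}|m. lin s) = (\<Sum>i\<in>UNIV. (c $ i) * (LINT s:{0..}|m. 1 - exp (- (axis i 1 \<bullet> s))))"
    if "\<And>u. u \<in> {0..} \<Longrightarrow> set_integrable m {0..} (\<lambda>s. 1 - exp (- (u \<bullet> s)))" for m
  proof -
    have "(LINT s:{0..}|m. lin s) = (\<Sum>i\<in>UNIV. LINT s:{0..}|m. (c $ i) * (1 - exp (- (axis i 1 \<bullet> s))))"
      unfolding lin_def set_lebesgue_integral_def scaleR_sum_right
      using set_integrable_mult_right[OF that[OF ax]]
      by (intro Bochner_Integration.integral_sum) (simp add: set_integrable_def)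
    then show ?thesis by simp
  qed
  have i\<nu>: "set_integrable (\<nu> t) {0..} (\<lambda>s. 1 - exp (- (u \<bullet> s)))" if "0 \<le> t" "u \<in> {0..}" for t u
    using inner_orthant_nonneg[OF that(2)] that(1)
    by (intro bounded_set_integrable[where K=1] continuous_intros) (auto simp: abs_le_iff intro: order_trans[of _ 1])
  have split: "(LINT s:{0..}|m. F s) = (LINT s:{0..}|m. f s * w s) + (LINT s:{0..}|m. lin s)"
    if "set_integrable m {0..} (\<lambda>s. f s * w s)" "set_integrable m {0..} lin" for m
    using set_integral_add(2)[OF that] unfolding set_lebesgue_integral_def F_ind .
  show "set_integrable \<phi> {0..} F"
    using set_integral_add(1)[OF weighted_integrable(2)[OF f] ilin[OF exp_diff_set_integrable]]
    unfolding set_integrable_def F_ind .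
  have one: "(LINT s:{0..}|\<nu> t. 1 - exp (- (u \<bullet> s))) = 1 - exp (- t * S u)"
    if "0 \<le> t" "u \<in> {0..}" for t u
  proof -
    have "(LINT s:{0..}|\<nu> t. 1 - exp (- (u \<bullet> s)))
       = (LINT s:{0..}|\<nu> t. 1) - (LINT s:{0..}|\<nu> t. exp (- (u \<bullet> s)))"
      using that inner_orthant_nonneg[OF that(2)]
      by (intro set_integral_diff bounded_set_integrable[where K=1] continuous_intros) auto
    \<comment> \<open>The total mass is the Laplace transform at \<open>u = 0\<close>, where the
      exponent vanishes.\<close>
    moreover have "(LINT s:{0..}|\<nu> t. 1::real) = 1"
      using laplace_set[OF that(1), of 0] by (simp add: laplace_exponent_def)
    ultimately show ?thesis using laplace_set[OF that] by simp
  qed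
  have dl: "((\<lambda>t. (1 - exp (- t * p)) / t) \<longlongrightarrow> p) (at_right 0)" for p :: real
  proof -
    have "((\<lambda>t. 1 - exp (- t * p)) has_real_derivative p) (at 0)"
      by (auto intro!: derivative_eq_intros)
    then have "((\<lambda>t. (1 - exp (- t * p)) / t) \<longlongrightarrow> p) (at 0)"
      by (simp add: DERIV_def)
    then show ?thesis by (rule tendsto_within_subset) simp
  qed
  have "((\<lambda>t. (LINT s:{0..}|\<nu> t. f s * w s) / t
       + (\<Sum>i\<in>UNIV. (c $ i) * ((1 - exp (- t * S (axis i 1))) / t))) \<longlongrightarrow>
     ((1 \<bullet> b) * f 0 + (LINT s:{0..}|\<phi>. f s * w s)) + (\<Sum>i\<in>UNIV. (c $ i) * S (axis i 1)))
     (at_right 0)"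
    by (intro tendsto_intros weighted_limit[OF f] dl)
  then have "((\<lambda>t. (LINT s:{0..}|\<nu> t. F s) / t) \<longlongrightarrow>
     ((1 \<bullet> b) * f 0 + (LINT s:{0..}|\<phi>. f s * w s)) + (\<Sum>i\<in>UNIV. (c $ i) * S (axis i 1)))
     (at_right 0)"
  proof (rule Lim_transform_eventually)
    show "\<forall>\<^sub>F t in at_right 0. (LINT s:{0..}|\<nu> t. f s * w s) / t
       + (\<Sum>i\<in>UNIV. (c $ i) * ((1 - exp (- t * S (axis i 1))) / t))
       = (LINT s:{0..}|\<nu> t. F s) / t"
      using eventually_at_right_less[of 0]
    proof eventually_elim
      case (elim t)
      then have t: "0 \<le> t" by simp
      show ?case
      proof -
        have "(LINT s:{0..}|\<nu> t. F s) = (LINT s:{0..}|\<nu> t. f s * w s) + (LINT s:{0..}|\<nu> t. lin s)"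
          using i\<nu>[OF t] by (intro split weighted_integrable(1) f t ilin)
        also have "(LINT s:{0..}|\<nu> t. lin s) = (\<Sum>i\<in>UNIV. (c $ i) * (1 - exp (- t * S (axis i 1))))"
          using vlin[OF i\<nu>[OF t]] by (simp only: one[OF t ax])
        finally show ?thesis by (simp only: add_divide_distrib sum_divide_distrib times_divide_eq_right)
      qed
    qed
  qed
  moreover have "((1 \<bullet> b) * f 0 + (LINT s:{0..}|\<phi>. f s * w s)) + (\<Sum>i\<in>UNIV. (c $ i) * S (axis i 1))
     = b \<bullet> c + (LINT s:{0..}|\<phi>. F s)"
  proof -
    \<comment> \<open>Here the individual coordinates of the drift reappear: the exponent at the
      \<open>i\<close>-th basis vector has drift part \<open>b $ i\<close>.\<close>
    have "(\<Sum>i\<in>UNIV. (c $ i) * S (axis i 1)) =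
       (\<Sum>i\<in>UNIV. (c $ i) * (b $ i)) + (LINT s:{0..}|\<phi>. lin s)"
    proof -
      have "(LINT s:{0..}|\<phi>. lin s) = (\<Sum>i\<in>UNIV. (c $ i) * (LINT s:{0..}|\<phi>. 1 - exp (- (axis i 1 \<bullet> s))))"
        by (intro vlin exp_diff_set_integrable)
      then show ?thesis
        unfolding laplace_exponent_def by (simp add: inner_axis distrib_left sum.distrib)
    qed
    moreover have "(\<Sum>i\<in>UNIV. (c $ i) * (b $ i)) = b \<bullet> c"
      by (simp add: inner_vec_def mult.commute)
    moreover have "(LINT s:{0..}|\<phi>. F s) = (LINT s:{0..}|\<phi>. f s * w s) + (LINT s:{0..}|\<phi>. lin s)"
      by (intro split weighted_integrable(2) f ilin exp_diff_set_integrable)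
    ultimately show ?thesis by (simp add: f_def)
  qed
  ultimately show "((\<lambda>t. (LINT s:{0..}|\<nu> t. F s) / t) \<longlongrightarrow> b \<bullet> c + (LINT s:{0..}|\<phi>. F s)) (at_right 0)"
    by simp
qed

lemma small_time_limit:
  fixes F :: "real ^ 'n \<Rightarrow> 'v::euclidean_space"
  assumes Fc: "continuous_on {0..} F" and K: "\<And>s. s \<in> {0..} \<Longrightarrow> norm (F s) \<le> K" and F0: "F 0 = 0"
    and diff: "((\<lambda>s. (F s - (\<Sum>j\<in>UNIV. (s $ j) *\<^sub>R c j)) /\<^sub>R norm s) \<longlongrightarrow> 0) (at 0 within {0..})"
  shows "set_integrable \<phi> {0..} F"
    and "((\<lambda>t. (LINT s:{0..}|\<nu> t. F s) /\<^sub>R t) \<longlongrightarrow>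
      (\<Sum>j\<in>UNIV. (b $ j) *\<^sub>R c j) + (LINT s:{0..}|\<phi>. F s)) (at_right 0)"
proof -
  have comp: "set_integrable \<phi> {0..} (\<lambda>s. F s \<bullet> i)"
    "((\<lambda>t. (LINT s:{0..}|\<nu> t. F s \<bullet> i) / t) \<longlongrightarrow>
      b \<bullet> (\<chi> j. c j \<bullet> i) + (LINT s:{0..}|\<phi>. F s \<bullet> i)) (at_right 0)" if i: "i \<in> Basis" for i
  proof -
    have bc: "bc_orthant (\<lambda>s. F s \<bullet> i)"
      unfolding bc_orthant_def
    proof (intro conjI exI[of _ K] ballI)
      show "\<bar>F s \<bullet> i\<bar> \<le> K" if "s \<in> {0..}" for s
        using Basis_le_norm[OF i, of "F s"] K[OF that] by linarith
    qed (intro continuous_intros Fc)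
    have "((\<lambda>s. ((F s - (\<Sum>j\<in>UNIV. (s $ j) *\<^sub>R c j)) /\<^sub>R norm s) \<bullet> i) \<longlongrightarrow> 0 \<bullet> i) (at 0 within {0..})"
      by (intro tendsto_intros diff)
    moreover have "((F s - (\<Sum>j\<in>UNIV. (s $ j) *\<^sub>R c j)) /\<^sub>R norm s) \<bullet> i
       = (F s \<bullet> i - (\<chi> j. c j \<bullet> i) \<bullet> s) / norm s" for s
      by (simp add: inner_diff_left inner_sum_left inner_vec_def mult.commute divide_inverse_commute)
    ultimately have d: "((\<lambda>s. (F s \<bullet> i - (\<chi> j. c j \<bullet> i) \<bullet> s) / norm s) \<longlongrightarrow> 0) (at 0 within {0..})"
      by simp
    show "set_integrable \<phi> {0..} (\<lambda>s. F s \<bullet> i)"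
      "((\<lambda>t. (LINT s:{0..}|\<nu> t. F s \<bullet> i) / t) \<longlongrightarrow>
      b \<bullet> (\<chi> j. c j \<bullet> i) + (LINT s:{0..}|\<phi>. F s \<bullet> i)) (at_right 0)"
      using small_time_limit_real[OF bc _ d] F0 by auto
  qed
  show iF: "set_integrable \<phi> {0..} F"
  proof -
    have "integrable \<phi> (\<lambda>s. \<Sum>i\<in>Basis. (indicator {0..} s *\<^sub>R (F s \<bullet> i)) *\<^sub>R i)"
      using comp(1) by (intro Bochner_Integration.integrable_sum integrable_scaleR_left) (simp add: set_integrable_def)
    also have "(\<lambda>s. \<Sum>i\<in>Basis. (indicator {0..} s *\<^sub>R (F s \<bullet> i)) *\<^sub>R i) = (\<lambda>s. indicator {0..} s *\<^sub>R F s)"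
    proof
      fix s
      have "(\<Sum>i\<in>Basis. (indicator {0..} s *\<^sub>R (F s \<bullet> i)) *\<^sub>R i) = indicator {0..} s *\<^sub>R (\<Sum>i\<in>Basis. (F s \<bullet> i) *\<^sub>R i)"
        by (simp add: scaleR_sum_right)
      then show "(\<Sum>i\<in>Basis. (indicator {0..} s *\<^sub>R (F s \<bullet> i)) *\<^sub>R i) = indicator {0..} s *\<^sub>R F s"
        by (simp add: euclidean_representation)
    qed
    finally show ?thesis by (simp add: set_integrable_def)
  qed
  have inn: "(LINT s:{0..}|m. F s) \<bullet> i = (LINT s:{0..}|m. F s \<bullet> i)" if "set_integrable m {0..} F" for m i
    using integral_inner_left[of i m "\<lambda>s. indicator {0..} s *\<^sub>R F s"] that
    by (simp add: set_lebesgue_integral_def set_integrable_def)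
  show "((\<lambda>t. (LINT s:{0..}|\<nu> t. F s) /\<^sub>R t) \<longlongrightarrow>
      (\<Sum>j\<in>UNIV. (b $ j) *\<^sub>R c j) + (LINT s:{0..}|\<phi>. F s)) (at_right 0)"
    unfolding tendsto_componentwise_iff[of "\<lambda>t. (LINT s:{0..}|\<nu> t. F s) /\<^sub>R t"]
  proof
    fix i :: 'v assume i: "i \<in> Basis"
    have eq: "((\<Sum>j\<in>UNIV. (b $ j) *\<^sub>R c j) + (LINT s:{0..}|\<phi>. F s)) \<bullet> i
       = b \<bullet> (\<chi> j. c j \<bullet> i) + (LINT s:{0..}|\<phi>. F s \<bullet> i)"
      using inn[OF iF] by (simp add: inner_add_left inner_sum_left inner_vec_def)
    show "((\<lambda>t. ((LINT s:{0..}|\<nu> t. F s) /\<^sub>R t) \<bullet> i) \<longlongrightarrow>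
        ((\<Sum>j\<in>UNIV. (b $ j) *\<^sub>R c j) + (LINT s:{0..}|\<phi>. F s)) \<bullet> i) (at_right 0)"
      unfolding eq
    proof (rule Lim_transform_eventually[OF comp(2)[OF i]])
      show "\<forall>\<^sub>F t in at_right 0. (LINT s:{0..}|\<nu> t. F s \<bullet> i) / t = ((LINT s:{0..}|\<nu> t. F s) /\<^sub>R t) \<bullet> i"
        using eventually_at_right_less[of 0]
      proof eventually_elim
        case (elim t)
        have "set_integrable (\<nu> t) {0..} F" using elim by (intro bounded_set_integrable[OF _ Fc K]) auto
        then show ?case using inn by (simp add: divide_inverse_commute)
      qed
    qed
  qed
qed

end

section \<open>Semigroups of Levy fields\<close>

lemma uniform_limit_C0:
  fixes f :: "'i \<Rightarrow> 'e::real_normed_vector \<Rightarrow> 'v::real_normed_vector"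
  assumes F: "F \<noteq> bot" and f: "\<forall>\<^sub>F i in F. f i \<in> C0" and lim: "uniform_limit UNIV f g F"
  shows "g \<in> C0"
proof -
  have "continuous_on UNIV g"
    by (rule uniform_limit_theorem[OF _ lim F]) (use f in \<open>auto simp: C0_def elim: eventually_mono\<close>)
  moreover have "(g \<longlongrightarrow> 0) at_infinity"
  proof (rule tendstoI)
    fix e :: real assume e: "0 < e"
    have "\<forall>\<^sub>F i in F. \<forall>x\<in>UNIV. dist (f i x) (g x) < e / 2"
      using lim e by (auto dest: uniform_limitD[where e="e/2"])
    from eventually_happens'[OF F eventually_conj[OF this f]]
    obtain i where i: "\<And>x. dist (f i x) (g x) < e / 2" "(f i \<longlongrightarrow> 0) at_infinity"
      by (auto simp: C0_def)
    have "\<forall>\<^sub>F x in at_infinity. dist (f i x) 0 < e / 2" using tendstoD[OF i(2), of "e / 2"] e by simp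
    then show "\<forall>\<^sub>F x in at_infinity. dist (g x) 0 < e"
    proof eventually_elim
      case (elim x)
      then show ?case using i(1)[of x] dist_triangle3[of "g x" 0 "f i x"] by simp
    qed
  qed
  ultimately show ?thesis by (simp add: C0_def)
qed

text \<open>Dominated convergence works along sequences, so failure of decay is first turned into a
  sequence of points escaping to infinity; along it every translate of \<open>h\<close> tends to 0
  pointwise.\<close>

lemma (in borel_prob) cv_C0:
  fixes h :: "'e \<Rightarrow> 'v::euclidean_space"
  assumes h: "bdlip C h" and lim: "(h \<longlongrightarrow> 0) at_infinity"
  shows "cv \<mu> h \<in> C0"
proof -
  have "(cv \<mu> h \<longlongrightarrow> 0) at_infinity"
  proof (rule ccontr)
    assume "\<not> (cv \<mu> h \<longlongrightarrow> 0) at_infinity"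
    then obtain e where e: "0 < e" "\<not> (\<forall>\<^sub>F x in at_infinity. norm (cv \<mu> h x) < e)"
      unfolding tendsto_iff by auto
    have "\<exists>x. real n \<le> norm x \<and> e \<le> norm (cv \<mu> h x)" for n
      using e(2) unfolding eventually_at_infinity by (meson not_le)
    then obtain X where X: "\<And>n. real n \<le> norm (X n)" "\<And>n. e \<le> norm (cv \<mu> h (X n))" by metis
    have "filterlim (\<lambda>n. norm (X n)) at_top sequentially"
      by (rule filterlim_at_top_mono[OF filterlim_real_sequentially]) (use X(1) in auto)
    then have Xinf: "filterlim X at_infinity sequentially" by (rule filterlim_norm_at_top_imp_at_infinity)
    have "(\<lambda>n. \<integral>y. h (X n + y) \<partial>\<mu>) \<longlonglongrightarrow> (\<integral>y. 0 \<partial>\<mu>)"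
    proof (rule integral_dominated_convergence[where w="\<lambda>_. C"])
      show "AE y in \<mu>. (\<lambda>n. h (X n + y)) \<longlonglongrightarrow> 0"
      proof (rule AE_I2)
        fix y
        have "filterlim (\<lambda>n. X n + y) at_infinity sequentially"
          by (rule tendsto_add_filterlim_at_infinity'[OF Xinf tendsto_const])
        then show "(\<lambda>n. h (X n + y)) \<longlonglongrightarrow> 0" by (rule filterlim_compose[OF lim])
      qed
      show "(\<lambda>y. h (X n + y)) \<in> borel_measurable \<mu>" for n
        by (rule borel_measurable_integrable[OF bdlip_integrable(2)[OF h]])
    qed (use h in \<open>auto simp: bdlip_def\<close>)
    then have "(\<lambda>n. cv \<mu> h (X n)) \<longlonglongrightarrow> 0" by (simp add: cv_def)
    then have "\<forall>\<^sub>F n in sequentially. norm (cv \<mu> h (X n)) < e"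
      using e(1) by (auto simp: tendsto_iff)
    then obtain n where "norm (cv \<mu> h (X n)) < e" by (meson eventually_happens' sequentially_bot)
    then show False using X(2)[of n] by simp
  qed
  then show ?thesis using bdlip_continuous[OF bdlip_cv[OF h]] by (simp add: C0_def)
qed

lemma generator1_eq:
  assumes "is_generator_value T h g"
  shows "generator1 T h = g"
  unfolding generator1_def
proof (rule the_equality)
  show "is_generator_value T h g" by fact
  fix g' assume g': "is_generator_value T h g'"
  show "g' = g"
  proof
    fix x
    show "g' x = g x"
    proof (rule tendsto_unique)
      show "((\<lambda>t. (T t h x - h x) /\<^sub>R t) \<longlongrightarrow> g' x) (at_right 0)"
        "((\<lambda>t. (T t h x - h x) /\<^sub>R t) \<longlongrightarrow> g x) (at_right 0)"
        using assms g' unfolding is_generator_value_def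
        by (auto intro: tendsto_uniform_limitI)
    qed simp
  qed
qed

lemma (in conv_semigroup) generator_value_exists:
  fixes h :: "'e \<Rightarrow> 'v::euclidean_space"
  assumes h: "good C h" "h \<in> C0" and T: "\<And>t. 0 < t \<Longrightarrow> T t h = cv (\<mu> t) h"
  shows "\<exists>g K. is_generator_value T h g \<and> (\<forall>x. norm (g x) \<le> K)"
proof -
  obtain g where g: "uniform_limit UNIV (\<lambda>t x. (cv (\<mu> t) h x - h x) /\<^sub>R t) g (at_right 0)"
    using generator_exists[OF h(1)] by blast
  have bl: "bdlip C h" using h by (simp add: good_def)
  have C0: "(\<lambda>x. (cv (\<mu> t) h x - h x) /\<^sub>R t) \<in> C0" if t: "0 < t" for t
  proof -
    interpret borel_prob "\<mu> t" using t by (intro prob) simp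
    have "cv (\<mu> t) h \<in> C0" using h(2) by (intro cv_C0[OF bl]) (simp add: C0_def)
    then show ?thesis using h(2) unfolding C0_def
      by (auto intro!: continuous_intros tendsto_eq_intros)
  qed
  have ev: "\<forall>\<^sub>F t in at_right 0. (0::real) < t" by (rule eventually_at_right_less)
  have gC0: "g \<in> C0"
    by (rule uniform_limit_C0[OF _ eventually_mono[OF ev C0] g]) simp_all
  have "\<forall>\<^sub>F t in at_right 0. \<forall>x\<in>UNIV. dist ((cv (\<mu> t) h x - h x) /\<^sub>R t) (g x) < 1"
    using uniform_limitD[OF g, of 1] by simp
  from eventually_happens'[OF _ eventually_conj[OF ev this]]
  obtain t where t: "0 < t" "\<And>x. dist ((cv (\<mu> t) h x - h x) /\<^sub>R t) (g x) < 1" by auto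
  interpret t: borel_prob "\<mu> t" using t by (intro prob) simp
  \<comment> \<open>The limit \<open>g\<close> lies within distance 1 of a single difference
    quotient, uniformly in \<open>x\<close>. The bound is recorded because
    \<open>semigroup_differentiable_at_0\<close> integrates \<open>g\<close> against the
    laws.\<close>
  have "norm (g x) \<le> (C + C) / t + 1" for x
  proof -
    have "norm (cv (\<mu> t) h x - h x) \<le> C + C"
      using bdlip_diff[OF t.bdlip_cv[OF bl] bl] by (simp add: bdlip_def)
    then have "norm ((cv (\<mu> t) h x - h x) /\<^sub>R t) \<le> (C + C) / t"
      using t(1) by (simp add: divide_inverse_commute mult_left_mono)
    then show ?thesis
      using t(2)[of x] norm_triangle_sub[of "g x" "(cv (\<mu> t) h x - h x) /\<^sub>R t"]
      by (simp add: dist_norm norm_minus_commute)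
  qed
  moreover have "is_generator_value T h g"
    unfolding is_generator_value_def
  proof (intro conjI h(2) gC0)
    show "uniform_limit UNIV (\<lambda>t x. (T t h x - h x) /\<^sub>R t) g (at_right 0)"
      by (rule uniform_limit_cong[THEN iffD1, OF _ _ g])
        (use ev T in \<open>auto elim!: eventually_mono\<close>)
  qed
  ultimately show ?thesis by blast
qed

section \<open>Expectations over an event, and the joint law of two independent variables\<close>

lemma (in prob_space) integrable_const_indicator:
  "E \<in> sets M \<Longrightarrow> integrable M (\<lambda>\<omega>. c + a * indicator E \<omega> :: real)"
  by (intro Bochner_Integration.integrable_add integrable_const integrable_mult_right
      integrable_real_indicator) (auto simp: less_top[symmetric])

lemma (in prob_space) expectation_const_indicator:
  assumes "E \<in> sets M"
  shows "expectation (\<lambda>\<omega>. c + a * indicator E \<omega> :: real) = c + a * prob E"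
proof -
  have "integrable M (\<lambda>\<omega>. a * indicator E \<omega>)"
    using integrable_const_indicator[OF assms, of 0 a] by simp
  then show ?thesis using assms sets.sets_into_space[OF assms]
    by (subst Bochner_Integration.integral_add) (auto simp: prob_space Int_absorb2)
qed

text \<open>A product of finite measures is determined by its values on rectangles. Independence is
  phrased through such events so that the lemma serves both for two increments of one field and for
  two fields with different value spaces.\<close>

lemma (in prob_space) joint_distr_eq_pair:
  fixes U :: "'a \<Rightarrow> 'b::euclidean_space" and V :: "'a \<Rightarrow> 'c::euclidean_space"
  assumes [measurable]: "U \<in> borel_measurable M" "V \<in> borel_measurable M"
    and ind: "\<And>A B. A \<in> sets borel \<Longrightarrow> B \<in> sets borel \<Longrightarrow>
      prob ((U -` A \<inter> space M) \<inter> (V -` B \<inter> space M)) = prob (U -` A \<inter> space M) * prob (V -` B \<inter> space M)"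
  shows "distr M borel U \<Otimes>\<^sub>M distr M borel V = distr M (borel \<Otimes>\<^sub>M borel) (\<lambda>\<omega>. (U \<omega>, V \<omega>))"
proof (rule pair_measure_eqI)
  show "sigma_finite_measure (distr M borel U)" "sigma_finite_measure (distr M borel V)"
    by (auto intro!: prob_space_imp_sigma_finite prob_space_distr)
  show "sets (distr M borel U \<Otimes>\<^sub>M distr M borel V) = sets (distr M (borel \<Otimes>\<^sub>M borel) (\<lambda>\<omega>. (U \<omega>, V \<omega>)))"
    by (simp cong: sets_pair_measure_cong)
  fix A B assume "A \<in> sets (distr M borel U)" "B \<in> sets (distr M borel V)"
  then have AB [measurable]: "A \<in> sets borel" "B \<in> sets borel" by auto
  have "(\<lambda>\<omega>. (U \<omega>, V \<omega>)) -` (A \<times> B) \<inter> space M = (U -` A \<inter> space M) \<inter> (V -` B \<inter> space M)" by auto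
  then show "emeasure (distr M borel U) A * emeasure (distr M borel V) B
     = emeasure (distr M (borel \<Otimes>\<^sub>M borel) (\<lambda>\<omega>. (U \<omega>, V \<omega>))) (A \<times> B)"
    using AB by (simp add: emeasure_distr emeasure_eq_measure ind ennreal_mult[symmetric])
qed

section \<open>The laws of a Levy field form a convolution semigroup\<close>

locale levy =
  fixes M :: "'a measure" and X :: "real ^ 'n \<Rightarrow> 'a \<Rightarrow> 'b::euclidean_space"
  assumes levy: "levy_field M X"
begin

sublocale prob_space M using levy by (simp add: levy_field_def)

definition law :: "real ^ 'n \<Rightarrow> 'b measure" where "law t = distr M borel (X t)"

lemma X_measurable [measurable]: "t \<in> {0..} \<Longrightarrow> X t \<in> borel_measurable M"
  using levy unfolding levy_field_def by blast

lemma X_zero: "AE \<omega> in M. X 0 \<omega> = 0"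
  using levy unfolding levy_field_def by blast

lemma X_stoch_cont:
  "t \<in> {0..} \<Longrightarrow> 0 < \<epsilon> \<Longrightarrow>
    ((\<lambda>s. prob {\<omega> \<in> space M. norm (X s \<omega> - X t \<omega>) > \<epsilon>}) \<longlongrightarrow> 0) (at t within {0..})"
  using levy unfolding levy_field_def by blast

lemma X_increment:
  "t \<in> {0..} \<Longrightarrow> \<tau> \<in> {0..} \<Longrightarrow> distr M borel (\<lambda>\<omega>. X (t + \<tau>) \<omega> - X t \<omega>) = law \<tau>"
  using levy unfolding levy_field_def law_def by blast

lemma borel_prob_law: "t \<in> {0..} \<Longrightarrow> borel_prob (law t)"
  unfolding law_def
  by (intro borel_prob.intro borel_prob_axioms.intro prob_space_distr) auto

text \<open>Along the chain \<open>0 \<le> s \<le> s + t\<close> the variable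
  \<open>X (s + t)\<close> is almost surely the sum of two independent increments, with laws
  \<open>law s\<close> and \<open>law t\<close> by stationarity.\<close>

lemma law_convolution:
  assumes s: "s \<in> {0..}" and t: "t \<in> {0..}"
  shows "law (s + t) = distr (law s \<Otimes>\<^sub>M law t) borel (\<lambda>(a, b). a + b)"
proof -
  have st: "s + t \<in> {0..}" and z: "0 \<in> {0 :: real ^ 'n..}" using s t by (auto simp: add_nonneg_nonneg)
  note [measurable] = X_measurable[OF s] X_measurable[OF t] X_measurable[OF st] X_measurable[OF z]
  define u where "u j = (if j = 0 then 0 else if j = 1 then s else s + t)" for j :: nat
  define D where "D j \<omega> = X (u (Suc j)) \<omega> - X (u j) \<omega>" for j \<omega>
  have "indep_vars (\<lambda>_. borel) D {..<2}"
  proof -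
    have "u 0 = 0 \<and> (\<forall>j<2. u j \<le> u (Suc j))"
      using s t by (auto simp: u_def less_Suc_eq numeral_2_eq_2)
    then show ?thesis using levy unfolding levy_field_def D_def[abs_def] by blast
  qed
  then have ind: "prob (\<Inter>j\<in>{0,1}. D j -` A j \<inter> space M) = (\<Prod>j\<in>{0,1}. prob (D j -` A j \<inter> space M))"
    if "\<And>j. A j \<in> sets borel" for A
    by (rule indep_varsD) (use that in auto)
  have D0: "distr M borel (D 0) = law s" using X_increment[OF z s] by (simp add: D_def[abs_def] u_def)
  have D1: "distr M borel (D 1) = law t" using X_increment[OF s t] by (simp add: D_def[abs_def] u_def)
  have Dm [measurable]: "D 0 \<in> borel_measurable M" "D 1 \<in> borel_measurable M"
    unfolding D_def[abs_def] u_def by auto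
  have "law s \<Otimes>\<^sub>M law t = distr M (borel \<Otimes>\<^sub>M borel) (\<lambda>\<omega>. (D 0 \<omega>, D 1 \<omega>))"
    unfolding D0[symmetric] D1[symmetric]
  proof (rule joint_distr_eq_pair[OF Dm])
    fix A B :: "'b set" assume "A \<in> sets borel" "B \<in> sets borel"
    then show "prob ((D 0 -` A \<inter> space M) \<inter> (D 1 -` B \<inter> space M))
       = prob (D 0 -` A \<inter> space M) * prob (D 1 -` B \<inter> space M)"
      using ind[of "\<lambda>j. if j = 0 then A else B"] by simp
  qed
  then have "distr (law s \<Otimes>\<^sub>M law t) borel (\<lambda>(a, b). a + b) = distr M borel (\<lambda>\<omega>. D 0 \<omega> + D 1 \<omega>)"
    using Dm(2) by (simp add: distr_distr comp_def)
  also have "\<dots> = law (s + t)"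
    unfolding law_def
  proof (rule distr_cong_AE)
    show "AE \<omega> in M. D 0 \<omega> + D 1 \<omega> = X (s + t) \<omega>"
      using X_zero by eventually_elim (simp add: D_def u_def)
    have "(\<lambda>\<omega>. D 0 \<omega> + D 1 \<omega>) \<in> borel_measurable M" by measurable
    then show "(\<lambda>\<omega>. D 0 \<omega> + D 1 \<omega>) \<in> measurable M borel" .
  qed auto
  finally show ?thesis by simp
qed

lemma law_integral_add:
  fixes g :: "'b \<Rightarrow> 'v::euclidean_space"
  assumes s: "s \<in> {0..}" and t: "t \<in> {0..}" and g [measurable]: "g \<in> borel_measurable borel"
    and K: "\<And>y. norm (g y) \<le> K"
  shows "(\<integral>y. g y \<partial>law (s + t)) = (\<integral>a. (\<integral>b. g (a + b) \<partial>law t) \<partial>law s)"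
proof -
  interpret s: borel_prob "law s" by (rule borel_prob_law[OF s])
  interpret t: borel_prob "law t" by (rule borel_prob_law[OF t])
  interpret pair_prob_space "law s" "law t" ..
  have gm: "(\<lambda>(a, b). g (a + b)) \<in> borel_measurable (law s \<Otimes>\<^sub>M law t)" by measurable
  have i: "integrable (law s \<Otimes>\<^sub>M law t) (\<lambda>(a, b). g (a + b))"
    using K gm by (intro P.integrable_const_bound[where B=K]) auto
  have "(\<integral>y. g y \<partial>law (s + t)) = (\<integral>p. (case p of (a, b) \<Rightarrow> g (a + b)) \<partial>(law s \<Otimes>\<^sub>M law t))"
    unfolding law_convolution[OF s t] by (subst integral_distr) (auto simp: case_prod_beta')
  also have "\<dots> = (\<integral>a. (\<integral>b. g (a + b) \<partial>law t) \<partial>law s)"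
    using integral_fst'[OF i] by simp
  finally show ?thesis .
qed

lemma cv_law_add:
  fixes f :: "'b \<Rightarrow> 'v::euclidean_space"
  assumes s: "s \<in> {0..}" and t: "t \<in> {0..}" and f: "continuous_on UNIV f" "\<And>y. norm (f y) \<le> K"
  shows "cv (law (s + t)) f x = cv (law s) (cv (law t) f) x"
proof -
  have [measurable]: "f \<in> borel_measurable borel" by (rule borel_measurable_continuous_onI[OF f(1)])
  show ?thesis
    unfolding cv_def using law_integral_add[OF s t, of "\<lambda>y. f (x + y)" K] f(2)
    by (simp add: add.assoc)
qed

lemma law_zero:
  fixes g :: "'b \<Rightarrow> 'v::euclidean_space"
  assumes g [measurable]: "g \<in> borel_measurable borel"
  shows "(\<integral>y. g y \<partial>law 0) = g 0"
proof -
  have [measurable]: "X 0 \<in> borel_measurable M" by (rule X_measurable) simp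
  have "(\<integral>y. g y \<partial>law 0) = (\<integral>\<omega>. g (X 0 \<omega>) \<partial>M)" unfolding law_def by (rule integral_distr) auto
  also have "\<dots> = (\<integral>\<omega>. g 0 \<partial>M)"
    by (rule integral_cong_AE) (use X_zero in \<open>auto elim!: eventually_mono\<close>)
  finally show ?thesis by (simp add: prob_space)
qed

lemma cv_law_expectation:
  fixes f :: "'b \<Rightarrow> 'v::euclidean_space"
  assumes "s \<in> {0..}" "continuous_on UNIV f"
  shows "cv (law s) f x = (\<integral>\<omega>. f (x + X s \<omega>) \<partial>M)"
proof -
  have [measurable]: "f \<in> borel_measurable borel" by (rule borel_measurable_continuous_onI[OF assms(2)])
  show ?thesis unfolding cv_def law_def using X_measurable[OF assms(1)] by (intro integral_distr) auto
qed

lemma field_semigroup_eq: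
  fixes f :: "'b \<Rightarrow> 'v::euclidean_space"
  assumes s: "s \<in> {0..}" and f: "continuous_on UNIV f"
  shows "field_semigroup M X s f = cv (law s) f"
proof
  fix x
  have [measurable]: "f \<in> borel_measurable borel" by (rule borel_measurable_continuous_onI[OF f])
  note [measurable] = X_measurable[OF s]
  show "field_semigroup M X s f x = cv (law s) f x"
    unfolding field_semigroup_def cv_law_expectation[OF s f] by (rule integral_completion) measurable
qed

text \<open>Continuity in probability is used by splitting the expectation: off the event that
  \<open>X s\<close> and \<open>X t\<close> are more than \<open>d\<close> apart the Lipschitz bound
  applies, on the event the sup bound together with its small probability.\<close>

lemma cv_law_continuous:
  fixes f :: "'b \<Rightarrow> 'v::euclidean_space"
  assumes f: "bdlip C f"
  shows "continuous_on {0..} (\<lambda>s. cv (law s) f x)"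
  unfolding continuous_on_def
proof
  fix t :: "real ^ 'n" assume t: "t \<in> {0..}"
  have C: "0 \<le> C" by (rule bdlip_nonneg[OF f])
  have fc: "continuous_on UNIV f" by (rule bdlip_continuous[OF f])
  have [measurable]: "f \<in> borel_measurable borel" by (rule borel_measurable_continuous_onI[OF fc])
  note [measurable] = X_measurable[OF t]
  show "((\<lambda>s. cv (law s) f x) \<longlongrightarrow> cv (law t) f x) (at t within {0..})"
  proof (rule tendstoI)
    fix e :: real assume e: "0 < e"
    define d where "d = e / 2 / (C + 1)"
    have d: "0 < d" using e C by (simp add: d_def)
    have "C + 1 \<noteq> 0" using C by simp
    then have "(C + 1) * d = e / 2"
      unfolding d_def by (metis nonzero_mult_div_cancel_left times_divide_eq_right)
    moreover have "C * d \<le> (C + 1) * d" using d by (intro mult_right_mono) auto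
    ultimately have Cd: "C * d \<le> e / 2" by simp
    have "((\<lambda>s. 2 * C * prob {\<omega> \<in> space M. norm (X s \<omega> - X t \<omega>) > d}) \<longlongrightarrow> 2 * C * 0) (at t within {0..})"
      by (intro tendsto_intros X_stoch_cont t d)
    then have "\<forall>\<^sub>F s in at t within {0..}. 2 * C * prob {\<omega> \<in> space M. norm (X s \<omega> - X t \<omega>) > d} < e / 2"
      using e by (intro order_tendstoD(2)[where y="2 * C * 0"]) auto
    moreover have "\<forall>\<^sub>F s in at t within {0..}. s \<in> {0..}"
      by (simp add: eventually_at_filter)
    ultimately show "\<forall>\<^sub>F s in at t within {0..}. dist (cv (law s) f x) (cv (law t) f x) < e"
    proof eventually_elim
      case (elim s)
      note [measurable] = X_measurable[OF elim(2)]
      define E where "E = {\<omega> \<in> space M. norm (X s \<omega> - X t \<omega>) > d}"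
      have [measurable]: "E \<in> sets M" unfolding E_def by measurable
      have i: "integrable M (\<lambda>\<omega>. f (x + X s \<omega>))" "integrable M (\<lambda>\<omega>. f (x + X t \<omega>))"
        using f by (auto intro!: integrable_const_bound[where B=C] simp: bdlip_def)
      have "cv (law s) f x - cv (law t) f x = (\<integral>\<omega>. f (x + X s \<omega>) - f (x + X t \<omega>) \<partial>M)"
        unfolding cv_law_expectation[OF elim(2) fc] cv_law_expectation[OF t fc] using i by simp
      also have "norm \<dots> \<le> (\<integral>\<omega>. norm (f (x + X s \<omega>) - f (x + X t \<omega>)) \<partial>M)" by simp
      also have "\<dots> \<le> (\<integral>\<omega>. C * d + 2 * C * indicator E \<omega> \<partial>M)"
      proof (rule integral_mono)
        fix \<omega> assume \<omega>: "\<omega> \<in> space M"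
        have l: "norm (f (x + X s \<omega>) - f (x + X t \<omega>)) \<le> C * norm (X s \<omega> - X t \<omega>)"
          using f unfolding bdlip_def by (metis add_diff_cancel_left)
        have b: "norm (f (x + X s \<omega>) - f (x + X t \<omega>)) \<le> C + C"
          using f norm_triangle_ineq4 unfolding bdlip_def by (meson add_mono order_trans)
        have Cd0: "0 \<le> C * d" using C d by simp
        show "norm (f (x + X s \<omega>) - f (x + X t \<omega>)) \<le> C * d + 2 * C * indicator E \<omega>"
        proof (cases "d < norm (X s \<omega> - X t \<omega>)")
          case True
          then show ?thesis using b \<omega> Cd0 by (simp add: E_def)
        next
          case False
          then have "C * norm (X s \<omega> - X t \<omega>) \<le> C * d" using C by (intro mult_left_mono) auto
          then show ?thesis using l False by (simp add: E_def)
        qed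
      qed (use i integrable_const_indicator in auto)
      also have "\<dots> = C * d + 2 * C * prob E" by (rule expectation_const_indicator) fact
      finally show ?case using elim(1) Cd unfolding E_def[symmetric] by (simp add: dist_norm)
    qed
  qed
qed

text \<open>Continuity of \<open>g\<close> at 0 is asked only along the set \<open>S\<close> that
  carries the field. For a subordinator the integrand is cut off outside the orthant, and is
  continuous at 0 only from within the orthant.\<close>

lemma law_integral_tendsto:
  fixes g :: "'b \<Rightarrow> 'v::euclidean_space"
  assumes g [measurable]: "g \<in> borel_measurable borel" and K: "\<And>y. norm (g y) \<le> K"
    and S: "\<And>s. s \<in> {0..} \<Longrightarrow> AE \<omega> in M. X s \<omega> \<in> S"
    and c: "(g \<longlongrightarrow> g 0) (at 0 within S)"
  shows "((\<lambda>s. \<integral>y. g y \<partial>law s) \<longlongrightarrow> g 0) (at 0 within {0..})"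
proof (rule tendstoI)
  fix e :: real assume e: "0 < e"
  have K0: "0 \<le> K" using order_trans[OF norm_ge_zero K] .
  have z: "0 \<in> {0 :: real ^ 'n..}" by simp
  note [measurable] = X_measurable[OF z]
  have "\<forall>\<^sub>F y in at 0 within S. dist (g y) (g 0) < e / 2" using tendstoD[OF c, of "e / 2"] e by simp
  then obtain d where d: "0 < d" "\<And>y. y \<in> S \<Longrightarrow> y \<noteq> 0 \<Longrightarrow> norm y < d \<Longrightarrow> norm (g y - g 0) < e / 2"
    unfolding eventually_at by (auto simp: dist_norm)
  have "((\<lambda>s. 2 * K * prob {\<omega> \<in> space M. norm (X s \<omega> - X 0 \<omega>) > d / 2}) \<longlongrightarrow> 2 * K * 0) (at 0 within {0..})"
    using d(1) by (intro tendsto_intros X_stoch_cont z) simp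
  then have "\<forall>\<^sub>F s in at 0 within {0..}. 2 * K * prob {\<omega> \<in> space M. norm (X s \<omega> - X 0 \<omega>) > d / 2} < e / 2"
    using e by (intro order_tendstoD(2)[where y="2 * K * 0"]) auto
  moreover have "\<forall>\<^sub>F s in at 0 within {0..}. s \<in> {0 :: real ^ 'n..}"
    by (simp add: eventually_at_filter)
  ultimately show "\<forall>\<^sub>F s in at 0 within {0..}. dist (\<integral>y. g y \<partial>law s) (g 0) < e"
  proof eventually_elim
    case (elim s)
    note [measurable] = X_measurable[OF elim(2)]
    define E where "E = {\<omega> \<in> space M. norm (X s \<omega> - X 0 \<omega>) > d / 2}"
    have [measurable]: "E \<in> sets M" unfolding E_def by measurable
    have i: "integrable M (\<lambda>\<omega>. g (X s \<omega>))"
      using K by (auto intro!: integrable_const_bound[where B=K])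
    have "(\<integral>y. g y \<partial>law s) - g 0 = (\<integral>\<omega>. g (X s \<omega>) - g 0 \<partial>M)"
      unfolding law_def using i by (subst integral_distr) (auto simp: prob_space)
    also have "norm \<dots> \<le> (\<integral>\<omega>. norm (g (X s \<omega>) - g 0) \<partial>M)" by simp
    also have "\<dots> \<le> (\<integral>\<omega>. e / 2 + 2 * K * indicator E \<omega> \<partial>M)"
    proof (rule integral_mono_AE)
      show "AE \<omega> in M. norm (g (X s \<omega>) - g 0) \<le> e / 2 + 2 * K * indicator E \<omega>"
        using S[OF elim(2)] X_zero AE_space
      proof eventually_elim
        case (elim \<omega>)
        show ?case
        proof (cases "d / 2 < norm (X s \<omega>)")
          case True
          have "norm (g (X s \<omega>) - g 0) \<le> K + K"
            using K norm_triangle_ineq4 by (meson add_mono order_trans)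
          then show ?thesis using True elim e by (simp add: E_def)
        next
          case False
          then have "norm (X s \<omega>) < d" using d(1) by linarith
          then have "norm (g (X s \<omega>) - g 0) \<le> e / 2"
            using d(2)[OF elim(1)] e by (cases "X s \<omega> = 0") (auto intro: less_imp_le)
          then show ?thesis using K0 by (simp add: indicator_def)
        qed
      qed
    qed (use i integrable_const_indicator in auto)
    also have "\<dots> = e / 2 + 2 * K * prob E" by (rule expectation_const_indicator) fact
    finally show ?case using elim(1) unfolding E_def[symmetric] by (simp add: dist_norm)
  qed
qed

lemma cv_law_tendsto:
  fixes f :: "'b \<Rightarrow> 'v::euclidean_space"
  assumes f: "continuous_on UNIV f" and K: "\<And>y. norm (f y) \<le> K"
  shows "((\<lambda>s. cv (law s) f x) \<longlongrightarrow> f x) (at 0 within {0..})"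
proof -
  have [measurable]: "f \<in> borel_measurable borel" by (rule borel_measurable_continuous_onI[OF f])
  have "continuous_on UNIV (\<lambda>y. f (x + y))"
    by (rule continuous_on_compose2[OF f]) (auto intro!: continuous_intros)
  from continuous_on_def[THEN iffD1, rule_format, OF this, of 0]
  have "((\<lambda>y. f (x + y)) \<longlongrightarrow> f (x + 0)) (at 0)" by simp
  then show ?thesis
    unfolding cv_def using law_integral_tendsto[of "\<lambda>y. f (x + y)" K UNIV] K by simp
qed

lemma axis_tendsto_zero:
  "filterlim (axis j) (at 0 within {0..}) (at_right (0::real))"
  unfolding filterlim_at
proof (intro conjI)
  show "\<forall>\<^sub>F x in at_right (0::real). axis j x \<in> {0..} \<and> axis j x \<noteq> 0"
    using eventually_at_right_less[of "0::real"]
    by eventually_elim (auto simp: axis_eq_0_iff intro!: axis_orthant[unfolded atLeast_iff])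
  show "(axis j \<longlongrightarrow> 0) (at_right (0::real))"
  proof (rule vec_tendstoI)
    fix i
    have "((\<lambda>x. if i = j then x else 0) \<longlongrightarrow> 0) (at_right (0::real))"
      by (cases "i = j") auto
    then show "((\<lambda>x. axis j x $ i) \<longlongrightarrow> 0 $ i) (at_right (0::real))"
      by (simp add: axis_def)
  qed
qed

lemma axis_add: "axis j (s + t) = axis j s + axis j (t::real)"
  by (auto simp: axis_def vec_eq_iff)

lemma conv_semigroup_marginal: "conv_semigroup (\<lambda>t. law (axis j t))"
proof (rule conv_semigroup.intro)
  show "borel_prob (law (axis j t))" if "0 \<le> t" for t
    using that by (intro borel_prob_law axis_orthant)
  show "cv (law (axis j (s + t))) f x = cv (law (axis j s)) (cv (law (axis j t)) f) x"
    if st: "0 \<le> s" "0 \<le> t" and f: "bdlip C f" for s t C x and f :: "'b \<Rightarrow> real"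
    unfolding axis_add using f
    by (intro cv_law_add[where K=C] axis_orthant st bdlip_continuous[OF f]) (auto simp: bdlip_def)
  show "cv (law (axis j 0)) f x = f x" if f: "bdlip C f" for C x and f :: "'b \<Rightarrow> real"
  proof -
    have [measurable]: "f \<in> borel_measurable borel"
      by (rule bdlip_measurable[OF f])
    have z: "axis j 0 = (0 :: real ^ 'n)" by simp
    show ?thesis unfolding cv_def z using law_zero[of "\<lambda>y. f (x + y)"] by simp
  qed
next
  have "continuous_on UNIV (\<lambda>y::'b. min (norm y) 1)" by (rule bdlip_continuous[OF bdlip_min_norm])
  then have "((\<lambda>y::'b. min (norm y) 1) \<longlongrightarrow> min (norm (0::'b)) 1) (at 0)"
    unfolding continuous_on_def by blast
  from law_integral_tendsto[OF _ _ _ this, of 1]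
  have "((\<lambda>s. \<integral>y. min (norm y) 1 \<partial>law s) \<longlongrightarrow> 0) (at 0 within {0..})" by simp
  then show "((\<lambda>t. \<integral>z. min (norm z) 1 \<partial>law (axis j t)) \<longlongrightarrow> 0) (at_right 0)"
    by (rule filterlim_compose[OF _ axis_tendsto_zero])
qed

end

context levy
begin

lemma cv_law_zero:
  fixes f :: "'b \<Rightarrow> 'v::euclidean_space"
  assumes "continuous_on UNIV f"
  shows "cv (law 0) f x = f x"
proof -
  have [measurable]: "f \<in> borel_measurable borel" by (rule borel_measurable_continuous_onI[OF assms])
  show ?thesis unfolding cv_def using law_zero[of "\<lambda>y. f (x + y)"] by simp
qed

text \<open>The coordinates of \<open>s\<close> are switched on one at a time. The semigroup law
  factors the new operator as \<open>T_{r A s}\<close> after \<open>T_{axis j (s $ j)}\<close>, so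
  the new contribution is \<open>T_{r A s}\<close> applied to a function close to
  \<open>(s $ j) *\<^sub>R g j\<close>. Uniform convergence of the difference quotients makes this
  error harmless under \<open>T_{r A s}\<close>, and continuity of the semigroup replaces
  \<open>T_{r A s} (g j) x\<close> by \<open>g j x\<close>.\<close>

lemma semigroup_differentiable_at_0:
  fixes h :: "'b \<Rightarrow> 'v::euclidean_space"
  assumes h: "bdlip C h"
    and g: "\<And>j. is_generator_value (\<lambda>t. field_semigroup M X (axis j t)) h (g j)"
    and K: "\<And>j x. norm (g j x) \<le> K"
  shows "((\<lambda>s. (cv (law s) h x - h x - (\<Sum>j\<in>UNIV. (s $ j) *\<^sub>R g j x)) /\<^sub>R norm s) \<longlongrightarrow> 0) (at 0 within {0..})"
proof -
  define r where "r A s = (\<Sum>j\<in>A. axis j (s $ j))" for A and s :: "real ^ 'n"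
  have r_comp: "r A s $ i = (if i \<in> A then s $ i else 0)" for A s i
    by (simp add: r_def axis_def sum.If_cases finite_subset[OF subset_UNIV] if_distrib cong: if_cong)
  have r_orthant: "r A s \<in> {0..}" if "s \<in> {0..}" for A s
    using that by (auto simp: less_eq_vec_def r_comp)
  have r_UNIV: "r UNIV s = s" for s by (simp add: vec_eq_iff r_comp)
  have r_lim: "(r A \<longlongrightarrow> 0) (at 0 within {0..})" for A
  proof (rule vec_tendstoI)
    fix i
    have "((\<lambda>s::real ^ 'n. s $ i) \<longlongrightarrow> 0 $ i) (at 0 within {0..})" by (intro tendsto_intros)
    then show "((\<lambda>s. r A s $ i) \<longlongrightarrow> 0 $ i) (at 0 within {0..})"
      by (cases "i \<in> A") (simp_all add: r_comp)
  qed
  have hc: "continuous_on UNIV h" and hb: "\<And>y. norm (h y) \<le> C"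
    using bdlip_continuous[OF h] h by (auto simp: bdlip_def)
  have gc: "continuous_on UNIV (g j)" for j using g[of j] by (simp add: is_generator_value_def C0_def)
  have inS: "\<forall>\<^sub>F s in at 0 within {0..}. s \<in> {0 :: real ^ 'n..} \<and> s \<noteq> 0"
    by (simp add: eventually_at_filter)
  have step: "((\<lambda>s. (cv (law (r A s)) h x - h x - (\<Sum>j\<in>A. (s $ j) *\<^sub>R g j x)) /\<^sub>R norm s) \<longlongrightarrow> 0) (at 0 within {0..})"
    if "finite A" for A
    using that
  proof (induction A)
    case empty
    then show ?case by (simp add: r_def cv_law_zero[OF hc])
  next
    case (insert j A)
    let ?R = "\<lambda>s. cv (law (r A s))" and ?J = "\<lambda>s. cv (law (axis j (s $ j))) h"
    define E where "E s = (?R s (?J s) x - ?R s h x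
       - (s $ j) *\<^sub>R g j x) /\<^sub>R norm s" for s
    have "(E \<longlongrightarrow> 0) (at 0 within {0..})"
    proof (rule tendstoI)
      fix e :: real assume e: "0 < e"
      have "continuous (at 0 within {0..}) (\<lambda>s. cv (law s) (g j) x)"
        using cv_law_tendsto[OF gc K] cv_law_zero[OF gc] by (simp add: continuous_within)
      then have "((\<lambda>s. ?R s (g j) x) \<longlongrightarrow> cv (law 0) (g j) x) (at 0 within {0..})"
        by (rule continuous_within_tendsto_compose[OF _ _ r_lim])
          (use inS r_orthant in \<open>auto elim!: eventually_mono\<close>)
      then have e1: "\<forall>\<^sub>F s in at 0 within {0..}. dist (?R s (g j) x) (g j x) < e / 3"
        using e by (intro tendstoD) (simp_all add: cv_law_zero[OF gc])
      have "\<forall>\<^sub>F t in at_right 0. \<forall>y\<in>UNIV. dist ((field_semigroup M X (axis j t) h y - h y) /\<^sub>R t) (g j y) < e / 3"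
        using g[of j] e unfolding is_generator_value_def by (intro uniform_limitD) auto
      then obtain d where d: "0 < d"
        "\<And>t y. 0 < t \<Longrightarrow> t < d \<Longrightarrow> dist ((field_semigroup M X (axis j t) h y - h y) /\<^sub>R t) (g j y) < e / 3"
        unfolding eventually_at_right_field by auto
      have e2: "\<forall>\<^sub>F s in at 0 within {0 :: real ^ 'n..}. norm s < d"
        unfolding eventually_at using d(1) by (intro exI[of _ d]) (auto simp: dist_norm)
      show "\<forall>\<^sub>F s in at 0 within {0..}. dist (E s) 0 < e"
        using e1 e2 inS
      proof eventually_elim
        case (elim s)
        have s: "s \<in> {0..}" and n: "0 < norm s" using elim by auto
        have sj: "0 \<le> s $ j" "s $ j \<le> norm s"
          using s component_le_norm_cart[of s j] by (auto simp: less_eq_vec_def)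
        interpret R: borel_prob "law (r A s)" by (rule borel_prob_law[OF r_orthant[OF s]])
        interpret J: borel_prob "law (axis j (s $ j))" by (rule borel_prob_law[OF axis_orthant[OF sj(1)]])
        have bh: "bdlip C (?J s)" by (rule J.bdlip_cv[OF h])
        let ?D = "\<lambda>y. ?J s y - h y - (s $ j) *\<^sub>R g j y"
        have D: "norm (?D y) \<le> (s $ j) * (e / 3)" for y
        \<comment> \<open>The generator controls difference quotients at positive times only; for
          \<open>s $ j = 0\<close> the operator is the identity and the difference vanishes.\<close>
        proof (cases "s $ j = 0")
          case True
          have z: "axis j 0 = (0 :: real ^ 'n)" by simp
          show ?thesis unfolding True z cv_law_zero[OF hc] by simp
        next
          case False
          then have p: "0 < s $ j" "s $ j < d" using sj elim(2) by auto
          have "?D y = (s $ j) *\<^sub>R ((field_semigroup M X (axis j (s $ j)) h y - h y) /\<^sub>R (s $ j) - g j y)"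
            using p by (simp add: field_semigroup_eq[OF axis_orthant[OF sj(1)] hc] scaleR_diff_right)
          then have "norm (?D y) = (s $ j) * dist ((field_semigroup M X (axis j (s $ j)) h y - h y) /\<^sub>R (s $ j)) (g j y)"
            using p by (simp add: dist_norm)
          then show ?thesis using d(2)[OF p, of y] p by simp
        qed
        have gi: "integrable (law (r A s)) (\<lambda>y. g j (x + y))"
          using gc[of j] K[of j]
          by (intro R.bd_integrable[where C=K] continuous_on_compose2[OF gc]) (auto intro!: continuous_intros)
        have "?R s ?D x = ?R s (?J s) x - ?R s h x
           - (s $ j) *\<^sub>R ?R s (g j) x"
          unfolding cv_def[of "law (r A s)"] using R.bdlip_integrable(2)[OF bh] R.bdlip_integrable(2)[OF h] gi
          by simp
        then have "E s = (?R s ?D x + (s $ j) *\<^sub>R (?R s (g j) x - g j x)) /\<^sub>R norm s"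
          unfolding E_def by (simp add: scaleR_diff_right)
        also have "norm \<dots> \<le> ((s $ j) * (e / 3) + (s $ j) * (e / 3)) / norm s"
        proof -
          have "norm (?R s ?D x) \<le> (s $ j) * (e / 3)" by (rule R.cv_bound[OF D])
          moreover have "norm ((s $ j) *\<^sub>R (?R s (g j) x - g j x)) \<le> (s $ j) * (e / 3)"
            unfolding norm_scaleR using elim(1) sj by (intro mult_mono) (auto simp: dist_norm)
          ultimately have "norm (?R s ?D x + (s $ j) *\<^sub>R (?R s (g j) x - g j x))
             \<le> (s $ j) * (e / 3) + (s $ j) * (e / 3)" by (rule norm_triangle_mono)
          then show ?thesis
            unfolding norm_scaleR abs_inverse divide_inverse_commute using n by (intro mult_mono) auto
        qed
        also have "\<dots> = (s $ j / norm s) * (2 * (e / 3))" by (simp add: mult_ac)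
        also have "\<dots> \<le> 1 * (2 * (e / 3))" using sj n e by (intro mult_right_mono) auto
        also have "\<dots> < e" using e by simp
        finally show ?case by simp
      qed
    qed
    from tendsto_add[OF insert.IH this]
    have "((\<lambda>s. (?R s h x - h x - (\<Sum>j\<in>A. (s $ j) *\<^sub>R g j x)) /\<^sub>R norm s + E s) \<longlongrightarrow> 0) (at 0 within {0..})"
      by simp
    then show ?case
    proof (rule Lim_transform_eventually)
      show "\<forall>\<^sub>F s in at 0 within {0..}.
         (?R s h x - h x - (\<Sum>j\<in>A. (s $ j) *\<^sub>R g j x)) /\<^sub>R norm s + E s =
         (cv (law (r (insert j A) s)) h x - h x - (\<Sum>j\<in>insert j A. (s $ j) *\<^sub>R g j x)) /\<^sub>R norm s"
        using inS
      proof eventually_elim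
        case (elim s)
        then have s: "s \<in> {0..}" and sj: "0 \<le> s $ j" by (auto simp: less_eq_vec_def)
        have "r (insert j A) s = r A s + axis j (s $ j)"
          using insert.hyps by (simp add: r_def add.commute)
        then have "cv (law (r (insert j A) s)) h x = ?R s (?J s) x"
          using cv_law_add[OF r_orthant[OF s] axis_orthant[OF sj] hc hb] by simp
        then show ?case unfolding E_def using insert.hyps
          by (simp only: scaleR_add_right[symmetric] sum.insert) (simp add: algebra_simps)
      qed
    qed
  qed
  show ?thesis using step[of UNIV] by (simp add: r_UNIV)
qed

end

section \<open>Subordination\<close>

lemma measurable_completion_AE:
  fixes f g :: "'a \<Rightarrow> 'b::topological_space"
  assumes g: "g \<in> borel_measurable M" and eq: "AE \<omega> in M. f \<omega> = g \<omega>"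
  shows "f \<in> borel_measurable (completion M)"
proof (rule measurableI)
  fix A :: "'b set" assume A: "A \<in> sets borel"
  have sets: "g -` A \<inter> space M \<in> sets (completion M)"
    using measurable_sets[OF g A] by auto
  have ae: "AE \<omega> in completion M. \<omega> \<in> g -` A \<inter> space M \<longleftrightarrow> \<omega> \<in> f -` A \<inter> space M"
    using AE_completion[OF eq] by eventually_elim auto
  show "f -` A \<inter> space (completion M) \<in> sets (completion M)"
    using completion.in_sets_AE[OF ae sets] by simp
qed simp

lemma (in prob_space) expectation_indicator_scaleR:
  fixes v :: "'v::euclidean_space"
  assumes E: "E \<in> sets M"
  shows "expectation (\<lambda>\<omega>. indicator E \<omega> *\<^sub>R v) = prob E *\<^sub>R v"
proof -
  have "integrable M (indicator E :: 'a \<Rightarrow> real)"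
    using integrable_const_indicator[OF E, of 0 1] by simp
  then show ?thesis
    using sets.sets_into_space[OF E] by (subst integral_scaleR_left) (auto simp: Int_absorb2)
qed

text \<open>Conditioning on a random index with countably many values: on the event
  \<open>N = z\<close> the integrand is \<open>F z\<close>, and the hypothesis \<open>eq\<close> is
  what independence of \<open>N\<close> and \<open>F z\<close> provides.\<close>

lemma (in prob_space) expectation_countable_mixture:
  fixes N :: "'a \<Rightarrow> 'i::countable" and F :: "'i \<Rightarrow> 'a \<Rightarrow> 'v::euclidean_space"
  assumes N [measurable]: "N \<in> measurable M (count_space UNIV)"
    and F [measurable]: "\<And>z. F z \<in> borel_measurable M"
    and FC: "\<And>z \<omega>. norm (F z \<omega>) \<le> C" and cC: "\<And>z. norm (c z) \<le> C"
    and eq: "\<And>z. (\<integral>\<omega>. indicator (N -` {z} \<inter> space M) \<omega> *\<^sub>R F z \<omega> \<partial>M) = prob (N -` {z} \<inter> space M) *\<^sub>R c z"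
  shows "expectation (\<lambda>\<omega>. F (N \<omega>) \<omega>) = expectation (\<lambda>\<omega>. c (N \<omega>))"
proof -
  define A where "A i = {\<omega> \<in> space M. to_nat (N \<omega>) = i}" for i
  have A [measurable]: "A i \<in> sets M" for i unfolding A_def by measurable
  have disj: "i \<noteq> j \<Longrightarrow> A i \<inter> A j = {}" for i j by (auto simp: A_def)
  have un: "(\<Union>i. A i) = space M" by (auto simp: A_def)
  have m1 [measurable]: "(\<lambda>\<omega>. F (N \<omega>) \<omega>) \<in> borel_measurable M"
    by (rule measurable_compose_countable[OF F N])
  have m2 [measurable]: "(\<lambda>\<omega>. c (N \<omega>)) \<in> borel_measurable M" by measurable
  have int: "set_integrable M (\<Union>i. A i) G"
    if "G \<in> borel_measurable M" "\<And>\<omega>. norm (G \<omega>) \<le> C" for G :: "'a \<Rightarrow> 'v"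
    unfolding un set_integrable_def using that
    by (intro integrable_mult_indicator integrable_const_bound[where B=C]) auto
  have whole: "expectation G = (LINT \<omega>:(\<Union>i. A i)|M. G \<omega>)" for G :: "'a \<Rightarrow> 'v"
    unfolding un set_lebesgue_integral_def by (intro Bochner_Integration.integral_cong) auto
  have "(LINT \<omega>:A i|M. F (N \<omega>) \<omega>) = (LINT \<omega>:A i|M. c (N \<omega>))" for i
  proof (cases "i \<in> range (to_nat :: 'i \<Rightarrow> nat)")
    case True
    then obtain z :: 'i where z: "i = to_nat z" by auto
    have Ai: "A i = N -` {z} \<inter> space M" unfolding A_def z by auto
    have "(LINT \<omega>:A i|M. F (N \<omega>) \<omega>) = (\<integral>\<omega>. indicator (A i) \<omega> *\<^sub>R F z \<omega> \<partial>M)"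
      unfolding set_lebesgue_integral_def Ai
      by (intro Bochner_Integration.integral_cong) (auto simp: indicator_def)
    also have "\<dots> = prob (A i) *\<^sub>R c z" unfolding Ai by (rule eq)
    also have "\<dots> = (\<integral>\<omega>. indicator (A i) \<omega> *\<^sub>R c z \<partial>M)"
      by (rule expectation_indicator_scaleR[OF A, symmetric])
    also have "\<dots> = (LINT \<omega>:A i|M. c (N \<omega>))"
      unfolding set_lebesgue_integral_def Ai
      by (intro Bochner_Integration.integral_cong) (auto simp: indicator_def)
    finally show ?thesis .
  next
    \<comment> \<open>Numbers that do not encode any value of the index type contribute an empty
      event.\<close>
    case False
    then have "A i = {}" by (auto simp: A_def)
    then show ?thesis by (simp add: set_lebesgue_integral_def)
  qed
  moreover have "expectation (\<lambda>\<omega>. F (N \<omega>) \<omega>) = (\<Sum>i. LINT \<omega>:A i|M. F (N \<omega>) \<omega>)"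
    unfolding whole by (rule lebesgue_integral_countable_add[OF A disj int[OF m1 FC]])
  moreover have "expectation (\<lambda>\<omega>. c (N \<omega>)) = (\<Sum>i. LINT \<omega>:A i|M. c (N \<omega>))"
    unfolding whole by (rule lebesgue_integral_countable_add[OF A disj int[OF m2 cC]])
  ultimately show ?thesis by (simp only:)
qed

text \<open>The summand 1 selects the upper corner of the dyadic cube, so that points are
  approximated from above, as right continuity demands. The integer index has a countable
  type.\<close>

definition grid :: "nat \<Rightarrow> int ^ 'n \<Rightarrow> real ^ 'n" where
  "grid n z = (\<chi> i. (of_int (z $ i) + 1) / 2 ^ n)"

definition grid_index :: "nat \<Rightarrow> real ^ 'n \<Rightarrow> int ^ 'n" where
  "grid_index n y = (\<chi> i. \<lfloor>2 ^ n * y $ i\<rfloor>)"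

lemma grid_index_orthant:
  assumes "y \<in> {0..}"
  shows "grid n (grid_index n y) \<in> {0..}"
proof -
  have "0 \<le> (of_int \<lfloor>2 ^ n * y $ i\<rfloor> + 1) / (2 ^ n :: real)" for i
  proof (rule divide_nonneg_nonneg)
    have "0 \<le> \<lfloor>2 ^ n * y $ i\<rfloor>" using assms by (simp add: less_eq_vec_def)
    then have "0 \<le> real_of_int \<lfloor>2 ^ n * y $ i\<rfloor>" by (simp only: of_int_0_le_iff)
    then show "0 \<le> real_of_int \<lfloor>2 ^ n * y $ i\<rfloor> + 1" by (rule add_nonneg_nonneg) simp
  qed simp
  then show ?thesis
    by (simp only: grid_def grid_index_def less_eq_vec_def atLeast_iff vec_lambda_beta zero_index) simp
qed

lemma grid_decseq: "decseq (\<lambda>n. grid n (grid_index n y))"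
proof (rule decseq_SucI)
  fix n
  have "(of_int \<lfloor>2 ^ Suc n * a\<rfloor> + 1) / 2 ^ Suc n \<le> (of_int \<lfloor>2 ^ n * a\<rfloor> + 1) / (2 ^ n :: real)" for a :: real
  proof -
    \<comment> \<open>With the summand 1 of \<open>grid\<close> this says that halving a cube never
      raises its upper corner.\<close>
    have "\<lfloor>2 * (2 ^ n * a)\<rfloor> \<le> 2 * \<lfloor>2 ^ n * a\<rfloor> + 1" by linarith
    then have "\<lfloor>2 ^ Suc n * a\<rfloor> \<le> 2 * \<lfloor>2 ^ n * a\<rfloor> + 1" by (simp add: mult.assoc)
    then have "real_of_int \<lfloor>2 ^ Suc n * a\<rfloor> \<le> of_int (2 * \<lfloor>2 ^ n * a\<rfloor> + 1)" by (simp only: of_int_le_iff)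
    then have "of_int \<lfloor>2 ^ Suc n * a\<rfloor> + 1 \<le> 2 * (of_int \<lfloor>2 ^ n * a\<rfloor> + (1::real))" by simp
    then have "(of_int \<lfloor>2 ^ Suc n * a\<rfloor> + 1) / 2 ^ Suc n \<le> 2 * (of_int \<lfloor>2 ^ n * a\<rfloor> + (1::real)) / 2 ^ Suc n"
      by (intro divide_right_mono) auto
    also have "\<dots> = (of_int \<lfloor>2 ^ n * a\<rfloor> + 1) / 2 ^ n"
      unfolding power_Suc by (rule mult_divide_mult_cancel_left) simp
    finally show ?thesis .
  qed
  then show "grid (Suc n) (grid_index (Suc n) y) \<le> grid n (grid_index n y)"
    by (simp only: less_eq_vec_def grid_def grid_index_def vec_lambda_beta) simp
qed

lemma grid_tendsto: "(\<lambda>n. grid n (grid_index n y)) \<longlonglongrightarrow> y"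
proof (rule vec_tendstoI)
  fix i
  have "(\<lambda>n. (1/2) ^ n) \<longlonglongrightarrow> (0::real)" by (intro LIMSEQ_power_zero) simp
  then have "(\<lambda>n. grid n (grid_index n y) $ i - y $ i) \<longlonglongrightarrow> 0"
  proof (rule Lim_null_comparison[rotated], intro always_eventually allI)
    fix n
    have "\<bar>(of_int \<lfloor>2 ^ n * y $ i\<rfloor> + 1) - 2 ^ n * y $ i\<bar> \<le> (1::real)" by linarith
    then have "\<bar>(of_int \<lfloor>2 ^ n * y $ i\<rfloor> + 1) - 2 ^ n * y $ i\<bar> / 2 ^ n \<le> 1 / 2 ^ n"
      by (intro divide_right_mono) auto
    moreover have "grid n (grid_index n y) $ i - y $ i = ((of_int \<lfloor>2 ^ n * y $ i\<rfloor> + 1) - 2 ^ n * y $ i) / 2 ^ n"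
      by (simp add: grid_def grid_index_def diff_divide_distrib)
    ultimately show "norm (grid n (grid_index n y) $ i - y $ i) \<le> (1/2) ^ n"
      by (simp add: power_one_over)
  qed
  then show "(\<lambda>n. grid n (grid_index n y) $ i) \<longlonglongrightarrow> y $ i" by (rule LIM_zero_cancel)
qed

lemma grid_index_measurable [measurable]:
  "(grid_index n :: real ^ 'n \<Rightarrow> _) \<in> measurable borel (count_space UNIV)"
  unfolding measurable_count_space_eq2_countable
proof (intro conjI ballI)
  fix z :: "int ^ 'n"
  have c [measurable]: "(\<lambda>y::real ^ 'n. y $ i) \<in> borel_measurable borel" for i
    by (intro borel_measurable_continuous_onI continuous_intros)
  have "{y \<in> space borel. \<forall>i\<in>UNIV. \<lfloor>2 ^ n * (y::real ^ 'n) $ i\<rfloor> = z $ i} \<in> sets borel"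
    by (rule sets.sets_Collect_finite_All) auto
  moreover have "grid_index n -` {z} \<inter> space borel = {y \<in> space borel. \<forall>i\<in>UNIV. \<lfloor>2 ^ n * (y::real ^ 'n) $ i\<rfloor> = z $ i}"
    by (auto simp: grid_index_def vec_eq_iff)
  ultimately show "grid_index n -` {z} \<inter> space borel \<in> sets (borel :: (real ^ 'n) measure)" by simp
qed simp

locale subordination = X: levy M X + H: levy M H
  for M :: "'a measure" and X :: "real ^ 'n \<Rightarrow> 'a \<Rightarrow> 'b::euclidean_space" and H :: "real ^ 'm \<Rightarrow> 'a \<Rightarrow> real ^ 'n" +
  assumes H_orthant: "t \<in> {0..} \<Longrightarrow> AE \<omega> in M. H t \<omega> \<in> {0..}"
    and indep: "indep_fields M X H"
begin

text \<open>An event about the field at a single time is the preimage of a one-coordinate cylinder,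
  hence belongs to the sigma-algebra generated by the field.\<close>

lemma X_H_indep:
  assumes v: "v \<in> {0..}" and t: "t \<in> {0..}" and A: "A \<in> sets borel" and B: "B \<in> sets borel"
  shows "X.prob ((X v -` A \<inter> space M) \<inter> (H t -` B \<inter> space M))
    = X.prob (X v -` A \<inter> space M) * X.prob (H t -` B \<inter> space M)"
proof -
  have ev: "Y u -` E \<inter> space M \<in> sets (vimage_algebra (space M) (\<lambda>\<omega>. \<lambda>s\<in>{0..}. Y s \<omega>) (PiM {0..} (\<lambda>_. borel)))"
    if u: "u \<in> {0..}" and E: "E \<in> sets borel" for Y :: "real ^ 'k \<Rightarrow> 'a \<Rightarrow> 'c::euclidean_space" and u E
  proof -
    have "(\<lambda>f. f u) -` E \<inter> space (PiM {0..} (\<lambda>_. borel)) \<in> sets (PiM {0..} (\<lambda>_. borel :: 'c measure))"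
      by (rule measurable_sets[OF measurable_component_singleton[OF u] E])
    from in_vimage_algebra[OF this]
    have "(\<lambda>\<omega>. \<lambda>s\<in>{0..}. Y s \<omega>) -` ((\<lambda>f. f u) -` E \<inter> space (PiM {0..} (\<lambda>_. borel))) \<inter> space M
       \<in> sets (vimage_algebra (space M) (\<lambda>\<omega>. \<lambda>s\<in>{0..}. Y s \<omega>) (PiM {0..} (\<lambda>_. borel)))" .
    also have "(\<lambda>\<omega>. \<lambda>s\<in>{0..}. Y s \<omega>) -` ((\<lambda>f. f u) -` E \<inter> space (PiM {0..} (\<lambda>_. borel))) \<inter> space M
       = Y u -` E \<inter> space M"
      using u by (auto simp: space_PiM)
    finally show ?thesis .
  qed
  show ?thesis
    using indep ev[OF v A, of X] ev[OF t B, of H] unfolding indep_fields_def by (rule X.indep_setD)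
qed

text \<open>At a deterministic time \<open>v\<close> the pair of \<open>X v\<close> and
  \<open>H t\<close> has a product law; this provides the condition \<open>eq\<close> of
  \<open>expectation_countable_mixture\<close>.\<close>

lemma independent_product:
  fixes f :: "'b \<Rightarrow> 'v::euclidean_space"
  assumes v: "v \<in> {0..}" and t: "t \<in> {0..}" and B [measurable]: "B \<in> sets borel" and f: "bdlip C f"
  shows "(\<integral>\<omega>. indicator (H t -` B \<inter> space M) \<omega> *\<^sub>R f (x + X v \<omega>) \<partial>M)
    = X.prob (H t -` B \<inter> space M) *\<^sub>R cv (X.law v) f x"
proof -
  note [measurable] = X.X_measurable[OF v] H.X_measurable[OF t]
  have [measurable]: "f \<in> borel_measurable borel"
    by (rule bdlip_measurable[OF f])
  interpret V: borel_prob "X.law v" by (rule X.borel_prob_law[OF v])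
  interpret T: borel_prob "H.law t" by (rule H.borel_prob_law[OF t])
  interpret pair_prob_space "X.law v" "H.law t" ..
  have joint: "X.law v \<Otimes>\<^sub>M H.law t = distr M (borel \<Otimes>\<^sub>M borel) (\<lambda>\<omega>. (X v \<omega>, H t \<omega>))"
    unfolding X.law_def H.law_def by (rule X.joint_distr_eq_pair) (auto intro: X_H_indep[OF v t])
  have m: "(\<lambda>(a, b). indicator B b *\<^sub>R f (x + a)) \<in> borel_measurable (borel \<Otimes>\<^sub>M borel)" by measurable
  have fC: "norm (f y) \<le> C" for y using f by (simp add: bdlip_def)
  have i: "integrable (X.law v \<Otimes>\<^sub>M H.law t) (\<lambda>(a, b). indicator B b *\<^sub>R f (x + a))"
  proof (rule P.integrable_const_bound[where B=C])
    show "AE p in X.law v \<Otimes>\<^sub>M H.law t. norm (case p of (a, b) \<Rightarrow> indicator B b *\<^sub>R f (x + a)) \<le> C"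
      using fC bdlip_nonneg[OF f] by (intro AE_I2) (auto simp: indicator_def)
  qed (use m in \<open>simp cong: measurable_cong_sets sets_pair_measure_cong\<close>)
  have "(\<integral>\<omega>. indicator (H t -` B \<inter> space M) \<omega> *\<^sub>R f (x + X v \<omega>) \<partial>M)
     = (\<integral>\<omega>. (case (X v \<omega>, H t \<omega>) of (a, b) \<Rightarrow> indicator B b *\<^sub>R f (x + a)) \<partial>M)"
    by (intro Bochner_Integration.integral_cong) (auto simp: indicator_def)
  also have "\<dots> = (\<integral>p. (case p of (a, b) \<Rightarrow> indicator B b *\<^sub>R f (x + a)) \<partial>(X.law v \<Otimes>\<^sub>M H.law t))"
    unfolding joint by (rule integral_distr[symmetric, OF _ m]) measurable
  also have "\<dots> = (\<integral>a. (\<integral>b. indicator B b *\<^sub>R f (x + a) \<partial>H.law t) \<partial>X.law v)"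
    using integral_fst'[OF i] by simp
  also have "\<dots> = (\<integral>a. T.prob B *\<^sub>R f (x + a) \<partial>X.law v)"
    by (simp add: T.expectation_indicator_scaleR)
  also have "\<dots> = T.prob B *\<^sub>R cv (X.law v) f x" by (simp add: cv_def)
  also have "T.prob B = X.prob (H t -` B \<inter> space M)"
    unfolding H.law_def by (rule measure_distr) auto
  finally show ?thesis .
qed

text \<open>The random time is approximated from above by times with countably many values.\<close>

lemma subordinated_expectation:
  fixes f :: "'b \<Rightarrow> 'v::euclidean_space"
  assumes t: "t \<in> {0..}" and f: "bdlip C f"
  shows "subordinated_field X H t \<in> borel_measurable (completion M)" (is ?meas)
    and "field_semigroup M (subordinated_field X H) t f x = (LINT s:{0..}|H.law t. cv (X.law s) f x)" (is ?formula)
proof -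
  let ?Z = "subordinated_field X H t"
  note [measurable] = H.X_measurable[OF t]
  have fc: "continuous_on UNIV f" by (rule bdlip_continuous[OF f])
  have fC: "norm (f y) \<le> C" for y using f by (simp add: bdlip_def)
  have [measurable]: "f \<in> borel_measurable borel" by (rule borel_measurable_continuous_onI[OF fc])
  define N where "N n \<omega> = grid_index n (H t \<omega>)" for n \<omega>
  have N [measurable]: "N n \<in> measurable M (count_space UNIV)" for n unfolding N_def[abs_def] by measurable
  \<comment> \<open>Measurability of \<open>X\<close> is known in the orthant only, so grid points
    outside it get the value 0; \<open>c\<close> uses the matching default
    \<open>f x\<close>.\<close>
  define Y where "Y n z \<omega> = (if grid n z \<in> {0..} then X (grid n z) \<omega> else 0)" for n z \<omega>
  have Y [measurable]: "Y n z \<in> borel_measurable M" for n z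
    unfolding Y_def[abs_def] by (cases "grid n z \<in> {0..}") (auto intro: X.X_measurable)
  define c where "c n z = (if grid n z \<in> {0..} then cv (X.law (grid n z)) f x else f x)" for n z
  define W where "W n \<omega> = Y n (N n \<omega>) \<omega>" for n \<omega>
  have W [measurable]: "W n \<in> borel_measurable M" for n
    unfolding W_def[abs_def] by (rule measurable_compose_countable[OF Y N])
  have cC: "norm (c n z) \<le> C" for n z
  proof (cases "grid n z \<in> {0..}")
    case True
    then show ?thesis using borel_prob.cv_bound[OF X.borel_prob_law[OF True] fC] by (simp add: c_def)
  qed (use fC in \<open>simp add: c_def\<close>)
  have mix: "(\<integral>\<omega>. f (x + W n \<omega>) \<partial>M) = (\<integral>\<omega>. c n (N n \<omega>) \<partial>M)" for n
    unfolding W_def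
  proof (rule X.expectation_countable_mixture[where C=C and F="\<lambda>z \<omega>. f (x + Y n z \<omega>)"])
    fix z
    have Nz: "N n -` {z} \<inter> space M = H t -` (grid_index n -` {z}) \<inter> space M" by (auto simp: N_def)
    have B: "grid_index n -` {z} \<in> sets (borel :: (real ^ 'n) measure)"
      using measurable_sets[OF grid_index_measurable[of n], of "{z}"] by simp
    show "(\<integral>\<omega>. indicator (N n -` {z} \<inter> space M) \<omega> *\<^sub>R f (x + Y n z \<omega>) \<partial>M)
       = X.prob (N n -` {z} \<inter> space M) *\<^sub>R c n z"
    proof (cases "grid n z \<in> {0..}")
      case True
      then show ?thesis unfolding Nz using independent_product[OF True t B f] by (simp add: Y_def c_def)
    next
      case False
      have "N n -` {z} \<inter> space M \<in> sets M" by (rule measurable_sets[OF N]) simp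
      then show ?thesis using False by (simp add: Y_def c_def X.expectation_indicator_scaleR)
    qed
  qed (use fC cC in \<open>simp_all, measurable\<close>)
  have H0: "AE \<omega> in M. H t \<omega> \<in> {0..}" by (rule H_orthant[OF t])
  have cad: "AE \<omega> in M. cadlag (\<lambda>t. X t \<omega>)" using X.levy unfolding levy_field_def by blast
  have lim: "AE \<omega> in M. (\<lambda>n. W n \<omega>) \<longlonglongrightarrow> ?Z \<omega>"
    using H0 cad
  proof eventually_elim
    case (elim \<omega>)
    let ?s = "\<lambda>n. grid n (grid_index n (H t \<omega>))"
    \<comment> \<open>Right continuity of the path is available at every time of the orthant
      simultaneously, hence also at the random time \<open>H t \<omega>\<close>.\<close>
    have "right_continuous_at (\<lambda>t. X t \<omega>) (H t \<omega>)" using elim by (simp add: cadlag_def)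
    then have rc: "(\<forall>n. ?s n \<in> {0..}) \<and> decseq ?s \<and> ?s \<longlonglongrightarrow> H t \<omega> \<longrightarrow>
        (\<lambda>n. X (?s n) \<omega>) \<longlonglongrightarrow> X (H t \<omega>) \<omega>"
      unfolding right_continuous_at_def by (rule spec)
    have "(\<lambda>n. X (?s n) \<omega>) \<longlonglongrightarrow> X (H t \<omega>) \<omega>"
      by (rule mp[OF rc]) (intro conjI allI grid_index_orthant[OF elim(1)] grid_decseq grid_tendsto)
    moreover have "W n \<omega> = X (?s n) \<omega>" for n
      using grid_index_orthant[OF elim(1)] by (simp add: W_def Y_def N_def)
    ultimately show ?case by (simp add: subordinated_field_def)
  qed
  \<comment> \<open>A version of the subordinated variable that is measurable for \<open>M\<close>
    itself. The two agree almost surely, which makes the subordinated variable measurable for the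
    completion and transfers its expectations to \<open>M\<close>.\<close>
  define L where "L \<omega> = lim (\<lambda>n. W n \<omega>)" for \<omega>
  have L [measurable]: "L \<in> borel_measurable M" unfolding L_def[abs_def] by measurable
  have ZL: "AE \<omega> in M. ?Z \<omega> = L \<omega>" using lim by eventually_elim (simp add: L_def limI)
  show meas: ?meas by (rule measurable_completion_AE[OF L ZL])
  have "field_semigroup M (subordinated_field X H) t f x = (\<integral>\<omega>. f (x + L \<omega>) \<partial>completion M)"
    unfolding field_semigroup_def
  proof (rule integral_cong_AE)
    show "(\<lambda>\<omega>. f (x + ?Z \<omega>)) \<in> borel_measurable (completion M)" using meas by measurable
    show "(\<lambda>\<omega>. f (x + L \<omega>)) \<in> borel_measurable (completion M)"
      by (rule measurable_completion) measurable
    show "AE \<omega> in completion M. f (x + ?Z \<omega>) = f (x + L \<omega>)"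
      using AE_completion[OF ZL] by eventually_elim simp
  qed
  also have "\<dots> = (\<integral>\<omega>. f (x + L \<omega>) \<partial>M)" by (rule integral_completion) measurable
  finally have lhs: "field_semigroup M (subordinated_field X H) t f x = (\<integral>\<omega>. f (x + L \<omega>) \<partial>M)" .
  have l1: "(\<lambda>n. \<integral>\<omega>. f (x + W n \<omega>) \<partial>M) \<longlonglongrightarrow> (\<integral>\<omega>. f (x + L \<omega>) \<partial>M)"
  proof (rule integral_dominated_convergence[where w="\<lambda>_. C"])
    show "AE \<omega> in M. (\<lambda>n. f (x + W n \<omega>)) \<longlonglongrightarrow> f (x + L \<omega>)"
      using lim ZL
    proof eventually_elim
      case (elim \<omega>)
      have "(\<lambda>n. x + W n \<omega>) \<longlonglongrightarrow> x + L \<omega>" using elim by (intro tendsto_intros) simp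
      then show ?case by (rule continuous_on_tendsto_compose[OF fc]) auto
    qed
  qed (use fC in auto)
  define \<Phi> where "\<Phi> s = indicator {0..} s *\<^sub>R cv (X.law s) f x" for s
  have \<Phi> [measurable]: "\<Phi> \<in> borel_measurable borel"
    unfolding \<Phi>_def[abs_def] by (rule borel_measurable_continuous_on_indicator[OF _ X.cv_law_continuous[OF f]]) simp
  have l2: "(\<lambda>n. \<integral>\<omega>. c n (N n \<omega>) \<partial>M) \<longlonglongrightarrow> (\<integral>\<omega>. \<Phi> (H t \<omega>) \<partial>M)"
  proof (rule integral_dominated_convergence[where w="\<lambda>_. C"])
    show "AE \<omega> in M. (\<lambda>n. c n (N n \<omega>)) \<longlonglongrightarrow> \<Phi> (H t \<omega>)"
      using H0
    proof eventually_elim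
      case (elim \<omega>)
      have "(\<lambda>n. cv (X.law (grid n (N n \<omega>))) f x) \<longlonglongrightarrow> cv (X.law (H t \<omega>)) f x"
        unfolding N_def
        by (rule continuous_on_tendsto_compose[OF X.cv_law_continuous[OF f] grid_tendsto elim])
          (use grid_index_orthant[OF elim] in auto)
      then show ?case using elim grid_index_orthant[OF elim] by (simp add: c_def N_def \<Phi>_def)
    qed
  qed (use cC in auto)
  have "(\<integral>\<omega>. f (x + L \<omega>) \<partial>M) = (\<integral>\<omega>. \<Phi> (H t \<omega>) \<partial>M)"
    using l1 l2 unfolding mix by (rule LIMSEQ_unique)
  also have "\<dots> = (\<integral>s. \<Phi> s \<partial>H.law t)" unfolding H.law_def by (rule integral_distr[symmetric]) auto
  finally show ?formula unfolding lhs by (simp add: \<Phi>_def set_lebesgue_integral_def)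
qed

end

section \<open>The subordinated laws as a convolution semigroup\<close>

context subordination
begin

definition sub_law :: "real ^ 'm \<Rightarrow> 'b measure" where
  "sub_law t = distr (completion M) borel (subordinated_field X H t)"

lemma borel_prob_sub_law:
  assumes "t \<in> {0..}"
  shows "borel_prob (sub_law t)"
proof -
  have [measurable]: "subordinated_field X H t \<in> borel_measurable (completion M)"
    by (rule subordinated_expectation(1)[OF assms bdlip_min_norm])
  have "prob_space (completion M)"
    by (rule prob_spaceI) (simp add: X.emeasure_space_1)
  then show ?thesis
    unfolding sub_law_def by (intro borel_prob.intro borel_prob_axioms.intro prob_space.prob_space_distr) auto
qed

lemma field_semigroup_sub_law:
  fixes f :: "'b \<Rightarrow> 'v::euclidean_space"
  assumes "t \<in> {0..}" "bdlip C f"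
  shows "field_semigroup M (subordinated_field X H) t f = cv (sub_law t) f"
proof
  fix x
  have [measurable]: "subordinated_field X H t \<in> borel_measurable (completion M)"
    by (rule subordinated_expectation(1)[OF assms])
  have [measurable]: "f \<in> borel_measurable borel"
    by (rule bdlip_measurable[OF assms(2)])
  show "field_semigroup M (subordinated_field X H) t f x = cv (sub_law t) f x"
    unfolding field_semigroup_def cv_def sub_law_def by (rule integral_distr[symmetric]) auto
qed

lemma cv_sub_law:
  fixes f :: "'b \<Rightarrow> 'v::euclidean_space"
  assumes "t \<in> {0..}" "bdlip C f"
  shows "cv (sub_law t) f x = (\<integral>s. indicator {0..} s *\<^sub>R cv (X.law s) f x \<partial>H.law t)"
  using subordinated_expectation(2)[OF assms, of x]
  unfolding field_semigroup_sub_law[OF assms] set_lebesgue_integral_def .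

lemma restricted_cv_measurable:
  fixes f :: "'b \<Rightarrow> 'v::euclidean_space"
  assumes "bdlip C f"
  shows "(\<lambda>s. indicator {0..} s *\<^sub>R cv (X.law s) f x) \<in> borel_measurable borel"
  by (rule borel_measurable_continuous_on_indicator[OF _ X.cv_law_continuous[OF assms]]) simp

lemma restricted_cv_bound:
  fixes f :: "'b \<Rightarrow> 'v::euclidean_space"
  assumes f: "bdlip C f"
  shows "norm (indicator {0..} s *\<^sub>R cv (X.law s) f x) \<le> C"
proof (cases "s \<in> {0..}")
  case True
  then show ?thesis
    using borel_prob.cv_bound[OF X.borel_prob_law[OF True], of f C x] f by (simp add: bdlip_def)
qed (use bdlip_nonneg[OF f] in simp)

text \<open>Continuity in the time \<open>v\<close>, together with a Lipschitz estimate in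
  \<open>y\<close> that is uniform in \<open>v\<close>, gives joint continuity on a closed set. The
  measurability is required for the Fubini step in \<open>cv_sub_law_add\<close>.\<close>

lemma restricted_cv_joint_measurable:
  fixes f :: "'b \<Rightarrow> 'v::euclidean_space"
  assumes f: "bdlip C f"
  shows "(\<lambda>(y, v). indicator {0..} v *\<^sub>R cv (X.law v) f (x + y)) \<in> borel_measurable (borel \<Otimes>\<^sub>M borel)"
proof -
  let ?S = "(UNIV :: 'b set) \<times> {0 :: real ^ 'n..}"
  let ?G = "\<lambda>p. cv (X.law (snd p)) f (x + fst p)"
  have "continuous_on ?S ?G"
    unfolding continuous_on_def
  proof
    fix p assume p: "p \<in> ?S"
    have "continuous_on ?S (\<lambda>q. cv (X.law (snd q)) f (x + fst p))"
      by (rule continuous_on_compose2[OF X.cv_law_continuous[OF f]]) (auto intro!: continuous_intros)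
    then have l: "((\<lambda>q. cv (X.law (snd q)) f (x + fst p)) \<longlongrightarrow> ?G p) (at p within ?S)"
      using p unfolding continuous_on_def by blast
    have "((\<lambda>q. ?G q - cv (X.law (snd q)) f (x + fst p)) \<longlongrightarrow> 0) (at p within ?S)"
    proof (rule Lim_null_comparison)
      show "\<forall>\<^sub>F q in at p within ?S. norm (?G q - cv (X.law (snd q)) f (x + fst p)) \<le> C * norm (fst q - fst p)"
        unfolding eventually_at_filter
      proof (intro always_eventually allI impI)
        fix q assume "q \<in> ?S"
        then have "snd q \<in> {0..}" by auto
        from borel_prob.bdlip_cv[OF X.borel_prob_law[OF this] f]
        have "norm (?G q - cv (X.law (snd q)) f (x + fst p)) \<le> C * norm ((x + fst q) - (x + fst p))"
          unfolding bdlip_def by blast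
        then show "norm (?G q - cv (X.law (snd q)) f (x + fst p)) \<le> C * norm (fst q - fst p)" by simp
      qed
      have "((\<lambda>q. C * norm (fst q - fst p)) \<longlongrightarrow> C * norm (fst p - fst p)) (at p within ?S)"
        by (intro tendsto_intros)
      then show "((\<lambda>q. C * norm (fst q - fst p)) \<longlongrightarrow> 0) (at p within ?S)" by simp
    qed
    from tendsto_add[OF this l] show "(?G \<longlongrightarrow> ?G p) (at p within ?S)" by simp
  qed
  then have "(\<lambda>p. indicator ?S p *\<^sub>R ?G p) \<in> borel_measurable borel"
    by (intro borel_measurable_continuous_on_indicator) (auto intro!: borel_closed closed_Times)
  also have "(\<lambda>p. indicator ?S p *\<^sub>R ?G p) = (\<lambda>(y, v). indicator {0..} v *\<^sub>R cv (X.law v) f (x + y))"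
    by (auto simp: indicator_def)
  finally show ?thesis by (simp add: borel_prod)
qed

lemma AE_H_law: "t \<in> {0..} \<Longrightarrow> AE s in H.law t. s \<in> {0..}"
  unfolding H.law_def using H_orthant[of t] H.X_measurable[of t] by (subst AE_distr_iff) auto

text \<open>The semigroup law is read off from the mixture formula \<open>cv_sub_law\<close> rather
  than from increments of the subordinated field. The random times add because the laws of
  \<open>H\<close> convolve, the operators of \<open>X\<close> compose accordingly, and Fubini
  interchanges the two averages.\<close>

lemma cv_sub_law_add:
  fixes f :: "'b \<Rightarrow> 'v::euclidean_space"
  assumes s: "s \<in> {0..}" and t: "t \<in> {0..}" and f: "bdlip C f"
  shows "cv (sub_law (s + t)) f x = cv (sub_law s) (cv (sub_law t) f) x"
proof -
  have st: "s + t \<in> {0..}" using s t by (auto simp: add_nonneg_nonneg)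
  interpret T: borel_prob "H.law t" by (rule H.borel_prob_law[OF t])
  interpret S: borel_prob "H.law s" by (rule H.borel_prob_law[OF s])
  have ft: "bdlip C (cv (sub_law t) f)" by (rule borel_prob.bdlip_cv[OF borel_prob_sub_law[OF t] f])
  define \<Phi> where "\<Phi> w = indicator {0..} w *\<^sub>R cv (X.law w) f x" for w
  have \<Phi> [measurable]: "\<Phi> \<in> borel_measurable borel"
    unfolding \<Phi>_def[abs_def] by (rule restricted_cv_measurable[OF f])
  have \<Phi>b: "norm (\<Phi> w) \<le> C" for w unfolding \<Phi>_def by (rule restricted_cv_bound[OF f])
  \<comment> \<open>One time is fixed as \<open>u\<close>: the operator of \<open>X\<close> is moved
    under the average over the second random time and composed there, which adds \<open>u\<close>
    and \<open>v\<close>.\<close>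
  have inner: "cv (X.law u) (cv (sub_law t) f) x = (\<integral>v. \<Phi> (u + v) \<partial>H.law t)" if u: "u \<in> {0..}" for u
  proof -
    interpret U: borel_prob "X.law u" by (rule X.borel_prob_law[OF u])
    interpret pair_prob_space "X.law u" "H.law t" ..
    let ?G = "\<lambda>y v. indicator {0..} v *\<^sub>R cv (X.law v) f (x + y)"
    have "integrable (X.law u \<Otimes>\<^sub>M H.law t) (case_prod ?G)"
    proof (rule P.integrable_const_bound[where B=C])
      show "AE p in X.law u \<Otimes>\<^sub>M H.law t. norm (case_prod ?G p) \<le> C"
        by (intro AE_I2) (auto simp del: norm_scaleR intro: restricted_cv_bound[OF f])
      show "case_prod ?G \<in> borel_measurable (X.law u \<Otimes>\<^sub>M H.law t)"
        using restricted_cv_joint_measurable[OF f, of x]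
        by (simp cong: measurable_cong_sets sets_pair_measure_cong)
    qed
    from Fubini_integral[OF this]
    have "cv (X.law u) (cv (sub_law t) f) x = (\<integral>v. (\<integral>y. ?G y v \<partial>X.law u) \<partial>H.law t)"
      unfolding cv_def[of "X.law u"] cv_sub_law[OF t f] by simp
    also have "\<dots> = (\<integral>v. indicator {0..} v *\<^sub>R cv (X.law (u + v)) f x \<partial>H.law t)"
    proof (intro Bochner_Integration.integral_cong refl)
      fix v
      show "(\<integral>y. ?G y v \<partial>X.law u) = indicator {0..} v *\<^sub>R cv (X.law (u + v)) f x"
      proof (cases "v \<in> {0..}")
        case True
        have "cv (X.law (u + v)) f x = cv (X.law u) (cv (X.law v) f) x"
          using f by (intro X.cv_law_add[OF u True, where K=C] bdlip_continuous[OF f]) (auto simp: bdlip_def)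
        then show ?thesis using True by (simp add: cv_def[of "X.law u"])
      qed simp
    qed
    also have "\<dots> = (\<integral>v. \<Phi> (u + v) \<partial>H.law t)"
    proof -
      have "indicator {0..} v *\<^sub>R cv (X.law (u + v)) f x = indicator {0..} v *\<^sub>R \<Phi> (u + v)" for v
      proof (cases "v \<in> {0..}")
        case True
        then have "u + v \<in> {0..}" using u by (auto simp: add_nonneg_nonneg)
        then show ?thesis by (simp add: \<Phi>_def)
      qed simp
      then have "(\<integral>v. indicator {0..} v *\<^sub>R cv (X.law (u + v)) f x \<partial>H.law t)
         = (\<integral>v. indicator {0..} v *\<^sub>R \<Phi> (u + v) \<partial>H.law t)" by (simp only:)
      also have "\<dots> = (\<integral>v. \<Phi> (u + v) \<partial>H.law t)"
      proof (rule integral_cong_AE)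
        show "AE v in H.law t. indicator {0..} v *\<^sub>R \<Phi> (u + v) = \<Phi> (u + v)"
          using AE_H_law[OF t] by eventually_elim simp
      qed measurable
      finally show ?thesis .
    qed
    finally show ?thesis .
  qed
  have "cv (sub_law (s + t)) f x = (\<integral>u. (\<integral>v. \<Phi> (u + v) \<partial>H.law t) \<partial>H.law s)"
    unfolding cv_sub_law[OF st f] \<Phi>_def[symmetric] by (rule H.law_integral_add[OF s t \<Phi> \<Phi>b])
  also have "\<dots> = (\<integral>u. indicator {0..} u *\<^sub>R cv (X.law u) (cv (sub_law t) f) x \<partial>H.law s)"
  proof (rule integral_cong_AE)
    have "(\<lambda>(u, v). \<Phi> (u + v)) \<in> borel_measurable (H.law s \<Otimes>\<^sub>M H.law t)" by measurable
    then show "(\<lambda>u. \<integral>v. \<Phi> (u + v) \<partial>H.law t) \<in> borel_measurable (H.law s)"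
      by (rule T.borel_measurable_lebesgue_integral)
    show "(\<lambda>u. indicator {0..} u *\<^sub>R cv (X.law u) (cv (sub_law t) f) x) \<in> borel_measurable (H.law s)"
      using restricted_cv_measurable[OF ft, of x] by (simp cong: measurable_cong_sets)
    show "AE u in H.law s. (\<integral>v. \<Phi> (u + v) \<partial>H.law t) = indicator {0..} u *\<^sub>R cv (X.law u) (cv (sub_law t) f) x"
      using AE_H_law[OF s] by eventually_elim (simp add: inner)
  qed
  also have "\<dots> = cv (sub_law s) (cv (sub_law t) f) x" by (rule cv_sub_law[OF s ft, symmetric])
  finally show ?thesis .
qed

lemma conv_semigroup_sub_law: "conv_semigroup (\<lambda>t. sub_law (axis k t))"
proof (rule conv_semigroup.intro)
  show "borel_prob (sub_law (axis k t))" if "0 \<le> t" for t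
    using that by (intro borel_prob_sub_law axis_orthant)
  show "cv (sub_law (axis k (s + t))) f x = cv (sub_law (axis k s)) (cv (sub_law (axis k t)) f) x"
    if "0 \<le> s" "0 \<le> t" "bdlip C f" for s t C x and f :: "'b \<Rightarrow> real"
    unfolding H.axis_add using that by (intro cv_sub_law_add[where C=C] axis_orthant)
  have z: "axis k 0 = (0 :: real ^ 'm)" by simp
  show "cv (sub_law (axis k 0)) f x = f x" if f: "bdlip C f" for C x and f :: "'b \<Rightarrow> real"
    unfolding z using cv_sub_law[of 0 C f x] f H.law_zero[OF restricted_cv_measurable[OF f, of x]]
      X.cv_law_zero[OF bdlip_continuous[OF f], of x] by simp
  let ?m = "\<lambda>y::'b. min (norm y) 1"
  \<comment> \<open>By the mixture formula the integral of \<open>?m\<close> against the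
    subordinated law is the integral of this function against the law of \<open>H\<close>. It is
    continuous at 0 relative to the orthant, where \<open>H\<close> takes its values almost
    surely.\<close>
  let ?\<Phi> = "\<lambda>s. indicator {0..} s *\<^sub>R cv (X.law s) ?m 0"
  have \<Phi>0: "?\<Phi> 0 = 0" using X.cv_law_zero[OF bdlip_continuous[OF bdlip_min_norm], of 0] by simp
  have "((\<lambda>s. \<integral>y. ?\<Phi> y \<partial>H.law s) \<longlongrightarrow> ?\<Phi> 0) (at 0 within {0..})"
  proof (rule H.law_integral_tendsto[OF restricted_cv_measurable restricted_cv_bound H_orthant])
    have "((\<lambda>s. cv (X.law s) ?m 0) \<longlongrightarrow> cv (X.law 0) ?m 0) (at 0 within {0..})"
      using X.cv_law_continuous[OF bdlip_min_norm, of 0] by (simp add: continuous_on_def)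
    then have "((\<lambda>s. cv (X.law s) ?m 0) \<longlongrightarrow> ?\<Phi> 0) (at 0 within {0..})" by simp
    then show "(?\<Phi> \<longlongrightarrow> ?\<Phi> 0) (at 0 within {0..})"
      by (rule Lim_transform_eventually) (simp add: eventually_at_filter)
  qed (rule bdlip_min_norm)+
  then have l: "((\<lambda>t. \<integral>y. ?\<Phi> y \<partial>H.law (axis k t)) \<longlongrightarrow> 0) (at_right 0)"
    unfolding \<Phi>0 by (rule filterlim_compose[OF _ H.axis_tendsto_zero])
  show "((\<lambda>t. \<integral>z. ?m z \<partial>sub_law (axis k t)) \<longlongrightarrow> 0) (at_right 0)"
  proof (rule Lim_transform_eventually[OF l])
    show "\<forall>\<^sub>F t in at_right 0. (\<integral>y. ?\<Phi> y \<partial>H.law (axis k t)) = (\<integral>z. ?m z \<partial>sub_law (axis k t))"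
      using eventually_at_right_less[of 0]
    proof eventually_elim
      case (elim t)
      have "axis k t \<in> {0..}" using elim by (intro axis_orthant) simp
      from cv_sub_law[OF this bdlip_min_norm, of 0] show ?case by (simp add: cv_def[of "sub_law _"])
    qed
  qed
qed

end

section \<open>Identification of the generator of the subordinated semigroup\<close>

theorem theorem3p5:
  fixes M :: "'a measure"
    and X :: "real ^ 'n \<Rightarrow> 'a \<Rightarrow> real ^ 'd"
    and H :: "real ^ 'm \<Rightarrow> 'a \<Rightarrow> real ^ 'n"
    and b :: "'m \<Rightarrow> real ^ 'n"
    and \<phi> :: "'m \<Rightarrow> (real ^ 'n) measure"
    and T :: "real ^ 'n \<Rightarrow> (real ^ 'd \<Rightarrow> 'b::{real_normed_field, euclidean_space}) \<Rightarrow> real ^ 'd \<Rightarrow> 'b"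
    and TZ :: "real ^ 'm \<Rightarrow> (real ^ 'd \<Rightarrow> 'b) \<Rightarrow> real ^ 'd \<Rightarrow> 'b"
    and h :: "real ^ 'd \<Rightarrow> 'b"
    and k :: 'm
  assumes "levy_field M X"
    and "subordinator_field M H"
    and "indep_fields M X H"
    and "\<And>k. drift_and_levy_measure M H k (b k) (\<phi> k)"
    and "T = field_semigroup M X"
    and "TZ = field_semigroup M (subordinated_field X H)"
    and "h \<in> Schwartz_space"
  shows "h \<in> generator_domain T \<and> h \<in> generator_domain TZ \<and>
         (\<forall>x. set_integrable (\<phi> k) {0..} (\<lambda>z. T z h x - h x) \<and>
           generator TZ k h x =
             (\<Sum>j\<in>UNIV. (b k $ j) *\<^sub>R generator T j h x)
             + (LINT z:{0..}|\<phi> k. T z h x - h x))"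
proof -
  interpret subordination M X H
  proof (intro subordination.intro levy.intro subordination_axioms.intro)
    show "levy_field M X" "indep_fields M X H" by fact+
    show "levy_field M H" using assms(2) by (simp add: subordinator_field_def)
    show "AE \<omega> in M. H t \<omega> \<in> {0..}" if "t \<in> {0..}" for t
      using assms(2) that by (simp add: subordinator_field_def)
  qed
  obtain C where good: "good C h" using Schwartz_good[OF assms(7)] by blast
  then have bl: "bdlip C h" by (simp add: good_def)
  have hc: "continuous_on UNIV h" by (rule bdlip_continuous[OF bl])
  have C0: "h \<in> C0" by (rule Schwartz_C0[OF assms(7)])
  have "\<exists>g K. is_generator_value (\<lambda>t. T (axis j t)) h g \<and> (\<forall>x. norm (g x) \<le> K)" for j
    by (rule conv_semigroup.generator_value_exists[OF X.conv_semigroup_marginal[of j] good C0])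
      (simp add: assms(5) X.field_semigroup_eq[OF axis_orthant hc])
  then obtain g K where g: "\<And>j. is_generator_value (\<lambda>t. T (axis j t)) h (g j)"
    and gK: "\<And>j x. norm (g j x) \<le> K j" by metis
  have "\<exists>g K. is_generator_value (\<lambda>t. TZ (axis k t)) h g \<and> (\<forall>x. norm (g x) \<le> K)" for k
    by (rule conv_semigroup.generator_value_exists[OF conv_semigroup_sub_law[of k] good C0])
      (simp add: assms(6) field_semigroup_sub_law[OF axis_orthant bl])
  then obtain gZ where gZ: "\<And>k. is_generator_value (\<lambda>t. TZ (axis k t)) h (gZ k)" by metis
  have gen: "generator T j h = g j" "generator TZ k h = gZ k" for j k
    unfolding generator_def by (rule generator1_eq g gZ)+
  have dom: "h \<in> generator_domain T" "h \<in> generator_domain TZ"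
    unfolding generator_domain_def generator_domain1_def using g gZ by blast+
  note dlm = assms(4)[of k, unfolded drift_and_levy_measure_def]
  interpret S: subordinator_laws "\<lambda>t. H.law (axis k t)" "b k" "\<phi> k"
  proof (rule subordinator_laws.intro)
    show "borel_prob (H.law (axis k t))" if "0 \<le> t" for t
      using that by (intro H.borel_prob_law axis_orthant)
    show "AE s in H.law (axis k t). s \<in> {0..}" if "0 \<le> t" for t
      using that by (intro AE_H_law axis_orthant)
    show "(\<integral>s. exp (- (u \<bullet> s)) \<partial>H.law (axis k t)) = exp (- t * laplace_exponent (b k) (\<phi> k) u)"
      if t: "0 \<le> t" and u: "u \<in> {0..}" for t u
    proof -
      have "(\<integral>\<omega>. exp (- (u \<bullet> H (axis k t) \<omega>)) \<partial>M) = exp (- t * laplace_exponent (b k) (\<phi> k) u)"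
        using dlm t u by blast
      then show ?thesis
        unfolding H.law_def using H.X_measurable[OF axis_orthant[OF t]] by (subst integral_distr) auto
    qed
  qed (use dlm in auto)
  have main: "set_integrable (\<phi> k) {0..} (\<lambda>z. T z h x - h x) \<and>
      gZ k x = (\<Sum>j\<in>UNIV. (b k $ j) *\<^sub>R g j x) + (LINT z:{0..}|\<phi> k. T z h x - h x)" for x
  proof -
    define F where "F s = cv (X.law s) h x - h x" for s
    have Fc: "continuous_on {0..} F" unfolding F_def[abs_def] by (intro continuous_intros X.cv_law_continuous[OF bl])
    have Fb: "norm (F s) \<le> C + C" if "s \<in> {0..}" for s
      unfolding F_def using bdlip_diff[OF borel_prob.bdlip_cv[OF X.borel_prob_law[OF that] bl] bl]
      by (simp add: bdlip_def)
    have F0: "F 0 = 0" unfolding F_def using X.cv_law_zero[OF hc] by simp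
    \<comment> \<open>A single bound for all components exists because there are finitely many
      coordinates.\<close>
    have "norm (g j y) \<le> Max (range K)" for j y
      by (rule order_trans[OF gK Max_ge]) auto
    then have Fd: "((\<lambda>s. (F s - (\<Sum>j\<in>UNIV. (s $ j) *\<^sub>R g j x)) /\<^sub>R norm s) \<longlongrightarrow> 0) (at 0 within {0..})"
      unfolding F_def using g by (intro X.semigroup_differentiable_at_0[OF bl]) (auto simp: assms(5))
    note lim = S.small_time_limit[OF Fc Fb F0 Fd]
    have TF: "T z h x - h x = F z" if "z \<in> {0..}" for z
      unfolding F_def assms(5) using X.field_semigroup_eq[OF that hc] by simp
    have ind: "indicator {0..} z *\<^sub>R (T z h x - h x) = indicator {0..} z *\<^sub>R F z" for z
      using TF[of z] by (cases "z \<in> {0..}") simp_all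
    have int: "set_integrable (\<phi> k) {0..} (\<lambda>z. T z h x - h x)"
      and val: "(LINT z:{0..}|\<phi> k. T z h x - h x) = (LINT z:{0..}|\<phi> k. F z)"
      using lim(1) unfolding set_integrable_def set_lebesgue_integral_def ind by auto
    have "((\<lambda>t. (TZ (axis k t) h x - h x) /\<^sub>R t) \<longlongrightarrow>
       (\<Sum>j\<in>UNIV. (b k $ j) *\<^sub>R g j x) + (LINT s:{0..}|\<phi> k. F s)) (at_right 0)"
    proof (rule Lim_transform_eventually[OF lim(2)])
      show "\<forall>\<^sub>F t in at_right 0. (LINT s:{0..}|H.law (axis k t). F s) /\<^sub>R t = (TZ (axis k t) h x - h x) /\<^sub>R t"
        using eventually_at_right_less[of 0]
      proof eventually_elim
        case (elim t)
        then have t: "0 \<le> t" by simp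
        have ax: "axis k t \<in> {0..}" by (rule axis_orthant[OF t])
        interpret L: borel_prob "H.law (axis k t)" by (rule H.borel_prob_law[OF ax])
        have i: "set_integrable (H.law (axis k t)) {0..} F" by (rule S.bounded_set_integrable[OF t Fc Fb])
        have c: "set_integrable (H.law (axis k t)) {0..} (\<lambda>_. h x)"
          by (rule S.bounded_set_integrable[OF t, where K="norm (h x)"]) auto
        have "(LINT s:{0..}|H.law (axis k t). h x) = (\<integral>s. h x \<partial>H.law (axis k t))"
          unfolding set_lebesgue_integral_def
          by (rule integral_cong_AE) (use AE_H_law[OF ax] in \<open>auto elim!: eventually_mono\<close>)
        also have "\<dots> = h x" by simp
        finally have c1: "(LINT s:{0..}|H.law (axis k t). h x) = h x" .
        have "TZ (axis k t) h x = (LINT s:{0..}|H.law (axis k t). cv (X.law s) h x)"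
          unfolding assms(6) by (rule subordinated_expectation(2)[OF ax bl])
        also have "\<dots> = (LINT s:{0..}|H.law (axis k t). F s + h x)" by (simp add: F_def)
        also have "\<dots> = (LINT s:{0..}|H.law (axis k t). F s) + h x"
          using set_integral_add(2)[OF i c] c1 by simp
        finally show ?case by simp
      qed
    qed
    \<comment> \<open>The uniform limit \<open>gZ k\<close> is already known to exist; its pointwise
      value must coincide with the limit computed from the subordinator laws.\<close>
    moreover have "((\<lambda>t. (TZ (axis k t) h x - h x) /\<^sub>R t) \<longlongrightarrow> gZ k x) (at_right 0)"
      using gZ[of k] unfolding is_generator_value_def by (auto intro: tendsto_uniform_limitI)
    ultimately have "gZ k x = (\<Sum>j\<in>UNIV. (b k $ j) *\<^sub>R g j x) + (LINT s:{0..}|\<phi> k. F s)"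
      by (intro tendsto_unique[where F="at_right (0::real)"]) auto
    then show ?thesis using int val by simp
  qed
  show ?thesis using dom main unfolding gen by blast
qed

end
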